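(* Let $\Omega\subset\mathbb{R}^2$ be a disk of radius $\rho$ containing a disk $B$ of radius $r$, let $0<k<+\infty$, $k\neq1$, let $g\in\mathcal{C}^{\alpha}(\partial\Omega)$, $\alpha>0$, with $\int_{\partial\Omega}g=0$, and let $u$ be the solution of $$\begin{cases}\nabla\cdot(1+(k-1)\chi(B))\nabla u=0 & \text{in }\Omega,\\ \dfrac{\partial u}{\partial\nu}=g & \text{on }\partial\Omega,\end{cases}\qquad \int_{\partial\Omega}u=0.$$ Let $$\epsilon:=\mathrm{dist}(B,\partial\Omega),\qquad \sigma:=\frac{k-1}{k+1},\qquad r^*:=\sqrt{\frac{\rho-r}{\rho r}}.$$ (i) If $k<1$, then there exists a constant $C_1>0$ independent of $k$, $r$, $\epsilon$ and $g$ such that for $\epsilon$ small enough, $$\frac{C_1\inf_{X\in J_1}|\langle\nabla\mathcal{S}_\Omega(g)(X),T_B(X_1)\rangle|}{1+\sigma+4r^*\sqrt{\epsilon}}\le\bigl|\nabla u|_+(X_1)\bigr|$$ and $$\frac{C_1\inf_{X\in J_2}|\langle\nabla\mathcal{S}_\Omega(g)(X),T_\Omega(X_2)\rangle|}{1+\sigma+4r^*\sqrt{\epsilon}}\le\bigl|\nabla u|_-(X_2)\bigr|.$$ (ii) For any $k\neq1$, there exists a constant $C_2$ independent of $k$, $r$ and $\epsilon$ such that for $\epsilon$ small enough, $$\|\nabla u\|_{L^\infty(\Omega)}\le\frac{C_2\|g\|_{\mathcal{C}^{\alpha}(\partial\Omega)}}{1-|\sigma|+r^*\sqrt{\epsi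lon}}.$$
   Context: $\chi(B)$ is the indicator function of $B$; $\langle\cdot,\cdot\rangle$ is the scalar product in $\mathbb{R}^2$. $\nu$ is the outward unit normal; $T_B$ and $T_\Omega$ are the positively oriented unit tangent vector fields on $\partial B$ and $\partial\Omega$. The subscript $+$ at $X_1\in\partial B$ denotes the limit from outside $B$; the subscript $-$ at $X_2\in\partial\Omega$ denotes the limit from inside $\Omega$. $X_1$ is the point of $\partial B$ closest to $\partial\Omega$ and $X_2$ is the point of $\partial\Omega$ closest to $\partial B$. $R_D$ denotes the reflection with respect to the boundary of a disk $D$ with center $Z$ and radius $s$: $R_D(X)=\frac{s^2(X-Z)}{|X-Z|^2}+Z$. $P_1$ is the fixed point of $R_BR_\Omega$ lying in $B$ and $P_2$ is the fixed point of $R_\Omega R_B$ lying outside $\Omega$ (products denote composition of maps). $J_1$ is the line segment between $P_1$ and $X_1$, and $J_2$ the line segment between $P_2$ and $X_2$. The single layer potential is $$\mathcal{S}_\Omega g(X)=\frac{1}{2\pi}\int_{\partial\Omega}\ln|X-Y|\,g(Y)\,d\sigma(Y),\quad X\in\mathbb{R}^2;$$ at $X_2\in\partial\Omega$ its tangential derivative is continuous across $\partial\Omega$ and is understood as the boundary limit. (In the single layer potential $d\sigma$ is arc length, unrelated to the number $\sigma$.) *)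

theory Defs
  imports "HOL-Analysis.Analysis" "HOL-Probability.Essential_Supremum"
begin

text \<open>
  The plane is the type \<^typ>\<open>complex\<close>, with the library's real inner product; a disk is given by its
  center and radius, and functions on a circle are functions on the plane of which only the values
  on that circle are used.
\<close>

definition gradient :: "(complex \<Rightarrow> real) \<Rightarrow> complex \<Rightarrow> complex" where
  "gradient f x = (THE D. GDERIV f x :> D)"

definition arc_integral :: "complex \<Rightarrow> real \<Rightarrow> (complex \<Rightarrow> real) \<Rightarrow> real" where
  "arc_integral z s f = integral {0..2*pi} (\<lambda>t. f (z + of_real s * cis t) * s)"

definition circle_tangent :: "complex \<Rightarrow> real \<Rightarrow> complex \<Rightarrow> complex" where
  "circle_tangent z s x = \<i> * ((x - z) /\<^sub>R s)"

definition circle_reflection :: "complex \<Rightarrow> real \<Rightarrow> complex \<Rightarrow> complex" where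
  "circle_reflection z s x = (s\<^sup>2 / (norm (x - z))\<^sup>2) *\<^sub>R (x - z) + z"


subsection \<open>Hoelder spaces on a circle\<close>

text \<open>
  An exponent \<open>\<alpha> > 0\<close> is split as \<open>\<alpha> = m + \<beta>\<close> with \<open>m\<close> a natural number and \<open>0 < \<beta> \<le> 1\<close>, and
  \<open>C\<^sup>\<alpha>\<close> is the space \<open>C\<^sup>m\<^sup>,\<^sup>\<beta>\<close> with respect to arc length. For \<open>\<alpha> \<le> 1\<close> this is \<open>m = 0\<close>, the usual
  Hoelder condition; an integer \<open>\<alpha>\<close> gives \<open>C\<^sup>\<alpha>\<^sup>-\<^sup>1\<^sup>,\<^sup>1\<close>, which contains the \<open>\<alpha>\<close> times continuously
  differentiable functions.
\<close>

definition holder_order :: "real \<Rightarrow> nat" where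
  "holder_order \<alpha> = nat (\<lceil>\<alpha>\<rceil> - 1)"

definition holder_frac :: "real \<Rightarrow> real" where
  "holder_frac \<alpha> = \<alpha> - real (holder_order \<alpha>)"

definition circle_deriv :: "complex \<Rightarrow> real \<Rightarrow> (complex \<Rightarrow> real) \<Rightarrow> complex \<Rightarrow> real" where
  "circle_deriv z s g x = deriv (\<lambda>t. g (z + (x - z) * cis (t / s))) 0"

definition holder_circle :: "complex \<Rightarrow> real \<Rightarrow> real \<Rightarrow> (complex \<Rightarrow> real) \<Rightarrow> bool" where
  "holder_circle z s \<alpha> g \<longleftrightarrow>
     (\<forall>j < holder_order \<alpha>. \<forall>x \<in> sphere z s.
        (\<lambda>t. (circle_deriv z s ^^ j) g (z + (x - z) * cis (t / s))) differentiable (at (0::real))) \<and>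
     (\<exists>C. \<forall>x \<in> sphere z s. \<forall>y \<in> sphere z s.
        \<bar>(circle_deriv z s ^^ holder_order \<alpha>) g x - (circle_deriv z s ^^ holder_order \<alpha>) g y\<bar>
          \<le> C * dist x y powr holder_frac \<alpha>)"

definition holder_norm :: "complex \<Rightarrow> real \<Rightarrow> real \<Rightarrow> (complex \<Rightarrow> real) \<Rightarrow> real" where
  "holder_norm z s \<alpha> g =
     (\<Sum>j \<le> holder_order \<alpha>. SUP x \<in> sphere z s. \<bar>(circle_deriv z s ^^ j) g x\<bar>) +
     (SUP (x, y) \<in> {(x, y). x \<in> sphere z s \<and> y \<in> sphere z s \<and> x \<noteq> y}.
        \<bar>(circle_deriv z s ^^ holder_order \<alpha>) g x - (circle_deriv z s ^^ holder_order \<alpha>) g y\<bar>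
          / dist x y powr holder_frac \<alpha>)"


subsection \<open>The single layer potential\<close>

definition single_layer :: "complex \<Rightarrow> real \<Rightarrow> (complex \<Rightarrow> real) \<Rightarrow> complex \<Rightarrow> real" where
  "single_layer z s g x = 1 / (2*pi) * arc_integral z s (\<lambda>y. ln (norm (x - y)) * g y)"

text \<open>
  \<open>\<langle>\<nabla>S g(x), T\<rangle>\<close>. At a point of the circle, where the normal derivative of the potential jumps, it is
  the boundary limit; that limit is two-sided, and exists for \<open>T\<close> tangent to the circle at \<open>x\<close>.
\<close>

definition single_layer_deriv ::
    "complex \<Rightarrow> real \<Rightarrow> (complex \<Rightarrow> real) \<Rightarrow> complex \<Rightarrow> complex \<Rightarrow> real" where
  "single_layer_deriv z s g T x =
     (if x \<in> sphere z s
      then Lim (at x within - sphere z s) (\<lambda>y. gradient (single_layer z s g) y \<bullet> T)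
      else gradient (single_layer z s g) x \<bullet> T)"


subsection \<open>Weak solutions of the conductivity problem\<close>

definition C1_test :: "complex set \<Rightarrow> (complex \<Rightarrow> real) \<Rightarrow> bool" where
  "C1_test U \<phi> \<longleftrightarrow>
     (\<forall>x. \<phi> differentiable (at x)) \<and> continuous_on UNIV (gradient \<phi>) \<and>
     compact (closure {x. \<phi> x \<noteq> 0}) \<and> closure {x. \<phi> x \<noteq> 0} \<subseteq> U"

text \<open>\<open>u\<close> belongs to the Sobolev space \<open>H\<^sup>1(U)\<close> and has weak gradient \<open>G\<close>.\<close>

definition H1_gradient ::
    "complex set \<Rightarrow> (complex \<Rightarrow> real) \<Rightarrow> (complex \<Rightarrow> complex) \<Rightarrow> bool" where
  "H1_gradient U u G \<longleftrightarrow>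
     u \<in> borel_measurable (lebesgue_on U) \<and> integrable (lebesgue_on U) (\<lambda>x. (u x)\<^sup>2) \<and>
     G \<in> borel_measurable (lebesgue_on U) \<and> integrable (lebesgue_on U) (\<lambda>x. (norm (G x))\<^sup>2) \<and>
     (\<forall>\<phi>. C1_test U \<phi> \<longrightarrow>
        (LINT x|lebesgue_on U. u x *\<^sub>R gradient \<phi> x) = - (LINT x|lebesgue_on U. \<phi> x *\<^sub>R G x))"

text \<open>
  The variational form of \<open>\<nabla>\<cdot>(1 + (k-1)\<chi>(B))\<nabla>u = 0\<close> in \<open>\<Omega>\<close> and \<open>\<partial>u/\<partial>\<nu> = g\<close> on \<open>\<partial>\<Omega>\<close>, normalized by
  \<open>\<integral>\<^sub>\<partial>\<^sub>\<Omega> u = 0\<close>, where \<open>\<Omega>\<close> and \<open>B\<close> are the disks with centers \<open>zO\<close>, \<open>zB\<close> and radii \<open>\<rho>\<close>, \<open>r\<close>.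
  The solution, an \<open>H\<^sup>1\<close> class, is given by its representative continuous on the closed disk, so that it
  has point values and its trace is its restriction. For the same reason the test functions are
  those of \<open>H\<^sup>1(\<Omega>)\<close> continuous up to the boundary, a dense subspace of \<open>H\<^sup>1(\<Omega>)\<close>.
\<close>

definition conductivity_solution ::
    "complex \<Rightarrow> real \<Rightarrow> complex \<Rightarrow> real \<Rightarrow> real \<Rightarrow> (complex \<Rightarrow> real) \<Rightarrow> (complex \<Rightarrow> real) \<Rightarrow> bool" where
  "conductivity_solution zO \<rho> zB r k g u \<longleftrightarrow>
     continuous_on (cball zO \<rho>) u \<and>
     (\<exists>G. H1_gradient (ball zO \<rho>) u G \<and>
        (\<forall>\<phi> H. continuous_on (cball zO \<rho>) \<phi> \<and> H1_gradient (ball zO \<rho>) \<phi> H \<longrightarrow>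
           (LINT x|lebesgue_on (ball zO \<rho>). (1 + (k - 1) * indicator (ball zB r) x) * (G x \<bullet> H x))
             = arc_integral zO \<rho> (\<lambda>y. g y * \<phi> y))) \<and>
     arc_integral zO \<rho> u = 0"

end

theory Submission
  imports Defs "HOL-Complex_Analysis.Complex_Analysis"
begin

text \<open>
  The gradient of a harmonic function is the conjugate of a holomorphic one. Without inclusion the
  solution is \<open>-2 S\<^sub>\<Omega> g\<close>; let \<open>f\<close> be the conjugate of its gradient, which by the Hoelder condition is
  continuous on the closed disk. The map \<open>M = R\<^sub>B R\<^sub>\<Omega>\<close> is a Moebius map of \<open>\<Omega>\<close> into \<open>B\<close> with attracting
  fixed point \<open>P\<^sub>1\<close> and multiplier \<open>\<lambda>\<close>, and the method of images gives the conjugate gradient of the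
  solution as \<open>(1 - \<sigma>) h\<close> in \<open>B\<close> and as \<open>h\<close> plus \<open>\<sigma>\<close> times its reflection in \<open>\<partial>B\<close> outside \<open>B\<close>, where
  \<open>h = \<Sum> (-\<sigma>)\<^sup>n (M\<^sup>n)' (f \<circ> M\<^sup>n)\<close>. Since \<open>\<bar>(M\<^sup>n)'\<bar> \<le> 4 \<lambda>\<^sup>n\<close> and \<open>1 - \<lambda>\<close> is comparable to \<open>r\<^sup>* \<surd>\<epsilon>\<close>, summing the
  geometric series yields (ii). For \<open>\<sigma> \<le> 0\<close> and on the line of centers the derivatives \<open>(M\<^sup>n)'\<close> are at
  least \<open>\<lambda>\<^sup>n\<close> and the tangential components of all terms have the same sign, which yields (i). The
  series is the solution because weak solutions are unique; Green's identity across the circles is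
  obtained from the divergence theorem for compactly supported functions by radial cutoffs.
\<close>

subsection \<open>Rotation invariance and integrals of gradients\<close>

text \<open>Weak gradients have no values on a curve, so boundary terms cannot be read off on the
  circles themselves: each circle is approached by thin shells strictly on one side of it. What such
  shells converge to follows from two facts, invariance of Lebesgue measure under rotations and the
  vanishing of the integral of a compactly supported gradient.

  The factor -2 is the jump relation: for a density of mean zero the normal derivative of the
  potential from inside the disk is -g/2.

  The position of B enters the size estimates through \<open>lam\<close> only: (M^n)' is comparable
  to \<open>lam ^ n\<close> with factors independent of r and \<epsilon>, on the closed disk from
  above and on the line of centers from below. All blow-up is thus carried by 1 - |\<sigma>|
  \<open>lam\<close>, which lies between the larger of 1 - |\<sigma>| and 1 - \<open>lam\<close> and
  their sum.

  In (i) the segment J_2 lies outside \<Omega>, where the series gives no information. Reflection in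
  \<partial>\<Omega> carries it to the segment from P_1 to X_2 and relates the tangential
  derivatives of the potential by a factor of modulus at most 1, so both lower bounds come from
  points inside.\<close>

lemma measurable_Complex [measurable]:
  "(\<lambda>p. Complex (fst p) (snd p)) \<in> borel_measurable borel"
  by (intro borel_measurable_continuous_onI) (auto simp: Complex_eq intro!: continuous_intros)

text \<open>Both measures give every box the product of its side lengths. The identification turns
  planar integrals into iterated ones, where one-dimensional facts apply.\<close>

lemma lborel_complex:
  "distr (lborel :: (real \<times> real) measure) borel (\<lambda>p. Complex (fst p) (snd p)) = lborel"
proof (rule lborel_eqI[symmetric])
  fix l u :: complex
  assume lu: "\<And>b. b \<in> Basis \<Longrightarrow> l \<bullet> b \<le> u \<bullet> b"
  have "(\<lambda>p. Complex (fst p) (snd p)) -` box l u = box (Re l, Im l) (Re u, Im u)"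
    by (auto simp: box_def Basis_complex_def Basis_prod_def)
  moreover have "Re l \<le> Re u" "Im l \<le> Im u"
    using lu[of 1] lu[of \<i>] by (auto simp: Basis_complex_def)
  ultimately show "emeasure (distr lborel borel (\<lambda>p. Complex (fst p) (snd p))) (box l u)
      = (\<Prod>b\<in>Basis. (u - l) \<bullet> b)"
    apply (simp add: emeasure_distr)
    apply (subst emeasure_lborel_box)
     apply (auto simp: Basis_prod_def Basis_complex_def)
    done
qed simp

lemma nn_integral_complex:
  assumes [measurable]: "f \<in> borel_measurable borel"
  shows "(\<integral>\<^sup>+z. f z \<partial>lborel) = (\<integral>\<^sup>+x. \<integral>\<^sup>+y. f (Complex x y) \<partial>lborel \<partial>lborel)"
    and "(\<integral>\<^sup>+z. f z \<partial>lborel) = (\<integral>\<^sup>+y. \<integral>\<^sup>+x. f (Complex x y) \<partial>lborel \<partial>lborel)"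
proof -
  have *: "(\<integral>\<^sup>+z. f z \<partial>lborel) = (\<integral>\<^sup>+p. f (Complex (fst p) (snd p)) \<partial>(lborel \<Otimes>\<^sub>M lborel))"
    by (subst lborel_complex[symmetric]) (simp add: nn_integral_distr lborel_prod)
  have [measurable]: "(\<lambda>p. f (Complex (fst p) (snd p))) \<in> borel_measurable (lborel \<Otimes>\<^sub>M lborel)"
    unfolding lborel_prod by measurable
  show "(\<integral>\<^sup>+z. f z \<partial>lborel) = (\<integral>\<^sup>+x. \<integral>\<^sup>+y. f (Complex x y) \<partial>lborel \<partial>lborel)"
    unfolding * by (subst lborel.nn_integral_fst[symmetric]) auto
  show "(\<integral>\<^sup>+z. f z \<partial>lborel) = (\<integral>\<^sup>+y. \<integral>\<^sup>+x. f (Complex x y) \<partial>lborel \<partial>lborel)"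
    unfolding * by (subst lborel_pair.nn_integral_snd[symmetric]) (auto simp: split_def)
qed

lemma integral_complex:
  fixes f :: "complex \<Rightarrow> real"
  assumes "integrable lborel f"
  shows "integral\<^sup>L lborel f = (\<integral>x. (\<integral>y. f (Complex x y) \<partial>lborel) \<partial>lborel)"
    and "integral\<^sup>L lborel f = (\<integral>y. (\<integral>x. f (Complex x y) \<partial>lborel) \<partial>lborel)"
    and "AE x in lborel. integrable lborel (\<lambda>y. f (Complex x y))"
    and "AE y in lborel. integrable lborel (\<lambda>x. f (Complex x y))"
proof -
  have [measurable]: "f \<in> borel_measurable borel"
    using assms by auto
  have i: "integrable (lborel \<Otimes>\<^sub>M lborel) (\<lambda>p. f (Complex (fst p) (snd p)))"
    using assms by (subst (asm) lborel_complex[symmetric]) (simp add: integrable_distr_eq lborel_prod)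
  then have i': "integrable (lborel \<Otimes>\<^sub>M lborel) (\<lambda>(x,y). f (Complex x y))"
    by (simp add: split_def)
  have *: "integral\<^sup>L lborel f = (\<integral>p. f (Complex (fst p) (snd p)) \<partial>(lborel \<Otimes>\<^sub>M lborel))"
    by (subst lborel_complex[symmetric]) (simp add: integral_distr lborel_prod)
  show "integral\<^sup>L lborel f = (\<integral>x. (\<integral>y. f (Complex x y) \<partial>lborel) \<partial>lborel)"
    unfolding * using lborel_pair.integral_fst'[OF i] by simp
  show "integral\<^sup>L lborel f = (\<integral>y. (\<integral>x. f (Complex x y) \<partial>lborel) \<partial>lborel)"
    unfolding * using lborel_pair.integral_snd[OF i'] by (simp add: split_def)
  show "AE x in lborel. integrable lborel (\<lambda>y. f (Complex x y))"
    using lborel_pair.AE_integrable_fst'[OF i] by simp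
  show "AE y in lborel. integrable lborel (\<lambda>x. f (Complex x y))"
    using lborel_pair.AE_integrable_snd[OF i'] by simp
qed

text \<open>A shear translates every line parallel to its axis by a constant amount, so Tonelli's
  theorem reduces the claim to translation invariance on the real line.\<close>

lemma distr_shear:
  fixes a :: real
  shows "distr lborel borel (\<lambda>z. Complex (Re z + a * Im z) (Im z)) = (lborel :: complex measure)" (is ?P)
    and "distr lborel borel (\<lambda>z. Complex (Re z) (Im z + a * Re z)) = (lborel :: complex measure)" (is ?Q)
proof -
  have m: "(\<lambda>z. Complex (Re z + a * Im z) (Im z)) \<in> borel_measurable borel"
      "(\<lambda>z. Complex (Re z) (Im z + a * Re z)) \<in> borel_measurable borel"
    by (intro borel_measurable_continuous_onI; auto simp: Complex_eq intro!: continuous_intros)+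
  note [measurable] = m
  show ?P
  proof (rule measure_eqI)
    fix A :: "complex set" assume "A \<in> sets (distr lborel borel (\<lambda>z. Complex (Re z + a * Im z) (Im z)))"
    then have [measurable]: "A \<in> sets borel" by simp
    have "emeasure (distr lborel borel (\<lambda>z. Complex (Re z + a * Im z) (Im z))) A
        = (\<integral>\<^sup>+z. indicator A (Complex (Re z + a * Im z) (Im z)) \<partial>lborel)"
      by (subst nn_integral_indicator[symmetric], simp, subst nn_integral_distr) auto
    also have "\<dots> = (\<integral>\<^sup>+y. \<integral>\<^sup>+x. indicator A (Complex (x + a * y) y) \<partial>lborel \<partial>lborel)"
      by (subst nn_integral_complex(2)) auto
    also have "\<dots> = (\<integral>\<^sup>+y. \<integral>\<^sup>+x. indicator A (Complex x y) \<partial>lborel \<partial>lborel)"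
    proof (rule nn_integral_cong)
      fix y :: real
      have "(\<lambda>x. Complex x y) \<in> borel_measurable borel"
        by (intro borel_measurable_continuous_onI) (auto simp: Complex_eq intro!: continuous_intros)
      then have "(\<lambda>x. indicator A (Complex x y) :: ennreal) \<in> borel_measurable borel"
        by measurable
      from nn_integral_real_affine[OF this, of 1 "a * y"]
      show "(\<integral>\<^sup>+x. indicator A (Complex (x + a * y) y) \<partial>lborel)
          = (\<integral>\<^sup>+x. indicator A (Complex x y) \<partial>lborel)"
        by (simp add: add.commute)
    qed
    also have "\<dots> = emeasure lborel A"
      by (subst nn_integral_complex(2)[symmetric]) auto
    finally show "emeasure (distr lborel borel (\<lambda>z. Complex (Re z + a * Im z) (Im z))) A
        = emeasure lborel A" .
  qed simp
  show ?Q
  proof (rule measure_eqI)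
    fix A :: "complex set" assume "A \<in> sets (distr lborel borel (\<lambda>z. Complex (Re z) (Im z + a * Re z)))"
    then have [measurable]: "A \<in> sets borel" by simp
    have "emeasure (distr lborel borel (\<lambda>z. Complex (Re z) (Im z + a * Re z))) A
        = (\<integral>\<^sup>+z. indicator A (Complex (Re z) (Im z + a * Re z)) \<partial>lborel)"
      by (subst nn_integral_indicator[symmetric], simp, subst nn_integral_distr) auto
    also have "\<dots> = (\<integral>\<^sup>+x. \<integral>\<^sup>+y. indicator A (Complex x (y + a * x)) \<partial>lborel \<partial>lborel)"
      by (subst nn_integral_complex(1)) auto
    also have "\<dots> = (\<integral>\<^sup>+x. \<integral>\<^sup>+y. indicator A (Complex x y) \<partial>lborel \<partial>lborel)"
    proof (rule nn_integral_cong)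
      fix x :: real
      have "(\<lambda>y. Complex x y) \<in> borel_measurable borel"
        by (intro borel_measurable_continuous_onI) (auto simp: Complex_eq intro!: continuous_intros)
      then have "(\<lambda>y. indicator A (Complex x y) :: ennreal) \<in> borel_measurable borel"
        by measurable
      from nn_integral_real_affine[OF this, of 1 "a * x"]
      show "(\<integral>\<^sup>+y. indicator A (Complex x (y + a * x)) \<partial>lborel)
          = (\<integral>\<^sup>+y. indicator A (Complex x y) \<partial>lborel)"
        by (simp add: add.commute)
    qed
    also have "\<dots> = emeasure lborel A"
      by (subst nn_integral_complex(1)[symmetric]) auto
    finally show "emeasure (distr lborel borel (\<lambda>z. Complex (Re z) (Im z + a * Re z))) A
        = emeasure lborel A" .
  qed simp
qed

text \<open>A rotation other than the half turn is a product of three shears.\<close>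

lemma distr_rotation:
  assumes "norm c = 1"
  shows "distr lborel borel (\<lambda>z. c * z) = (lborel :: complex measure)"
proof -
  have main: "distr lborel borel (\<lambda>z. c * z) = (lborel :: complex measure)"
    if c: "norm c = 1" "c \<noteq> -1" for c :: complex
  proof -
    have q: "(Re c)\<^sup>2 + (Im c)\<^sup>2 = 1"
      using c by (metis cmod_power2 one_power2)
    have ne: "1 + Re c \<noteq> 0"
    proof
      assume "1 + Re c = 0"
      then have "Re c = -1" by simp
      with q have "Im c = 0" by simp
      with \<open>Re c = -1\<close> have "c = -1" by (simp add: complex_eq_iff)
      with c show False by simp
    qed
    \<comment> \<open>For \<open>c = cis \<theta>\<close> this is - tan(\<theta>/2). The shears with
      coefficients \<open>a\<close>, \<open>Im c\<close>, \<open>a\<close> compose to multiplication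
      by \<open>c\<close>; the two identities that follow are half-angle formulas.\<close>
    define a where "a = - Im c / (1 + Re c)"
    have ab: "1 + a * Im c = Re c"
    proof -
      have "(Im c)\<^sup>2 = (1 - Re c) * (1 + Re c)"
        using q by (simp add: algebra_simps power2_eq_square)
      then have "a * Im c = - (1 - Re c)"
        using ne by (simp add: a_def power2_eq_square)
      then show ?thesis by simp
    qed
    have a2: "a * (1 + Re c) = - Im c"
      using ne by (simp add: a_def)
    let ?s = "\<lambda>z. Complex (Re z + a * Im z) (Im z)"
    let ?t = "\<lambda>z. Complex (Re z) (Im z + Im c * Re z)"
    have m: "?s \<in> borel_measurable borel" "?t \<in> borel_measurable borel"
      by (intro borel_measurable_continuous_onI; auto simp: Complex_eq intro!: continuous_intros)+
    have eq: "?s (?t (?s z)) = c * z" for z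
    proof -
      have "Re z + a * Im z + a * (Im z + Im c * (Re z + a * Im z))
          = Re z * (1 + a * Im c) + Im z * (a * (1 + (1 + a * Im c)))"
        by (simp add: algebra_simps)
      also have "\<dots> = Re c * Re z - Im c * Im z"
        unfolding ab a2 by simp
      finally have 1: "Re z + a * Im z + a * (Im z + Im c * (Re z + a * Im z)) = Re c * Re z - Im c * Im z" .
      have "Im z + Im c * (Re z + a * Im z) = Im z * (1 + a * Im c) + Im c * Re z"
        by (simp add: algebra_simps)
      also have "\<dots> = Re c * Im z + Im c * Re z"
        unfolding ab by simp
      finally show ?thesis using 1 by (simp add: complex_eq_iff)
    qed
    have "distr lborel borel (\<lambda>z. c * z) = distr lborel borel (?s \<circ> (?t \<circ> ?s))"
      unfolding comp_def by (simp only: eq)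
    also have "\<dots> = distr (distr (distr lborel borel ?s) borel ?t) borel ?s"
      using m by (subst distr_distr, simp, simp, subst distr_distr, simp_all)
    also have "\<dots> = lborel"
      by (simp only: distr_shear)
    finally show ?thesis .
  qed
  show ?thesis
  proof (cases "c = -1")
    case True
    \<comment> \<open>The half turn, where the half-angle tangent is infinite, is the square of the
      quarter turn.\<close>
    have i: "norm \<i> = 1" "\<i> \<noteq> -1"
      by (auto simp: complex_eq_iff)
    have "distr lborel borel (\<lambda>z. c * z) = distr lborel borel ((\<lambda>z. \<i> * z) \<circ> (\<lambda>z. \<i> * z))"
      unfolding comp_def by (simp add: True)
    also have "\<dots> = distr (distr lborel borel (\<lambda>z. \<i> * z)) borel (\<lambda>z. \<i> * z)"
      by (simp add: distr_distr)
    also have "\<dots> = lborel"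
      by (simp only: main[OF i])
    finally show ?thesis .
  qed (use main assms in blast)
qed

lemma integral_rotation:
  fixes f :: "complex \<Rightarrow> real"
  assumes "integrable lborel f" and "norm c = 1"
  shows "integrable lborel (\<lambda>x. f (z + c * (x - z)))"
    and "(\<integral>x. f (z + c * (x - z)) \<partial>lborel) = integral\<^sup>L lborel f"
proof -
  have "distr lborel borel (\<lambda>x. z + c * (x - z))
      = distr (distr (distr lborel borel (\<lambda>x. -z + x)) borel (\<lambda>x. c * x)) borel (\<lambda>x. z + x)"
    by (simp add: distr_distr comp_def)
  also have "\<dots> = lborel"
    by (simp only: lborel_distr_plus distr_rotation[OF assms(2)])
  finally have d: "distr lborel borel (\<lambda>x. z + c * (x - z)) = lborel" .
  have m: "f \<in> borel_measurable borel" using assms by auto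
  show "integrable lborel (\<lambda>x. f (z + c * (x - z)))"
    using assms(1) m by (subst (asm) d[symmetric]) (simp add: integrable_distr_eq)
  show "(\<integral>x. f (z + c * (x - z)) \<partial>lborel) = integral\<^sup>L lborel f"
    using m by (subst (2) d[symmetric]) (simp add: integral_distr)
qed

section \<open>Gradients and the divergence theorem for compactly supported functions\<close>

lemma gradient_eqI: "GDERIV f x :> D \<Longrightarrow> gradient f x = D"
  unfolding gradient_def
proof (rule the_equality)
  fix D' assume "GDERIV f x :> D" "GDERIV f x :> D'"
  then have "(\<lambda>h. h \<bullet> D) = (\<lambda>h. h \<bullet> D')"
    unfolding gderiv_def by (rule has_derivative_unique)
  then have "D \<bullet> (D - D') = 0" "D' \<bullet> (D - D') = 0"
    by (metis inner_commute inner_diff_right right_minus_eq)+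
  then have "(D - D') \<bullet> (D - D') = 0"
    by (simp add: inner_diff_left)
  then show "D' = D" by simp
qed

lemma GDERIV_along_axes:
  assumes "GDERIV f (Complex x y) :> D"
  shows "((\<lambda>t. f (Complex t y)) has_vector_derivative Re D) (at x)"
    and "((\<lambda>t. f (Complex x t)) has_vector_derivative Im D) (at y)"
proof -
  have 1: "((\<lambda>t. Complex t y) has_derivative (\<lambda>h. of_real h)) (at x)"
    unfolding Complex_eq by (auto intro!: derivative_eq_intros)
  have 2: "((\<lambda>t. Complex x t) has_derivative (\<lambda>h. \<i> * of_real h)) (at y)"
    unfolding Complex_eq by (auto intro!: derivative_eq_intros)
  note f = assms[unfolded gderiv_def]
  show "((\<lambda>t. f (Complex t y)) has_vector_derivative Re D) (at x)"
    using has_derivative_compose[OF 1 f] by (simp add: has_vector_derivative_def inner_complex_def)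
  show "((\<lambda>t. f (Complex x t)) has_vector_derivative Im D) (at y)"
    using has_derivative_compose[OF 2 f] by (simp add: has_vector_derivative_def inner_complex_def)
qed

text \<open>The finite exceptional set accommodates the kinks where the line crosses a circle. The
  fundamental theorem still applies to a continuous primitive, whose values at both ends
  vanish.\<close>

lemma integral_line_derivative:
  fixes f f' :: "real \<Rightarrow> real"
  assumes i: "integrable lborel f'" and N: "finite N" and f: "continuous_on UNIV f"
    and R: "R > 0" and z: "\<And>x. \<bar>x\<bar> \<ge> R \<Longrightarrow> f x = 0" "\<And>x. \<bar>x\<bar> > R \<Longrightarrow> f' x = 0"
    and d: "\<And>x. x \<notin> N \<Longrightarrow> (f has_vector_derivative f' x) (at x)"
  shows "integral\<^sup>L lborel f' = 0"
proof -
  have "(f' has_integral (f R - f (-R))) {-R..R}"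
    by (rule fundamental_theorem_of_calculus_interior_strong[OF N])
       (use R d f in \<open>auto intro: continuous_on_subset\<close>)
  then have "(f' has_integral 0) {-R..R}"
    using z(1)[of R] z(1)[of "-R"] R by simp
  then have "(f' has_integral 0) UNIV"
    by (rule has_integral_on_superset) (auto intro!: z(2))
  then show ?thesis
    using has_integral_integral_lborel[OF i] has_integral_unique by blast
qed

text \<open>Along every line parallel to an axis the function is piecewise differentiable, so that Fubini's
  theorem reduces the divergence theorem to the fundamental theorem of calculus.\<close>

lemma integral_gradient_zero:
  fixes f :: "complex \<Rightarrow> real" and D :: "complex \<Rightarrow> complex"
  assumes i: "integrable lborel D" and f: "continuous_on UNIV f"
    and N: "\<And>a. finite {t. Complex a t \<in> N}" "\<And>a. finite {t. Complex t a \<in> N}"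
    and R: "R > 0" and z: "\<And>x. norm x \<ge> R \<Longrightarrow> f x = 0" "\<And>x. norm x > R \<Longrightarrow> D x = 0"
    and d: "\<And>x. x \<notin> N \<Longrightarrow> GDERIV f x :> D x"
  shows "integral\<^sup>L lborel D = 0"
proof -
  have iR: "integrable lborel (\<lambda>x. Re (D x))" and iI: "integrable lborel (\<lambda>x. Im (D x))"
    using i by auto
  have le: "\<bar>x\<bar> \<le> norm (Complex x y)" "\<bar>y\<bar> \<le> norm (Complex x y)" for x y
    using abs_Re_le_cmod[of "Complex x y"] abs_Im_le_cmod[of "Complex x y"] by auto
  have z': "R \<le> \<bar>x\<bar> \<Longrightarrow> f (Complex x y) = 0" "R \<le> \<bar>y\<bar> \<Longrightarrow> f (Complex x y) = 0"
    "R < \<bar>x\<bar> \<Longrightarrow> D (Complex x y) = 0" "R < \<bar>y\<bar> \<Longrightarrow> D (Complex x y) = 0" for x y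
    using le[of x y] le(2)[of y x] z[of "Complex x y"] by force+
  have "integral\<^sup>L lborel (\<lambda>x. Re (D x)) = (\<integral>y. (\<integral>x. Re (D (Complex x y)) \<partial>lborel) \<partial>lborel)"
    by (rule integral_complex(2)[OF iR])
  also have "\<dots> = 0"
  proof (rule integral_eq_zero_AE)
    show "AE y in lborel. (\<integral>x. Re (D (Complex x y)) \<partial>lborel) = 0"
      using integral_complex(4)[OF iR]
    proof eventually_elim
      case (elim y)
      have c: "continuous_on UNIV (\<lambda>x. f (Complex x y))"
        by (rule continuous_on_compose2[OF f]) (auto simp: Complex_eq intro!: continuous_intros)
      show ?case
        by (rule integral_line_derivative[OF elim N(2)[of y] c R])
           (auto intro!: GDERIV_along_axes d simp: z')
    qed
  qed
  finally have 1: "integral\<^sup>L lborel (\<lambda>x. Re (D x)) = 0" by simp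
  have "integral\<^sup>L lborel (\<lambda>x. Im (D x)) = (\<integral>x. (\<integral>y. Im (D (Complex x y)) \<partial>lborel) \<partial>lborel)"
    by (rule integral_complex(1)[OF iI])
  also have "\<dots> = 0"
  proof (rule integral_eq_zero_AE)
    show "AE x in lborel. (\<integral>y. Im (D (Complex x y)) \<partial>lborel) = 0"
      using integral_complex(3)[OF iI]
    proof eventually_elim
      case (elim x)
      have c: "continuous_on UNIV (\<lambda>y. f (Complex x y))"
        by (rule continuous_on_compose2[OF f]) (auto simp: Complex_eq intro!: continuous_intros)
      show ?case
        by (rule integral_line_derivative[OF elim N(1)[of x] c R])
           (auto intro!: GDERIV_along_axes d simp: z')
    qed
  qed
  finally have 2: "integral\<^sup>L lborel (\<lambda>x. Im (D x)) = 0" by simp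
  show ?thesis
    using 1 2 i by (simp add: complex_eq_iff)
qed

subsection \<open>Circles as limits of shells\<close>

lemma DERIV_max_power2:
  "DERIV (\<lambda>t. (max 0 t)\<^sup>2) t :> 2 * max 0 (t::real)"
proof -
  consider "t > 0" | "t = 0" | "t < 0" by linarith
  then show ?thesis
  proof cases
    case 1
    have "DERIV (\<lambda>t. t\<^sup>2) t :> 2 * max 0 t"
      using 1 by (auto intro!: derivative_eq_intros)
    then show ?thesis
      by (rule has_field_derivative_transform_within_open[of _ _ _ "{0<..}"]) (use 1 in auto)
  next
    case 2
    show ?thesis
      unfolding CARAT_DERIV
      by (rule exI[of _ "\<lambda>z. max 0 z"]; intro conjI continuous_intros)
        (auto simp: 2 max_def power2_eq_square)
  next
    case 3
    have "DERIV (\<lambda>t. 0) t :> 2 * max 0 t"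
      using 3 by (auto intro!: derivative_eq_intros)
    then show ?thesis
      by (rule has_field_derivative_transform_within_open[of _ _ _ "{..<0}"]) (use 3 in auto)
  qed
qed

text \<open>A transition from 1 to 0 across the interval from A to B that is just smooth enough for
  C^1 test functions: squares of positive parts are C^1, and for \<open>A < B\<close> the two never
  vanish together, so the quotient is C^1 as well.\<close>

definition step_fn :: "real \<Rightarrow> real \<Rightarrow> real \<Rightarrow> real" where
  "step_fn A B t = (max 0 (B - t))\<^sup>2 / ((max 0 (B - t))\<^sup>2 + (max 0 (t - A))\<^sup>2)"

definition step_fn' :: "real \<Rightarrow> real \<Rightarrow> real \<Rightarrow> real" where
  "step_fn' A B t = - (2 * max 0 (B - t) * (max 0 (t - A))\<^sup>2 + (max 0 (B - t))\<^sup>2 * (2 * max 0 (t - A)))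
     / ((max 0 (B - t))\<^sup>2 + (max 0 (t - A))\<^sup>2)\<^sup>2"

lemma step_fn_denom:
  fixes A B t :: real
  assumes "A < B" shows "(max 0 (B - t))\<^sup>2 + (max 0 (t - A))\<^sup>2 > 0"
  using assms by (cases "t < B") (auto simp: max_def add_pos_nonneg add_nonneg_pos)

lemma DERIV_step_fn:
  assumes "A < B" shows "DERIV (step_fn A B) t :> step_fn' A B t"
proof -
  have d1: "DERIV (\<lambda>t. B - t) t :> -1" and d2: "DERIV (\<lambda>t. t - A) t :> 1"
    by (auto intro!: derivative_eq_intros)
  have 1: "DERIV (\<lambda>t. (max 0 (B - t))\<^sup>2) t :> - (2 * max 0 (B - t))"
    using DERIV_chain2[OF DERIV_max_power2 d1] by simp
  have 2: "DERIV (\<lambda>t. (max 0 (t - A))\<^sup>2) t :> 2 * max 0 (t - A)"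
    using DERIV_chain2[OF DERIV_max_power2 d2] by simp
  note d = DERIV_divide[OF 1 DERIV_add[OF 1 2]]
  have "DERIV (\<lambda>t. (max 0 (B - t))\<^sup>2 / ((max 0 (B - t))\<^sup>2 + (max 0 (t - A))\<^sup>2)) t :> step_fn' A B t"
    using step_fn_denom[OF assms, of t]
    by (intro DERIV_cong[OF d]) (auto simp: step_fn'_def power2_eq_square algebra_simps)
  then show ?thesis
    by (simp add: step_fn_def[abs_def])
qed

lemma continuous_step_fn' [continuous_intros]:
  assumes "A < B" "continuous_on S f" shows "continuous_on S (\<lambda>x. step_fn' A B (f x))"
proof -
  have "(max 0 (B - f x))\<^sup>2 + (max 0 (f x - A))\<^sup>2 \<noteq> 0" for x
    using step_fn_denom[OF assms(1), of "f x"] by linarith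
  then show ?thesis
    unfolding step_fn'_def by (intro continuous_intros assms) auto
qed

lemma continuous_step_fn [continuous_intros]:
  assumes "A < B" "continuous_on S f" shows "continuous_on S (\<lambda>x. step_fn A B (f x))"
proof -
  have "(max 0 (B - f x))\<^sup>2 + (max 0 (f x - A))\<^sup>2 \<noteq> 0" for x
    using step_fn_denom[OF assms(1), of "f x"] by linarith
  then show ?thesis
    unfolding step_fn_def by (intro continuous_intros assms) auto
qed

lemma step_fn_eq:
  assumes "A < B"
  shows "t \<le> A \<Longrightarrow> step_fn A B t = 1" "B \<le> t \<Longrightarrow> step_fn A B t = 0"
    "0 \<le> step_fn A B t" "step_fn A B t \<le> 1"
    "t \<le> A \<Longrightarrow> step_fn' A B t = 0" "B \<le> t \<Longrightarrow> step_fn' A B t = 0"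
  using assms
  by (auto simp: step_fn_def step_fn'_def max_def divide_simps add_nonneg_nonneg sum_power2_gt_zero_iff)

lemma step_fn'_nonpos: "step_fn' A B t \<le> 0"
proof -
  have "0 \<le> 2 * max 0 (B - t) * (max 0 (t - A))\<^sup>2 + (max 0 (B - t))\<^sup>2 * (2 * max 0 (t - A))"
    by (intro add_nonneg_nonneg mult_nonneg_nonneg) auto
  then show ?thesis
    unfolding step_fn'_def
    by (intro divide_nonpos_nonneg) (simp_all only: neg_le_0_iff_le zero_le_power2)
qed

text \<open>The profile is evaluated at the squared distance, which is smooth at the center too and
  has gradient 2(x - z). Hence A and B are squares of radii.\<close>

definition cutoff :: "real \<Rightarrow> real \<Rightarrow> complex \<Rightarrow> complex \<Rightarrow> real" where
  "cutoff A B z x = step_fn A B ((norm (x - z))\<^sup>2)"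

definition cutoff_grad :: "real \<Rightarrow> real \<Rightarrow> complex \<Rightarrow> complex \<Rightarrow> complex" where
  "cutoff_grad A B z x = (2 * step_fn' A B ((norm (x - z))\<^sup>2)) *\<^sub>R (x - z)"

lemma GDERIV_norm_power2: "GDERIV (\<lambda>x. (norm (x - z))\<^sup>2) x :> 2 *\<^sub>R (x - z)"
  unfolding gderiv_def power2_norm_eq_inner
  by (auto intro!: derivative_eq_intros simp: inner_commute algebra_simps)

lemma GDERIV_cutoff:
  assumes "A < B" shows "GDERIV (cutoff A B z) x :> cutoff_grad A B z x"
  unfolding cutoff_def[abs_def] cutoff_grad_def
  using GDERIV_DERIV_compose[OF GDERIV_norm_power2 DERIV_step_fn[OF assms], of z x]
  by (simp add: algebra_simps)

lemma continuous_cutoff [continuous_intros]: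
  "A < B \<Longrightarrow> continuous_on S (cutoff A B z)" "A < B \<Longrightarrow> continuous_on S (cutoff_grad A B z)"
  unfolding cutoff_def[abs_def] cutoff_grad_def[abs_def] by (intro continuous_intros; simp)+

lemma integrable_compact_support:
  fixes f :: "complex \<Rightarrow> 'b::euclidean_space"
  assumes f: "f \<in> borel_measurable borel" and b: "\<And>x. norm (f x) \<le> M"
    and z: "\<And>x. x \<notin> S \<Longrightarrow> f x = 0" and S: "bounded S"
  shows "integrable lborel f"
proof -
  obtain R where R: "S \<subseteq> cball 0 R"
    using bounded_subset_ballD[OF S, of 0] ball_subset_cball by blast
  have "integrable lborel (\<lambda>x::complex. indicator (cball 0 R) x * M)"
    using emeasure_bounded_finite[OF bounded_cball, of "0::complex" R]
    by (intro integrable_mult_left integrable_real_indicator) auto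
  then show ?thesis
  proof (rule Bochner_Integration.integrable_bound)
    show "AE x in lborel. norm (f x) \<le> norm (indicator (cball 0 R) x * M :: real)"
      using R z b by (intro AE_I2) (force simp: indicator_def intro: order_trans[OF _ abs_ge_self])
  qed (use f in auto)
qed

lemma integrable_continuous_support:
  fixes f :: "complex \<Rightarrow> 'b::euclidean_space"
  assumes c: "continuous_on UNIV f" and K: "compact K" "\<And>x. x \<notin> K \<Longrightarrow> f x = 0"
  shows "integrable lborel f"
proof -
  have "compact (f ` K)"
    by (intro compact_continuous_image continuous_on_subset[OF c] K) auto
  then obtain M where M: "\<And>x. x \<in> K \<Longrightarrow> norm (f x) \<le> M"
    using compact_imp_bounded bounded_iff by (metis image_eqI)
  show ?thesis
  proof (rule integrable_compact_support[where M = "max 0 M" and S = K])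
    show "norm (f x) \<le> max 0 M" for x
      using M[of x] K(2)[of x] by (cases "x \<in> K") auto
  qed (use c K in \<open>auto intro: borel_measurable_continuous_onI compact_imp_bounded\<close>)
qed

lemma integrable_cutoff_weight:
  assumes "A < B"
  shows "integrable lborel (\<lambda>x. step_fn' A B ((norm (x - z))\<^sup>2))"
    and "integrable lborel (cutoff A B z)" and "integrable lborel (\<lambda>x. step_fn' A B ((norm (x - z))\<^sup>2) * (norm (x - z))\<^sup>2)"
proof -
  have S: "norm (x - z) \<ge> sqrt (max 0 B)" if "x \<notin> cball z (sqrt (max 0 B))" for x
    using that by (auto simp: dist_norm norm_minus_commute)
  then have S: "(norm (x - z))\<^sup>2 \<ge> B" if "x \<notin> cball z (sqrt (max 0 B))" for x
    using that power_mono[OF S[OF that], of 2] by auto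
  have *: "integrable lborel f" if "continuous_on UNIV f" "\<And>x. (norm (x - z))\<^sup>2 \<ge> B \<Longrightarrow> f x = 0" for f :: "complex \<Rightarrow> real"
    by (rule integrable_continuous_support[OF that(1), where K = "cball z (sqrt (max 0 B))"]) (rule compact_cball, rule that(2)[OF S])
  show "integrable lborel (\<lambda>x. step_fn' A B ((norm (x - z))\<^sup>2))"
    "integrable lborel (cutoff A B z)" "integrable lborel (\<lambda>x. step_fn' A B ((norm (x - z))\<^sup>2) * (norm (x - z))\<^sup>2)"
    by (rule *; use assms in \<open>auto simp: cutoff_def step_fn_eq intro!: continuous_intros\<close>)+
qed

text \<open>The divergence of the radial field times the cutoff is twice the cutoff plus twice the
  weight times the squared distance, and its integral vanishes. This measures a shell by an area
  without passing to polar coordinates.\<close>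

lemma integral_step_weight:
  assumes "0 < A" "A < B"
  shows "(\<integral>x. step_fn' A B ((norm (x - z))\<^sup>2) * (norm (x - z))\<^sup>2 \<partial>lborel) = - integral\<^sup>L lborel (cutoff A B z)"
proof -
  let ?w = "\<lambda>x. step_fn' A B ((norm (x - z))\<^sup>2)"
  define R where "R = norm z + sqrt B + 1"
  have R: "R > 0" using assms by (simp add: R_def add_nonneg_pos)
  have out: "B \<le> (norm (x - z))\<^sup>2" if "norm x \<ge> R" for x
  proof -
    have "sqrt B \<le> norm (x - z)"
      using that norm_triangle_ineq2[of x z] by (simp add: R_def)
    then show ?thesis
      using assms by (metis real_sqrt_le_iff real_sqrt_pow2 sqrt_le_D norm_ge_zero real_sqrt_unique)
  qed
  have D0: "cutoff A B z x *\<^sub>R c + ((x - z) \<bullet> c) *\<^sub>R cutoff_grad A B z x = 0" if "norm x \<ge> R" for x c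
    using out[OF that] assms by (simp add: cutoff_def cutoff_grad_def step_fn_eq)
  have i: "integrable lborel (\<lambda>x. cutoff A B z x *\<^sub>R c + ((x - z) \<bullet> c) *\<^sub>R cutoff_grad A B z x)" for c
  proof (rule integrable_continuous_support[where K = "cball 0 R"])
    show "continuous_on UNIV (\<lambda>x. cutoff A B z x *\<^sub>R c + ((x - z) \<bullet> c) *\<^sub>R cutoff_grad A B z x)"
      using assms by (intro continuous_intros) auto
  qed (use D0 in auto)
  have comp: "integral\<^sup>L lborel (\<lambda>x. cutoff A B z x *\<^sub>R c + ((x - z) \<bullet> c) *\<^sub>R cutoff_grad A B z x) = 0"
    for c :: complex
  proof (rule integral_gradient_zero[where f = "\<lambda>x. ((x - z) \<bullet> c) * cutoff A B z x" and N = "{}" and R = R])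
    let ?D = "\<lambda>x. cutoff A B z x *\<^sub>R c + ((x - z) \<bullet> c) *\<^sub>R cutoff_grad A B z x"
    show "\<And>x. norm x > R \<Longrightarrow> ?D x = 0" using D0 by simp
    show "integrable lborel ?D" by (rule i)
    show "continuous_on UNIV (\<lambda>x. ((x - z) \<bullet> c) * cutoff A B z x)"
      using assms by (intro continuous_intros) auto
    show "((x - z) \<bullet> c) * cutoff A B z x = 0" if "norm x \<ge> R" for x
      using out[OF that] assms by (simp add: cutoff_def step_fn_eq)
    have g: "GDERIV (\<lambda>x. (x - z) \<bullet> c) x :> c" for x
      unfolding gderiv_def by (auto intro!: derivative_eq_intros)
    show "GDERIV (\<lambda>x. ((x - z) \<bullet> c) * cutoff A B z x) x :> ?D x" for x
      using GDERIV_mult[OF g GDERIV_cutoff[OF assms(2)]] by (simp add: add.commute)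
  qed (use R in auto)
  \<comment> \<open>Taking the first component of the gradient for \<open>c = 1\<close> and the
    second for \<open>c = \<i>\<close> assembles the divergence of the radial field times the
    cutoff.\<close>
  have "0 = Re (integral\<^sup>L lborel (\<lambda>x. cutoff A B z x *\<^sub>R 1 + ((x - z) \<bullet> 1) *\<^sub>R cutoff_grad A B z x))
      + Im (integral\<^sup>L lborel (\<lambda>x. cutoff A B z x *\<^sub>R \<i> + ((x - z) \<bullet> \<i>) *\<^sub>R cutoff_grad A B z x))"
    by (simp only: comp) simp
  also have "\<dots> = (\<integral>x. Re (cutoff A B z x *\<^sub>R 1 + ((x - z) \<bullet> 1) *\<^sub>R cutoff_grad A B z x)
      + Im (cutoff A B z x *\<^sub>R \<i> + ((x - z) \<bullet> \<i>) *\<^sub>R cutoff_grad A B z x) \<partial>lborel)"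
    using i[of 1] i[of \<i>]
    by (subst Bochner_Integration.integral_add) (simp_all only: integrable_Re integrable_Im integral_Re integral_Im)
  also have "\<dots> = (\<integral>x. 2 * cutoff A B z x + 2 * (?w x * (norm (x - z))\<^sup>2) \<partial>lborel)"
  proof (intro Bochner_Integration.integral_cong refl)
    fix x :: complex
    define w where "w = ?w x"
    have "?w x * (norm (x - z))\<^sup>2 = w * ((Re (x - z))\<^sup>2 + (Im (x - z))\<^sup>2)"
      by (simp add: w_def cmod_power2)
    then show "Re (cutoff A B z x *\<^sub>R 1 + ((x - z) \<bullet> 1) *\<^sub>R cutoff_grad A B z x)
      + Im (cutoff A B z x *\<^sub>R \<i> + ((x - z) \<bullet> \<i>) *\<^sub>R cutoff_grad A B z x)
      = 2 * cutoff A B z x + 2 * (?w x * (norm (x - z))\<^sup>2)"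
      unfolding cutoff_grad_def w_def[symmetric]
      by (simp add: inner_complex_def algebra_simps power2_eq_square)
  qed
  also have "\<dots> = 2 * integral\<^sup>L lborel (cutoff A B z) + 2 * (\<integral>x. ?w x * (norm (x - z))\<^sup>2 \<partial>lborel)"
    using integrable_cutoff_weight[OF assms(2), of z] by simp
  finally show ?thesis by simp
qed

lemma measure_ball_complex: "s \<ge> 0 \<Longrightarrow> measure lborel (ball (z::complex) s) = pi * s\<^sup>2"
  "s \<ge> 0 \<Longrightarrow> measure lborel (cball (z::complex) s) = pi * s\<^sup>2"
  using content_ball[of s z] content_cball[of s z] by (simp_all add: unit_ball_vol_2)

lemma integral_cutoff_bounds:
  assumes "0 < A" "A < B"
  shows "pi * A \<le> integral\<^sup>L lborel (cutoff A B z)" "integral\<^sup>L lborel (cutoff A B z) \<le> pi * B"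
proof -
  have i: "integrable lborel (indicator (ball z (sqrt C)) :: complex \<Rightarrow> real)" for C
    using emeasure_bounded_finite[OF bounded_ball, of z "sqrt C"] by (intro integrable_real_indicator) auto
  have e: "integral\<^sup>L lborel (indicator (ball z (sqrt C)) :: complex \<Rightarrow> real) = pi * C" if "C > 0" for C
    using measure_ball_complex(1)[of "sqrt C" z] that by simp
  have s: "norm (x - z) < sqrt C \<longleftrightarrow> (norm (x - z))\<^sup>2 < C" if "C > 0" for C x
    using that by (metis real_less_rsqrt real_sqrt_less_iff real_sqrt_abs abs_norm_cancel)
  have "integral\<^sup>L lborel (indicator (ball z (sqrt A)) :: complex \<Rightarrow> real) \<le> integral\<^sup>L lborel (cutoff A B z)"
    using assms s[of A]
    by (intro integral_mono i integrable_cutoff_weight)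
       (auto simp: indicator_def cutoff_def step_fn_eq dist_norm norm_minus_commute)
  then show "pi * A \<le> integral\<^sup>L lborel (cutoff A B z)" using e assms by simp
  have "integral\<^sup>L lborel (cutoff A B z) \<le> integral\<^sup>L lborel (indicator (ball z (sqrt B)) :: complex \<Rightarrow> real)"
    using assms s[of B]
    by (intro integral_mono i integrable_cutoff_weight)
       (auto simp: indicator_def cutoff_def step_fn_eq dist_norm norm_minus_commute)
  then show "integral\<^sup>L lborel (cutoff A B z) \<le> pi * B" using e assms by simp
qed

text \<open>On the support of the weight the squared distance lies between A and B, so the mass W
  can be compared with the integral of the weight times the squared distance. That integral is the
  area under the cutoff, between the areas of the disks of radius sqrt A and sqrt B. When A and B
  approach the same positive number, W is squeezed to pi.\<close>

lemma integral_weight_bounds: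
  fixes z :: complex
  assumes "0 < A" "A < B"
  defines "W \<equiv> - (\<integral>x. step_fn' A B ((norm (x - z))\<^sup>2) \<partial>lborel)"
  shows "pi * A \<le> B * W" "A * W \<le> pi * B"
proof -
  let ?w = "\<lambda>x. step_fn' A B ((norm (x - z))\<^sup>2)"
  have W: "W = (\<integral>x. - ?w x \<partial>lborel)" by (simp add: W_def)
  note iw = integrable_cutoff_weight[OF assms(2), of z]
  have "integral\<^sup>L lborel (cutoff A B z) = (\<integral>x. - (?w x * (norm (x - z))\<^sup>2) \<partial>lborel)"
    using integral_step_weight[OF assms(1,2), of z] by simp
  moreover have "(\<integral>x. - (?w x * (norm (x - z))\<^sup>2) \<partial>lborel) \<le> (\<integral>x. B * - ?w x \<partial>lborel)"
  proof (intro integral_mono)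
    show "- (?w x * (norm (x - z))\<^sup>2) \<le> B * - ?w x" for x
      using step_fn'_nonpos[of A B "(norm (x - z))\<^sup>2"] step_fn_eq(6)[OF assms(2), of "(norm (x - z))\<^sup>2"]
      by (cases "(norm (x - z))\<^sup>2 \<le> B") (auto simp: mult.commute[of "step_fn' A B _"] mult_right_mono_neg step_fn_eq assms)
  qed (use iw in auto)
  moreover have "(\<integral>x. A * - ?w x \<partial>lborel) \<le> (\<integral>x. - (?w x * (norm (x - z))\<^sup>2) \<partial>lborel)"
  proof (intro integral_mono)
    show "A * - ?w x \<le> - (?w x * (norm (x - z))\<^sup>2)" for x
      using step_fn'_nonpos[of A B "(norm (x - z))\<^sup>2"]
      by (cases "A \<le> (norm (x - z))\<^sup>2") (auto simp: mult.commute[of "step_fn' A B _"] mult_right_mono_neg step_fn_eq assms)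
  qed (use iw in auto)
  moreover have "(\<integral>x. B * - ?w x \<partial>lborel) = B * W" "(\<integral>x. A * - ?w x \<partial>lborel) = A * W"
    using iw by (simp_all add: W)
  ultimately show "pi * A \<le> B * W" "A * W \<le> pi * B"
    using integral_cutoff_bounds[OF assms(1,2), of z] by linarith+
qed

section \<open>Averages over rotations and the limit of thin shells\<close>

lemma integral_circle_shift:
  fixes p :: "complex \<Rightarrow> 'b::banach"
  assumes p: "continuous_on (sphere 0 1) p" and c: "norm c = 1"
  shows "integral {0..2*pi} (\<lambda>t. p (cis t * c)) = integral {0..2*pi} (\<lambda>t. p (cis t))"
proof -
  obtain \<theta> where th: "0 \<le> \<theta>" "\<theta> < 2*pi" "c = cis \<theta>"
    using c complex_unimodular_polar[of c] by (auto simp: cis.code Complex_eq)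
  let ?q = "\<lambda>t. p (cis t)"
  have q: "continuous_on S ?q" for S
    by (rule continuous_on_compose2[OF p]) (auto intro!: continuous_intros)
  have iq: "?q integrable_on {a..b}" for a b
    by (intro integrable_continuous_real q)
  have "integral {0..2*pi} (\<lambda>t. p (cis t * c)) = integral {0..2*pi} (?q \<circ> (+) \<theta>)"
    by (simp add: th cis_mult comp_def add.commute)
  also have "\<dots> = integral {\<theta>..2*pi+\<theta>} ?q"
    using integral_shift_Icc_real[of 0 "2*pi" ?q \<theta>] by simp
  also have "\<dots> = integral {\<theta>..2*pi} ?q + integral {2*pi..2*pi+\<theta>} ?q"
    using th by (intro Henstock_Kurzweil_Integration.integral_combine[symmetric] iq) auto
  also have "integral {2*pi..2*pi+\<theta>} ?q = integral {0..\<theta>} (?q \<circ> (+) (2*pi))"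
    using integral_shift_Icc_real[of 0 "\<theta>" ?q "2*pi"] by (simp add: add.commute)
  also have "(?q \<circ> (+) (2*pi)) = ?q"
    by (auto simp: fun_eq_iff cis_mult[symmetric])
  also have "integral {\<theta>..2*pi} ?q + integral {0..\<theta>} ?q = integral {0..2*pi} ?q"
    using th by (subst add.commute, intro Henstock_Kurzweil_Integration.integral_combine iq) auto
  finally show ?thesis .
qed

text \<open>Rotating about z leaves the planar integral unchanged. Averaging over all angles and
  exchanging the integrals replaces the angular factor by its mean over the circle, because the
  weight is radial.\<close>

lemma integral_radial_profile:
  fixes p :: "complex \<Rightarrow> real" and z :: complex
  assumes AB: "0 < A" "A < B" and p: "continuous_on (sphere 0 1) p"
  defines "w \<equiv> \<lambda>x. step_fn' A B ((norm (x - z))\<^sup>2)"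
  defines "q \<equiv> \<lambda>v. if v \<in> sphere 0 1 then p v else 0"
  shows "integrable lborel (\<lambda>x. w x * q (sgn (x - z)))"
    and "2 * pi * (\<integral>x. w x * q (sgn (x - z)) \<partial>lborel)
      = integral\<^sup>L lborel w * integral {0..2*pi} (\<lambda>t. p (cis t))"
proof -
  have iw: "integrable lborel w"
    unfolding w_def by (rule integrable_cutoff_weight[OF AB(2)])
  then have [measurable]: "w \<in> borel_measurable borel" by auto
  have mq [measurable]: "q \<in> borel_measurable borel"
    unfolding q_def by (intro borel_measurable_continuous_on_if p) auto
  have "compact (p ` sphere 0 1)"
    by (intro compact_continuous_image p) auto
  then obtain M where M: "\<And>v. v \<in> sphere 0 1 \<Longrightarrow> norm (p v) \<le> M"
    using compact_imp_bounded bounded_iff by (metis image_eqI)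
  have qM: "norm (q v) \<le> max 0 M" for v
    using M[of v] by (auto simp: q_def)
  let ?g = "\<lambda>x. w x * q (sgn (x - z))"
  show ig: "integrable lborel ?g"
  proof (rule Bochner_Integration.integrable_bound)
    show "integrable lborel (\<lambda>x. max 0 M * w x)" using iw by simp
    show "AE x in lborel. norm (?g x) \<le> norm (max 0 M * w x)"
    proof (rule AE_I2)
      fix x
      have "\<bar>w x\<bar> * \<bar>q (sgn (x - z))\<bar> \<le> \<bar>w x\<bar> * max 0 M"
        by (intro mult_left_mono) (use qM in auto)
      then show "norm (?g x) \<le> norm (max 0 M * w x)"
        by (simp add: abs_mult mult.commute)
    qed
  qed measurable
  let ?m = "integral {0..2*pi} (\<lambda>t. p (cis t))"
  let ?I = "restrict_space lborel {0..2*pi::real}"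
  interpret I: finite_measure ?I
    by (rule finite_measureI) (auto simp: emeasure_restrict_space)
  interpret P: pair_sigma_finite ?I "lborel :: complex measure"
    by standard
  let ?f = "\<lambda>t x. w x * q (cis t * sgn (x - z))"
  have c: "cis \<in> borel_measurable ?I"
  proof -
    have "continuous_on UNIV cis" by (intro continuous_intros)
    then show ?thesis
      by (intro measurable_restrict_space1) (simp add: borel_measurable_continuous_onI)
  qed
  have "(\<lambda>(t, x). w x * q (cis t * sgn (x - z))) \<in> borel_measurable (?I \<Otimes>\<^sub>M lborel)"
  proof -
    have "(\<lambda>y. cis (fst y)) \<in> borel_measurable (?I \<Otimes>\<^sub>M (lborel :: complex measure))"
      using measurable_compose[OF measurable_fst c] .
    then have "(\<lambda>y. cis (fst y) * sgn (snd y - z)) \<in> borel_measurable (?I \<Otimes>\<^sub>M lborel)"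
      by measurable
    from measurable_compose[OF this mq]
    have "(\<lambda>y. q (cis (fst y) * sgn (snd y - z))) \<in> borel_measurable (?I \<Otimes>\<^sub>M lborel)" .
    then show ?thesis unfolding split_def by measurable
  qed
  note mf = this
  have int_f: "integrable (?I \<Otimes>\<^sub>M lborel) (case_prod ?f)"
  proof (rule Bochner_Integration.integrable_bound[OF _ mf])
    have "integrable (?I \<Otimes>\<^sub>M lborel) (\<lambda>y. w (snd y))"
    proof (rule P.Fubini_integrable)
      show "(\<lambda>y. w (snd y)) \<in> borel_measurable (?I \<Otimes>\<^sub>M lborel)" by measurable
      show "integrable ?I (\<lambda>x. LBINT y. norm (w (snd (x, y))))" by simp
      show "AE x in ?I. integrable lborel (\<lambda>y. w (snd (x, y)))" using iw by simp
    qed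
    then show "integrable (?I \<Otimes>\<^sub>M lborel) (\<lambda>y. max 0 M * w (snd y))" by simp
    show "AE y in ?I \<Otimes>\<^sub>M lborel. norm (case_prod ?f y) \<le> norm (max 0 M * w (snd y))"
    proof (rule AE_I2)
      fix y :: "real \<times> complex"
      have "\<bar>w (snd y)\<bar> * \<bar>q (cis (fst y) * sgn (snd y - z))\<bar> \<le> \<bar>w (snd y)\<bar> * max 0 M"
        by (intro mult_left_mono) (use qM in auto)
      then show "norm (case_prod ?f y) \<le> norm (max 0 M * w (snd y))"
        by (simp add: abs_mult mult.commute split_def)
    qed
  qed
  have inner_x: "(\<integral>x. ?f t x \<partial>lborel) = integral\<^sup>L lborel ?g" for t
  proof -
    have e: "w (z + cis t * (x - z)) * q (sgn (z + cis t * (x - z) - z)) = ?f t x" for x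
      by (simp add: w_def norm_mult sgn_mult)
    show ?thesis
      using integral_rotation(2)[OF ig, of "cis t" z] by (simp only: e norm_cis)
  qed
  have inner_t: "(\<integral>t. ?f t x \<partial>?I) = w x * ?m" for x
  proof (cases "x = z")
    case True
    \<comment> \<open>At the center \<open>sgn\<close> gives 0, which is not a direction; the weight
      vanishes there because A is positive.\<close>
    then show ?thesis using AB by (simp add: w_def step_fn_eq)
  next
    case False
    let ?v = "sgn (x - z)"
    have v: "norm ?v = 1" using False by (simp add: norm_sgn)
    have c: "continuous_on {0..2*pi} (\<lambda>t. p (cis t * ?v))"
      by (rule continuous_on_compose2[OF p]) (auto intro!: continuous_intros simp: norm_mult v)
    have "(\<integral>t. ?f t x \<partial>?I) = w x * (\<integral>t. p (cis t * ?v) \<partial>?I)"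
      by (simp add: q_def norm_mult v)
    also have "(\<integral>t. p (cis t * ?v) \<partial>?I) = (LINT t:{0..2*pi}|lborel. p (cis t * ?v))"
      by (subst integral_restrict_space) (auto simp: set_lebesgue_integral_def)
    also have "\<dots> = integral {0..2*pi} (\<lambda>t. p (cis t * ?v))"
      by (intro set_borel_integral_eq_integral borel_integrable_atLeastAtMost') (rule c)
    also have "\<dots> = ?m"
      by (rule integral_circle_shift[OF p v])
    finally show ?thesis .
  qed
  have "2 * pi * integral\<^sup>L lborel ?g = (\<integral>t. integral\<^sup>L lborel ?g \<partial>?I)"
    by (simp add: measure_restrict_space)
  also have "\<dots> = (\<integral>t. (\<integral>x. ?f t x \<partial>lborel) \<partial>?I)"
    by (simp only: inner_x)
  also have "\<dots> = (\<integral>x. (\<integral>t. ?f t x \<partial>?I) \<partial>lborel)"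
    by (rule P.Fubini_integral[OF int_f, symmetric])
  also have "\<dots> = (\<integral>x. w x * ?m \<partial>lborel)"
    by (simp only: inner_t)
  also have "\<dots> = integral\<^sup>L lborel w * ?m"
    by simp
  finally show "2 * pi * integral\<^sup>L lborel ?g = integral\<^sup>L lborel w * ?m" .
qed

text \<open>On a thin shell G differs little from its value at the radial projection to the circle,
  by uniform continuity on S. For a function of the direction alone the integral factors into the
  mass of the shell, which tends to pi, and the angular mean. The limit carries no factor s for arc
  length; in the application it sits in the integrand (x - z) q.\<close>

lemma shell_limit:
  fixes G :: "complex \<Rightarrow> real" and z :: complex
  assumes s: "s > 0" and AB: "\<And>n. 0 < A n" "\<And>n. A n < B n" "A \<longlonglongrightarrow> s\<^sup>2" "B \<longlonglongrightarrow> s\<^sup>2"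
    and S: "compact S" "continuous_on S G" "sphere z s \<subseteq> S"
    and shell: "\<And>n x. A n < (norm (x - z))\<^sup>2 \<Longrightarrow> (norm (x - z))\<^sup>2 < B n \<Longrightarrow> x \<in> S"
    and m: "\<And>n. (\<lambda>x. step_fn' (A n) (B n) ((norm (x - z))\<^sup>2) * G x) \<in> borel_measurable borel"
  shows "(\<lambda>n. \<integral>x. 2 * step_fn' (A n) (B n) ((norm (x - z))\<^sup>2) * G x \<partial>lborel)
     \<longlonglongrightarrow> - integral {0..2*pi} (\<lambda>t. G (z + of_real s * cis t))"
proof -
  define w where "w n x = step_fn' (A n) (B n) ((norm (x - z))\<^sup>2)" for n x
  define p where "p v = G (z + of_real s * v)" for v
  define q where "q v = (if v \<in> sphere 0 1 then p v else 0)" for v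
  let ?m = "integral {0..2*pi} (\<lambda>t. p (cis t))"
  have p: "continuous_on (sphere 0 1) p"
    unfolding p_def
    by (rule continuous_on_compose2[OF S(2)])
       (use s S(3) in \<open>auto intro!: continuous_intros simp: dist_norm norm_mult subset_iff\<close>)
  have iw: "integrable lborel (w n)" for n
    unfolding w_def by (rule integrable_cutoff_weight[OF AB(2)])
  have iq: "integrable lborel (\<lambda>x. w n x * q (sgn (x - z)))"
    and eq: "2 * pi * (\<integral>x. w n x * q (sgn (x - z)) \<partial>lborel) = integral\<^sup>L lborel (w n) * ?m" for n
    unfolding w_def q_def using integral_radial_profile[OF AB(1,2) p, of n z] by auto
  have w0: "w n x \<noteq> 0 \<Longrightarrow> A n < (norm (x - z))\<^sup>2 \<and> (norm (x - z))\<^sup>2 < B n" for n x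
    using step_fn_eq(5,6)[OF AB(2)] unfolding w_def by (meson linorder_not_le)
  have wle: "w n x \<le> 0" for n x
    unfolding w_def by (rule step_fn'_nonpos)
  define W where "W n = - integral\<^sup>L lborel (w n)" for n
  have Wb: "pi * A n \<le> B n * W n" "A n * W n \<le> pi * B n" for n
    using integral_weight_bounds[OF AB(1,2), of n z] by (simp_all add: W_def w_def[abs_def])
  have B0: "B n > 0" for n using AB(1,2)[of n] by simp
  have W: "W \<longlonglongrightarrow> pi"
  proof (rule real_tendsto_sandwich)
    show "\<forall>\<^sub>F n in sequentially. pi * A n / B n \<le> W n"
      using Wb(1) B0 by (intro always_eventually allI) (simp add: pos_divide_le_eq mult.commute)
    show "\<forall>\<^sub>F n in sequentially. W n \<le> pi * B n / A n"
      using Wb(2) AB(1) by (intro always_eventually allI) (simp add: pos_le_divide_eq mult.commute)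
    have "(\<lambda>n. pi * A n / B n) \<longlonglongrightarrow> pi * s\<^sup>2 / s\<^sup>2" "(\<lambda>n. pi * B n / A n) \<longlonglongrightarrow> pi * s\<^sup>2 / s\<^sup>2"
      by (intro tendsto_intros AB; use s in simp)+
    then show "(\<lambda>n. pi * A n / B n) \<longlonglongrightarrow> pi" "(\<lambda>n. pi * B n / A n) \<longlonglongrightarrow> pi"
      using s by auto
  qed
  \<comment> \<open>The point x and its projection to the circle have distance | |x - z| - s |,
    which is eventually below the modulus d of uniform continuity, uniformly in the shell.\<close>
  have close: "\<forall>\<^sub>F n in sequentially. \<forall>x. w n x \<noteq> 0 \<longrightarrow> \<bar>G x - q (sgn (x - z))\<bar> \<le> e" if e: "e > 0" for e
  proof -
    obtain d where d: "d > 0" "\<And>x y. x \<in> S \<Longrightarrow> y \<in> S \<Longrightarrow> dist x y < d \<Longrightarrow> dist (G x) (G y) < e"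
      using compact_uniformly_continuous[OF S(2,1)] e unfolding uniformly_continuous_on_def by metis
    have "(\<lambda>n. sqrt (A n)) \<longlonglongrightarrow> sqrt (s\<^sup>2)" "(\<lambda>n. sqrt (B n)) \<longlonglongrightarrow> sqrt (s\<^sup>2)"
      by (intro tendsto_intros AB)+
    then have "\<forall>\<^sub>F n in sequentially. s - d < sqrt (A n)" "\<forall>\<^sub>F n in sequentially. sqrt (B n) < s + d"
      using s d(1) order_tendstoD(1)[of "\<lambda>n. sqrt (A n)" s sequentially "s - d"]
        order_tendstoD(2)[of "\<lambda>n. sqrt (B n)" s sequentially "s + d"] by auto
    then show ?thesis
    proof eventually_elim
      case (elim n)
      show ?case
      proof (intro allI impI)
        fix x assume wx: "w n x \<noteq> 0"
        let ?r = "norm (x - z)"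
        have r: "sqrt (A n) < ?r" "?r < sqrt (B n)"
          using w0[OF wx] AB(1)[of n] by (auto simp: real_less_rsqrt intro: real_less_lsqrt)
        then have "?r > 0" using AB(1)[of n] by (smt (verit) real_sqrt_gt_zero)
        then have v: "norm (sgn (x - z)) = 1" by (auto simp: norm_sgn)
        let ?y = "z + of_real s * sgn (x - z)"
        have y: "?y \<in> S" using S(3) s v by (auto simp: dist_norm norm_mult subset_iff)
        have "x - z = of_real ?r * sgn (x - z)"
          using \<open>?r > 0\<close> by (simp add: sgn_eq)
        then have "x - ?y = of_real (?r - s) * sgn (x - z)"
          by (simp add: algebra_simps)
        then have "dist x ?y = \<bar>?r - s\<bar>"
          using v by (simp add: dist_norm norm_mult flip: of_real_diff)
        then have "dist x ?y < d" using r elim by auto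
        then have "dist (G x) (G ?y) < e"
          using d(2) shell w0[OF wx] y by blast
        then show "\<bar>G x - q (sgn (x - z))\<bar> \<le> e"
          using v by (simp add: q_def p_def dist_real_def)
      qed
    qed
  qed
  have est: "\<forall>\<^sub>F n in sequentially. \<bar>(\<integral>x. w n x * G x \<partial>lborel) + W n * ?m / (2*pi)\<bar> \<le> e * W n" if e: "e > 0" for e
    using close[OF e]
  proof eventually_elim
    case (elim n)
    have b: "\<bar>w n x * G x - w n x * q (sgn (x - z))\<bar> \<le> e * - w n x" for x
    proof (cases "w n x = 0")
      case False
      have "\<bar>w n x\<bar> * \<bar>G x - q (sgn (x - z))\<bar> \<le> \<bar>w n x\<bar> * e"
        using elim False by (intro mult_left_mono) auto
      moreover have "\<bar>w n x * G x - w n x * q (sgn (x - z))\<bar> = \<bar>w n x\<bar> * \<bar>G x - q (sgn (x - z))\<bar>"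
        by (simp only: right_diff_distrib[symmetric] abs_mult)
      ultimately show ?thesis
        using wle[of n x] by (simp add: mult.commute[of e])
    qed simp
    have iG: "integrable lborel (\<lambda>x. w n x * G x - w n x * q (sgn (x - z)))"
    proof (rule Bochner_Integration.integrable_bound)
      show "integrable lborel (\<lambda>x. e * - w n x)" using iw by simp
      show "(\<lambda>x. w n x * G x - w n x * q (sgn (x - z))) \<in> borel_measurable lborel"
        using m[of n] iq[of n] by (auto simp: w_def)
      show "AE x in lborel. norm (w n x * G x - w n x * q (sgn (x - z))) \<le> norm (e * - w n x)"
        using order_trans[OF b abs_ge_self] by (intro AE_I2) (simp only: real_norm_def)
    qed
    have iG': "integrable lborel (\<lambda>x. w n x * G x)"
      using Bochner_Integration.integrable_add[OF iG iq[of n]] by simp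
    have "(\<integral>x. w n x * G x \<partial>lborel) + W n * ?m / (2*pi)
        = (\<integral>x. w n x * G x \<partial>lborel) - (\<integral>x. w n x * q (sgn (x - z)) \<partial>lborel)"
      using eq[of n] by (simp add: W_def field_simps)
    also have "\<dots> = (\<integral>x. w n x * G x - w n x * q (sgn (x - z)) \<partial>lborel)"
      using iG' iq[of n] by simp
    also have "\<bar>\<dots>\<bar> \<le> (\<integral>x. \<bar>w n x * G x - w n x * q (sgn (x - z))\<bar> \<partial>lborel)"
      by (rule integral_abs_bound)
    also have "\<dots> \<le> (\<integral>x. e * - w n x \<partial>lborel)"
      using iw[of n] iG b by (intro integral_mono) auto
    also have "\<dots> = e * W n"
      by (simp add: W_def)
    finally show ?case .
  qed
  have "(\<lambda>n. (\<integral>x. w n x * G x \<partial>lborel) + W n * ?m / (2*pi)) \<longlonglongrightarrow> 0"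
  proof (rule tendstoI)
    fix e :: real assume e: "e > 0"
    \<comment> \<open>Any bound above the limit pi serves; it turns the error
      \<open>e / 4 * W n\<close> into one below e.\<close>
    have "\<forall>\<^sub>F n in sequentially. W n < 4"
      using order_tendstoD(2)[OF W, of 4] pi_less_4 by simp
    moreover have "\<forall>\<^sub>F n in sequentially. \<bar>(\<integral>x. w n x * G x \<partial>lborel) + W n * ?m / (2*pi)\<bar> \<le> e / 4 * W n"
      by (rule est) (use e in simp)
    ultimately have "\<forall>\<^sub>F n in sequentially. \<bar>(\<integral>x. w n x * G x \<partial>lborel) + W n * ?m / (2*pi)\<bar> < e"
    proof eventually_elim
      case (elim n)
      have "e / 4 * W n < e / 4 * 4"
        by (rule mult_strict_left_mono) (use elim e in auto)
      with elim(2) show ?case by linarith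
    qed
    then show "\<forall>\<^sub>F n in sequentially. dist ((\<integral>x. w n x * G x \<partial>lborel) + W n * ?m / (2*pi)) 0 < e"
      by simp
  qed
  moreover have "(\<lambda>n. W n * ?m / (2*pi)) \<longlonglongrightarrow> pi * ?m / (2*pi)"
    by (intro tendsto_intros W) simp
  ultimately have "(\<lambda>n. ((\<integral>x. w n x * G x \<partial>lborel) + W n * ?m / (2*pi)) - W n * ?m / (2*pi)) \<longlonglongrightarrow> 0 - pi * ?m / (2*pi)"
    by (rule tendsto_diff)
  then have "(\<lambda>n. 2 * (\<integral>x. w n x * G x \<partial>lborel)) \<longlonglongrightarrow> 2 * (- ?m / 2)"
    by (intro tendsto_mult tendsto_const) simp
  then show ?thesis
    by (simp add: w_def p_def mult.assoc)
qed

subsection \<open>Green's identity for piecewise holomorphic fields\<close>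

lemma GDERIV_zero_outside:
  assumes "closed K" "x \<notin> K" "\<And>y. y \<notin> K \<Longrightarrow> f y = 0"
  shows "GDERIV f x :> 0"
proof -
  have "((\<lambda>x. 0) has_derivative (\<lambda>h. h \<bullet> 0)) (at x)" by simp
  then show ?thesis
    unfolding gderiv_def
    by (rule has_derivative_transform_within_open[of _ _ _ _ "- K"]) (use assms in auto)
qed

lemma C1_testI:
  assumes D: "\<And>x. GDERIV f x :> D x" and c: "continuous_on UNIV D"
    and K: "compact K" "K \<subseteq> U" "\<And>x. x \<notin> K \<Longrightarrow> f x = 0"
  shows "C1_test U f" and "gradient f = D"
proof -
  show g: "gradient f = D"
    using gradient_eqI[OF D] by auto
  have s: "closure {x. f x \<noteq> 0} \<subseteq> K"
    using K by (intro closure_minimal) (auto simp: compact_imp_closed)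
  show "C1_test U f"
    unfolding C1_test_def
  proof (intro conjI allI)
    show "f differentiable at x" for x
      using D[of x] unfolding gderiv_def differentiable_def by blast
    show "continuous_on UNIV (gradient f)" using c g by simp
    show "compact (closure {x. f x \<noteq> 0})"
      using s K(1) by (meson bounded_subset closed_closure compact_eq_bounded_closed)
    show "closure {x. f x \<noteq> 0} \<subseteq> U" using s K by auto
  qed
qed

text \<open>As vectors, gradients of real parts are conjugates of complex derivatives. This is why
  gradients are carried as \<open>cnj q\<close> with holomorphic \<open>q\<close> from here
  on.\<close>

lemma GDERIV_Re:
  assumes "(f has_field_derivative f') (at x)"
  shows "GDERIV (\<lambda>x. Re (f x)) x :> cnj f'" and "GDERIV (\<lambda>x. Im (f x)) x :> \<i> * cnj f'"
  using assms unfolding gderiv_def has_field_derivative_def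
  by (auto intro!: has_derivative_eq_rhs[OF has_derivative_Re] has_derivative_eq_rhs[OF has_derivative_Im]
      simp: inner_complex_def fun_eq_iff)

lemma integrable_lebesgue_on:
  fixes f :: "complex \<Rightarrow> 'b::euclidean_space"
  assumes "integrable lborel f" "U \<in> sets lebesgue"
  shows "integrable (lebesgue_on U) f"
proof -
  have "integrable lebesgue f"
    using assms by (auto simp: integrable_completion)
  then show ?thesis
    using assms(2) by (auto simp: integrable_restrict_space intro: integrable_mult_indicator)
qed

lemma integral_lebesgue_on_lborel:
  fixes f :: "complex \<Rightarrow> 'b::euclidean_space"
  assumes "f \<in> borel_measurable borel" "U \<in> sets lebesgue" "\<And>x. x \<notin> U \<Longrightarrow> f x = 0"
  shows "integral\<^sup>L (lebesgue_on U) f = integral\<^sup>L lborel f"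
proof -
  have "integral\<^sup>L (lebesgue_on U) f = (\<integral>x. indicator U x *\<^sub>R f x \<partial>lebesgue)"
    using assms(2) by (simp add: integral_restrict_space)
  also have "(\<lambda>x. indicator U x *\<^sub>R f x) = f"
    using assms(3) by (auto simp: fun_eq_iff indicator_def)
  also have "integral\<^sup>L lebesgue f = integral\<^sup>L lborel f"
    using assms(1) by (simp add: integral_completion)
  finally show ?thesis .
qed

lemma integrable_L2_inner:
  fixes f g :: "'a \<Rightarrow> complex"
  assumes "f \<in> borel_measurable M" "g \<in> borel_measurable M"
    and i: "integrable M (\<lambda>x. (norm (f x))\<^sup>2)" "integrable M (\<lambda>x. (norm (g x))\<^sup>2)"
  shows "integrable M (\<lambda>x. f x \<bullet> g x)"
proof (rule Bochner_Integration.integrable_bound)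
  show "integrable M (\<lambda>x. (norm (f x))\<^sup>2 + (norm (g x))\<^sup>2)" using i by simp
  show "AE x in M. norm (f x \<bullet> g x) \<le> norm ((norm (f x))\<^sup>2 + (norm (g x))\<^sup>2)"
  proof (rule AE_I2)
    fix x
    have "\<bar>f x \<bullet> g x\<bar> \<le> norm (f x) * norm (g x)" by (rule Cauchy_Schwarz_ineq2)
    also have "\<dots> \<le> (norm (f x))\<^sup>2 + (norm (g x))\<^sup>2"
      using sum_squares_bound[of "norm (f x)" "norm (g x)"] mult_nonneg_nonneg[OF norm_ge_zero norm_ge_zero, of "f x" "g x"]
      by linarith
    finally show "norm (f x \<bullet> g x) \<le> norm ((norm (f x))\<^sup>2 + (norm (g x))\<^sup>2)" by simp
  qed
qed (use assms in measurable)

lemma integrable_L2_scaleR: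
  fixes g :: "'a \<Rightarrow> complex" and f :: "'a \<Rightarrow> real"
  assumes "f \<in> borel_measurable M" "g \<in> borel_measurable M"
    and i: "integrable M (\<lambda>x. (f x)\<^sup>2)" "integrable M (\<lambda>x. (norm (g x))\<^sup>2)"
  shows "integrable M (\<lambda>x. f x *\<^sub>R g x)"
proof (rule Bochner_Integration.integrable_bound)
  show "integrable M (\<lambda>x. (f x)\<^sup>2 + (norm (g x))\<^sup>2)" using i by simp
  show "AE x in M. norm (f x *\<^sub>R g x) \<le> norm ((f x)\<^sup>2 + (norm (g x))\<^sup>2)"
  proof (rule AE_I2)
    fix x
    have "\<bar>f x\<bar> * norm (g x) \<le> (f x)\<^sup>2 + (norm (g x))\<^sup>2"
      using sum_squares_bound[of "\<bar>f x\<bar>" "norm (g x)"] mult_nonneg_nonneg[OF abs_ge_zero norm_ge_zero, of "f x" "g x"]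
        power2_abs[of "f x"]
      by linarith
    then show "norm (f x *\<^sub>R g x) \<le> norm ((f x)\<^sup>2 + (norm (g x))\<^sup>2)" by simp
  qed
qed (use assms in measurable)

lemma H1_gradient_test:
  assumes H: "H1_gradient U u G" and U: "U \<in> sets lebesgue" and t: "C1_test U f"
  shows "integrable (lebesgue_on U) (\<lambda>x. u x *\<^sub>R gradient f x)"
    and "integrable (lebesgue_on U) (\<lambda>x. f x *\<^sub>R G x)"
    and "(LINT x|lebesgue_on U. u x *\<^sub>R gradient f x) = - (LINT x|lebesgue_on U. f x *\<^sub>R G x)"
proof -
  have c: "continuous_on UNIV (gradient f)" and d: "\<And>x. f differentiable (at x)"
    and "compact (closure {x. f x \<noteq> 0})"
    using t by (auto simp: C1_test_def)
  moreover define K where "K = closure {x. f x \<noteq> 0}"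
  ultimately have K: "compact K" by simp
  have f0: "f x = 0" if "x \<notin> K" for x
    using that closure_subset[of "{x. f x \<noteq> 0}"] by (auto simp: K_def)
  have g0: "gradient f x = 0" if "x \<notin> K" for x
    by (rule gradient_eqI, rule GDERIV_zero_outside[OF compact_imp_closed[OF K] that], rule f0)
  have cf: "continuous_on UNIV f"
    using d by (meson continuous_at_imp_continuous_on differentiable_imp_continuous_within)
  have 1: "integrable (lebesgue_on U) (\<lambda>x. (norm (gradient f x))\<^sup>2)"
    by (rule integrable_lebesgue_on[OF integrable_continuous_support[OF _ K] U])
       (use c g0 in \<open>auto intro!: continuous_on_power continuous_on_norm\<close>)
  have 2: "integrable (lebesgue_on U) (\<lambda>x. (f x)\<^sup>2)"
    by (rule integrable_lebesgue_on[OF integrable_continuous_support[OF _ K] U])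
       (use cf f0 in \<open>auto intro!: continuous_on_power\<close>)
  have m: "gradient f \<in> borel_measurable (lebesgue_on U)" "f \<in> borel_measurable (lebesgue_on U)"
    using integrable_lebesgue_on[OF integrable_continuous_support[OF c K g0] U]
      integrable_lebesgue_on[OF integrable_continuous_support[OF cf K f0] U] by auto
  show "integrable (lebesgue_on U) (\<lambda>x. u x *\<^sub>R gradient f x)"
    using H m 1 unfolding H1_gradient_def by (intro integrable_L2_scaleR) auto
  show "integrable (lebesgue_on U) (\<lambda>x. f x *\<^sub>R G x)"
    using H m 2 unfolding H1_gradient_def by (intro integrable_L2_scaleR) auto
  show "(LINT x|lebesgue_on U. u x *\<^sub>R gradient f x) = - (LINT x|lebesgue_on U. f x *\<^sub>R G x)"
    using H t unfolding H1_gradient_def by blast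
qed

text \<open>The field \<open>cnj q\<close> is divergence free by the Cauchy-Riemann equations.\<close>

lemma weak_divergence_holomorphic:
  fixes \<psi> :: "complex \<Rightarrow> real"
  assumes H: "H1_gradient U u G" and U: "U \<in> sets lebesgue"
    and V: "open V" "V \<subseteq> U" and q: "q holomorphic_on V"
    and psi: "\<And>x. GDERIV \<psi> x :> D x" "continuous_on UNIV D"
    and K: "compact K" "K \<subseteq> V" "\<And>x. x \<notin> K \<Longrightarrow> \<psi> x = 0"
  shows "(LINT x|lebesgue_on U. \<psi> x * (cnj (q x) \<bullet> G x)) = - (LINT x|lebesgue_on U. u x * (D x \<bullet> cnj (q x)))"
proof -
  have D0: "D x = 0" if "x \<notin> K" for x
  proof -
    have "GDERIV \<psi> x :> 0"
      by (rule GDERIV_zero_outside[OF compact_imp_closed[OF K(1)] that]) (rule K(3))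
    then have "gradient \<psi> x = 0" by (rule gradient_eqI)
    moreover have "gradient \<psi> x = D x" using psi(1) by (rule gradient_eqI)
    ultimately show ?thesis by simp
  qed
  have cpsi: "continuous_on UNIV \<psi>"
    using psi(1) unfolding gderiv_def
    by (meson continuous_at_imp_continuous_on has_derivative_continuous)
  have Kc: "closed K" using K(1) compact_imp_closed by blast
  have UV: "UNIV = V \<union> - K" using K by auto
  have glue: "continuous_on UNIV f" if "continuous_on V f" "\<And>x. x \<notin> K \<Longrightarrow> f x = 0" for f :: "complex \<Rightarrow> 'b::real_normed_vector"
  proof -
    have "continuous_on (- K) f"
      using that(2) by (subst continuous_on_cong[OF refl, of _ _ "\<lambda>_. 0"]) auto
    then show ?thesis
      unfolding UV using that(1) V(1) Kc by (intro continuous_on_open_Un) auto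
  qed
  have cq: "continuous_on V q" and cq': "continuous_on V (deriv q)"
    using q V(1) by (auto intro: holomorphic_on_imp_continuous_on holomorphic_deriv)
  have test: "C1_test U (\<lambda>x. \<psi> x * p x)" "gradient (\<lambda>x. \<psi> x * p x) = (\<lambda>x. \<psi> x *\<^sub>R P x + p x *\<^sub>R D x)"
    if p: "continuous_on V p" "continuous_on V P" and d: "\<And>x. x \<in> V \<Longrightarrow> GDERIV p x :> P x" for p P
  proof -
    have GD: "GDERIV (\<lambda>x. \<psi> x * p x) x :> \<psi> x *\<^sub>R P x + p x *\<^sub>R D x" for x
    proof (cases "x \<in> V")
      case True
      then show ?thesis using GDERIV_mult[OF psi(1) d] by simp
    next
      case False
      then have "x \<notin> K" using K by auto
      have "GDERIV (\<lambda>x. \<psi> x * p x) x :> 0"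
        by (rule GDERIV_zero_outside[OF Kc \<open>x \<notin> K\<close>]) (simp add: K(3))
      then show ?thesis using \<open>x \<notin> K\<close> by (simp add: D0 K)
    qed
    have "continuous_on UNIV (\<lambda>x. \<psi> x *\<^sub>R P x + p x *\<^sub>R D x)"
      by (rule glue) (auto simp: D0 K intro!: continuous_intros p continuous_on_subset[OF cpsi] continuous_on_subset[OF psi(2)])
    from C1_testI[OF GD this K(1)] show "C1_test U (\<lambda>x. \<psi> x * p x)"
      "gradient (\<lambda>x. \<psi> x * p x) = (\<lambda>x. \<psi> x *\<^sub>R P x + p x *\<^sub>R D x)"
      using K V by auto
  qed
  have dq: "(q has_field_derivative deriv q x) (at x)" if "x \<in> V" for x
    using q V(1) that holomorphic_derivI by blast
  \<comment> \<open>The inner product of \<open>cnj q\<close> and G is Re q Re G - Im q Im G. So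
    \<psi> Re q is tested against the first component of the weak gradient and \<psi> Im q against
    the second; in the difference the terms with \<open>deriv q\<close> cancel.\<close>
  have t1: "C1_test U (\<lambda>x. \<psi> x * Re (q x))"
    "gradient (\<lambda>x. \<psi> x * Re (q x)) = (\<lambda>x. \<psi> x *\<^sub>R cnj (deriv q x) + Re (q x) *\<^sub>R D x)"
    by (rule test; use dq in \<open>auto intro!: continuous_intros cq cq' GDERIV_Re\<close>)+
  have t2: "C1_test U (\<lambda>x. \<psi> x * Im (q x))"
    "gradient (\<lambda>x. \<psi> x * Im (q x)) = (\<lambda>x. \<psi> x *\<^sub>R (\<i> * cnj (deriv q x)) + Im (q x) *\<^sub>R D x)"
    by (rule test; use dq in \<open>auto intro!: continuous_intros cq cq' GDERIV_Re\<close>)+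
  note h1 = H1_gradient_test[OF H U t1(1), unfolded t1(2)]
  note h2 = H1_gradient_test[OF H U t2(1), unfolded t2(2)]
  have "(LINT x|lebesgue_on U. \<psi> x * (cnj (q x) \<bullet> G x))
      = (LINT x|lebesgue_on U. Re ((\<psi> x * Re (q x)) *\<^sub>R G x) - Im ((\<psi> x * Im (q x)) *\<^sub>R G x))"
    by (intro Bochner_Integration.integral_cong refl) (simp add: inner_complex_def algebra_simps)
  also have "\<dots> = Re (LINT x|lebesgue_on U. (\<psi> x * Re (q x)) *\<^sub>R G x) - Im (LINT x|lebesgue_on U. (\<psi> x * Im (q x)) *\<^sub>R G x)"
    using h1(2) h2(2) by (subst Bochner_Integration.integral_diff) (simp_all only: integrable_Re integrable_Im integral_Re integral_Im)
  also have "\<dots> = - (Re (LINT x|lebesgue_on U. u x *\<^sub>R (\<psi> x *\<^sub>R cnj (deriv q x) + Re (q x) *\<^sub>R D x))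
     - Im (LINT x|lebesgue_on U. u x *\<^sub>R (\<psi> x *\<^sub>R (\<i> * cnj (deriv q x)) + Im (q x) *\<^sub>R D x)))"
    unfolding h1(3) h2(3) by simp
  also have "\<dots> = - (LINT x|lebesgue_on U. Re (u x *\<^sub>R (\<psi> x *\<^sub>R cnj (deriv q x) + Re (q x) *\<^sub>R D x))
     - Im (u x *\<^sub>R (\<psi> x *\<^sub>R (\<i> * cnj (deriv q x)) + Im (q x) *\<^sub>R D x)))"
    using h1(1) h2(1) by (subst Bochner_Integration.integral_diff) (simp_all only: integrable_Re integrable_Im integral_Re integral_Im)
  also have "\<dots> = - (LINT x|lebesgue_on U. u x * (D x \<bullet> cnj (q x)))"
    by (intro arg_cong[where f = uminus] Bochner_Integration.integral_cong refl)
       (simp add: inner_complex_def algebra_simps)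
  finally show ?thesis by blast
qed

lemma cutoff_weight_times:
  fixes F :: "complex \<Rightarrow> real"
  assumes "A < B" and S: "compact S" "continuous_on S F"
    and shell: "\<And>x. A < (norm (x - z))\<^sup>2 \<Longrightarrow> (norm (x - z))\<^sup>2 < B \<Longrightarrow> x \<in> S"
  shows "(\<lambda>x. step_fn' A B ((norm (x - z))\<^sup>2) * F x) \<in> borel_measurable borel" (is "?f \<in> _")
    and "integrable lborel (\<lambda>x. 2 * step_fn' A B ((norm (x - z))\<^sup>2) * F x)"
proof -
  let ?w = "\<lambda>x. step_fn' A B ((norm (x - z))\<^sup>2)"
  have w0: "?w x = 0" if "x \<notin> S" for x
    using step_fn_eq(5,6)[OF assms(1)] shell[of x] that by (meson linorder_not_le)
  have iw: "integrable lborel ?w"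
    by (rule integrable_cutoff_weight[OF assms(1)])
  have "S \<in> sets borel" using S(1) by (simp add: borel_closed compact_imp_closed)
  then have "(\<lambda>x. indicator S x *\<^sub>R F x) \<in> borel_measurable borel"
    by (rule borel_measurable_continuous_on_indicator[OF _ S(2)])
  then have "(\<lambda>x. ?w x * (indicator S x *\<^sub>R F x)) \<in> borel_measurable borel"
    using iw by auto
  also have "(\<lambda>x. ?w x * (indicator S x *\<^sub>R F x)) = ?f"
    using w0 by (auto simp: fun_eq_iff indicator_def)
  finally show m: "?f \<in> borel_measurable borel" .
  have "compact (F ` S)"
    by (intro compact_continuous_image S)
  then obtain M where M: "\<And>x. x \<in> S \<Longrightarrow> norm (F x) \<le> M"
    using compact_imp_bounded bounded_iff by (metis image_eqI)
  have "integrable lborel ?f"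
  proof (rule Bochner_Integration.integrable_bound)
    show "integrable lborel (\<lambda>x. M * ?w x)" using iw by simp
    show "AE x in lborel. norm (?f x) \<le> norm (M * ?w x)"
    proof (rule AE_I2)
      fix x show "norm (?f x) \<le> norm (M * ?w x)"
      proof (cases "x \<in> S")
        case True
        have "\<bar>?w x\<bar> * \<bar>F x\<bar> \<le> \<bar>?w x\<bar> * \<bar>M\<bar>"
          using M[OF True] by (intro mult_left_mono) auto
        then show ?thesis by (simp add: abs_mult mult.commute)
      qed (simp add: w0)
    qed
  qed (use m in simp)
  then have "integrable lborel (\<lambda>x. 2 * ?f x)" by (rule integrable_mult_right)
  then show "integrable lborel (\<lambda>x. 2 * ?w x * F x)"
    by (simp add: mult.assoc)
qed

lemma cutoff_grad_inner:
  "cutoff_grad A B z x \<bullet> cnj w = 2 * step_fn' A B ((norm (x - z))\<^sup>2) * Re ((x - z) * w)"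
  by (simp add: cutoff_grad_def inner_complex_def algebra_simps)

lemma cutoff_square:
  assumes "0 < a" "a < b"
  shows "norm (x - z) \<le> a \<Longrightarrow> cutoff (a\<^sup>2) (b\<^sup>2) z x = 1"
    and "b \<le> norm (x - z) \<Longrightarrow> cutoff (a\<^sup>2) (b\<^sup>2) z x = 0"
    and "norm (x - z) \<le> a \<Longrightarrow> step_fn' (a\<^sup>2) (b\<^sup>2) ((norm (x - z))\<^sup>2) = 0"
    and "b \<le> norm (x - z) \<Longrightarrow> step_fn' (a\<^sup>2) (b\<^sup>2) ((norm (x - z))\<^sup>2) = 0"
proof -
  have ab: "a\<^sup>2 < b\<^sup>2" using assms by (simp add: power_strict_mono)
  have 1: "(norm (x - z))\<^sup>2 \<le> a\<^sup>2" if "norm (x - z) \<le> a" using that by (simp add: power_mono)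
  have 2: "b\<^sup>2 \<le> (norm (x - z))\<^sup>2" if "b \<le> norm (x - z)" using that assms by (intro power_mono) auto
  show "norm (x - z) \<le> a \<Longrightarrow> cutoff (a\<^sup>2) (b\<^sup>2) z x = 1"
    "b \<le> norm (x - z) \<Longrightarrow> cutoff (a\<^sup>2) (b\<^sup>2) z x = 0"
    "norm (x - z) \<le> a \<Longrightarrow> step_fn' (a\<^sup>2) (b\<^sup>2) ((norm (x - z))\<^sup>2) = 0"
    "b \<le> norm (x - z) \<Longrightarrow> step_fn' (a\<^sup>2) (b\<^sup>2) ((norm (x - z))\<^sup>2) = 0"
    using step_fn_eq[OF ab] 1 2 by (auto simp: cutoff_def)
qed

text \<open>The shells may approach the circle from one side only, and only they have to lie in the
  open disk. Thus the limiting circle may be the boundary of that disk, where the integrand is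
  merely continuous.\<close>

lemma integral_sphere_shells:
  fixes F :: "complex \<Rightarrow> real" and z :: complex
  assumes s: "s > 0" and ab: "\<And>n. 0 < a n" "\<And>n. a n < b n" "a \<longlonglongrightarrow> s" "b \<longlonglongrightarrow> s"
    and S: "compact S" "continuous_on S F" "sphere z s \<subseteq> S" "S \<subseteq> cball zO \<rho>"
    and shell: "\<And>n x. a n < norm (x - z) \<Longrightarrow> norm (x - z) < b n \<Longrightarrow> x \<in> S \<inter> ball zO \<rho>"
  shows "(\<lambda>n. LINT x|lebesgue_on (ball zO \<rho>). 2 * step_fn' ((a n)\<^sup>2) ((b n)\<^sup>2) ((norm (x - z))\<^sup>2) * F x)
     \<longlonglongrightarrow> - integral {0..2*pi} (\<lambda>t. F (z + of_real s * cis t))"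
    and "integrable (lebesgue_on (ball zO \<rho>)) (\<lambda>x. 2 * step_fn' ((a n)\<^sup>2) ((b n)\<^sup>2) ((norm (x - z))\<^sup>2) * F x)"
proof -
  have lt: "(a n)\<^sup>2 < (b n)\<^sup>2" for n
    using ab(1,2)[of n] by (simp add: power_strict_mono)
  have sh: "x \<in> S \<inter> ball zO \<rho>" if "(a n)\<^sup>2 < (norm (x - z))\<^sup>2" "(norm (x - z))\<^sup>2 < (b n)\<^sup>2" for n x
    using that ab(1,2)[of n] shell[of n x] by (meson norm_ge_zero less_imp_le less_trans power_less_imp_less_base)
  have i: "integrable lborel (\<lambda>x. 2 * step_fn' ((a n)\<^sup>2) ((b n)\<^sup>2) ((norm (x - z))\<^sup>2) * F x)" for n
    by (rule cutoff_weight_times(2)[OF lt S(1,2)]) (use sh in auto)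
  have z: "2 * step_fn' ((a n)\<^sup>2) ((b n)\<^sup>2) ((norm (x - z))\<^sup>2) * F x = 0" if "x \<notin> ball zO \<rho>" for x n
    using step_fn_eq(5,6)[OF lt[of n], of "(norm (x - z))\<^sup>2"] sh[of n x] that by force
  have e: "(LINT x|lebesgue_on (ball zO \<rho>). 2 * step_fn' ((a n)\<^sup>2) ((b n)\<^sup>2) ((norm (x - z))\<^sup>2) * F x)
    = (\<integral>x. 2 * step_fn' ((a n)\<^sup>2) ((b n)\<^sup>2) ((norm (x - z))\<^sup>2) * F x \<partial>lborel)" for n
    by (rule integral_lebesgue_on_lborel) (use i[of n] z in auto)
  show "(\<lambda>n. LINT x|lebesgue_on (ball zO \<rho>). 2 * step_fn' ((a n)\<^sup>2) ((b n)\<^sup>2) ((norm (x - z))\<^sup>2) * F x)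
     \<longlonglongrightarrow> - integral {0..2*pi} (\<lambda>t. F (z + of_real s * cis t))"
    unfolding e
  proof (rule shell_limit[OF s _ lt _ _ S(1-3)])
    show "(\<lambda>n. (a n)\<^sup>2) \<longlonglongrightarrow> s\<^sup>2" "(\<lambda>n. (b n)\<^sup>2) \<longlonglongrightarrow> s\<^sup>2" by (intro tendsto_intros ab)+
    show "(\<lambda>x. step_fn' ((a n)\<^sup>2) ((b n)\<^sup>2) ((norm (x - z))\<^sup>2) * F x) \<in> borel_measurable borel" for n
      by (rule cutoff_weight_times(1)[OF lt S(1,2)]) (use sh in auto)
    show "0 < (a n)\<^sup>2" for n using ab(1)[of n] by simp
  qed (use sh in auto)
  show "integrable (lebesgue_on (ball zO \<rho>)) (\<lambda>x. 2 * step_fn' ((a n)\<^sup>2) ((b n)\<^sup>2) ((norm (x - z))\<^sup>2) * F x)"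
    by (rule integrable_lebesgue_on[OF i]) auto
qed

lemma piecewise_bounded_measurable:
  fixes q1 q2 :: "complex \<Rightarrow> 'b::euclidean_space"
  assumes c1: "continuous_on (cball zB r) q1" and c2: "continuous_on (cball zO \<rho> - ball zB r) q2"
  defines "q \<equiv> \<lambda>x. if x \<in> ball zB r then q1 x else q2 x"
  shows "q \<in> borel_measurable (lebesgue_on (ball zO \<rho>))"
    and "\<exists>M. \<forall>x\<in>cball zO \<rho>. norm (q x) \<le> M"
    and "integrable (lebesgue_on (ball zO \<rho>)) (\<lambda>x. (norm (q x))\<^sup>2)"
proof -
  define p where "p x = (if x \<in> ball zB r then q1 x else if x \<in> cball zO \<rho> - ball zB r then q2 x else 0)" for x
  have "(\<lambda>x. if x \<in> cball zO \<rho> - ball zB r then q2 x else 0) \<in> borel_measurable borel"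
    by (intro borel_measurable_continuous_on_if c2) (auto intro!: sets.Diff)
  moreover have "(\<lambda>x. if x \<in> ball zB r then q1 x else 0) \<in> borel_measurable borel"
    by (intro borel_measurable_continuous_on_if continuous_on_subset[OF c1]) auto
  ultimately have "(\<lambda>x. (if x \<in> ball zB r then q1 x else 0) + (if x \<in> cball zO \<rho> - ball zB r then q2 x else 0)) \<in> borel_measurable borel"
    by (rule borel_measurable_add[rotated])
  moreover have "(\<lambda>x. (if x \<in> ball zB r then q1 x else 0) + (if x \<in> cball zO \<rho> - ball zB r then q2 x else 0)) = p"
    by (auto simp: p_def fun_eq_iff)
  ultimately have "p \<in> borel_measurable borel" by simp
  then have "p \<in> borel_measurable (lebesgue_on (ball zO \<rho>))"
    by (intro measurable_restrict_space1) (auto intro: measurable_completion)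
  then show m: "q \<in> borel_measurable (lebesgue_on (ball zO \<rho>))"
    by (rule measurable_cong[THEN iffD1, rotated]) (auto simp: p_def q_def)
  have "compact (q1 ` cball zB r)" "compact (q2 ` (cball zO \<rho> - ball zB r))"
    by (intro compact_continuous_image c1 c2 compact_cball compact_diff; simp)+
  then obtain M1 M2 where M: "\<And>x. x \<in> cball zB r \<Longrightarrow> norm (q1 x) \<le> M1"
    "\<And>x. x \<in> cball zO \<rho> - ball zB r \<Longrightarrow> norm (q2 x) \<le> M2"
    using compact_imp_bounded bounded_iff by (metis (no_types, lifting) image_eqI)
  have qM: "norm (q x) \<le> max M1 M2" if "x \<in> cball zO \<rho>" for x
    using M(1)[of x] M(2)[of x] that by (auto simp: q_def)
  then show "\<exists>M. \<forall>x\<in>cball zO \<rho>. norm (q x) \<le> M" by blast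
  have fin: "finite_measure (lebesgue_on (ball zO \<rho>))"
    by (rule finite_measure_lebesgue_on) auto
  show "integrable (lebesgue_on (ball zO \<rho>)) (\<lambda>x. (norm (q x))\<^sup>2)"
  proof (rule finite_measure.integrable_const_bound[OF fin])
    show "AE x in lebesgue_on (ball zO \<rho>). norm ((norm (q x))\<^sup>2) \<le> (max M1 M2)\<^sup>2"
      using qM by (intro AE_I2) (auto intro!: power_mono)
  qed (use m in measurable)
qed

lemma AE_lebesgue_on_sphere: "AE x in lebesgue_on (ball (zO::complex) \<rho>). x \<notin> sphere zB r"
proof -
  have "sphere zB r \<in> null_sets lebesgue"
    by (simp add: negligible_iff_null_sets[symmetric] negligible_sphere)
  then have "AE x in lebesgue. x \<notin> sphere zB r"
    by (rule AE_not_in)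
  then show ?thesis
    by (subst AE_restrict_space_iff) auto
qed

text \<open>The field \<open>cnj q\<close> is divergence free off \<partial>B. It is tested with
  \<phi> times a cutoff that vanishes in thin collars around both circles; the gradient of the
  cutoff produces one shell integral at \<partial>\<Omega> and two at \<partial>B. The latter two
  have opposite signs and, since the normal components match, equal limits.\<close>

lemma green_transmission:
  fixes q1 q2 :: "complex \<Rightarrow> complex" and \<phi> :: "complex \<Rightarrow> real"
  assumes r: "r > 0" and B: "cball zB r \<subseteq> ball zO \<rho>"
    and q1: "q1 holomorphic_on ball zB r" "continuous_on (cball zB r) q1"
    and q2: "q2 holomorphic_on ball zO \<rho> - cball zB r" "continuous_on (cball zO \<rho> - ball zB r) q2"
    and match: "\<And>x. x \<in> sphere zB r \<Longrightarrow> Re ((x - zB) * q1 x) = Re ((x - zB) * q2 x)"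
    and H: "H1_gradient (ball zO \<rho>) \<phi> H" and phi: "continuous_on (cball zO \<rho>) \<phi>"
  defines "q \<equiv> \<lambda>x. if x \<in> ball zB r then q1 x else q2 x"
  shows "(LINT x|lebesgue_on (ball zO \<rho>). cnj (q x) \<bullet> H x)
    = integral {0..2*pi} (\<lambda>t. \<phi> (zO + of_real \<rho> * cis t) * Re (of_real \<rho> * cis t * q2 (zO + of_real \<rho> * cis t)))"
proof -
  let ?O = "ball zO \<rho>" and ?M = "lebesgue_on (ball zO \<rho>)"
  define d where "d = dist zO zB"
  have d: "d + r < \<rho>" "d \<ge> 0"
    using B r by (auto simp: d_def cball_subset_ball_iff dist_commute)
  \<comment> \<open>Collars reach up to 2 \<delta> from each circle. One fifth of the radius keeps
    the inner shell away from the center of B, and one fifth of the gap keeps the shells around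
    \<partial>B and inside \<partial>\<Omega> apart, which takes 4 \<delta> below the gap.\<close>
  define \<delta>0 where "\<delta>0 = min r (\<rho> - d - r) / 5"
  define \<delta> where "\<delta> n = \<delta>0 * inverse (real (Suc n))" for n
  have d0: "\<delta>0 > 0" "5 * \<delta>0 \<le> r" "5 * \<delta>0 \<le> \<rho> - d - r" using r d by (auto simp: \<delta>0_def)
  have dl: "0 < \<delta> n" "\<delta> n \<le> \<delta>0" for n
  proof -
    show "0 < \<delta> n" using d0 by (simp add: \<delta>_def)
    have "inverse (real (Suc n)) \<le> 1" by (simp add: field_simps)
    then show "\<delta> n \<le> \<delta>0" using d0 mult_left_mono[of "inverse (real (Suc n))" 1 \<delta>0] by (simp add: \<delta>_def)
  qed
  have lim: "\<delta> \<longlonglongrightarrow> 0"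
    unfolding \<delta>_def using tendsto_mult_right[OF LIMSEQ_inverse_real_of_nat, of \<delta>0] by (simp add: mult.commute)
  have lims: "(\<lambda>n. c + k * \<delta> n) \<longlonglongrightarrow> c" for c k
    using tendsto_add[OF tendsto_const tendsto_mult[OF tendsto_const lim], of c k] by simp
  have tri: "norm (x - zO) \<le> norm (x - zB) + d" "norm (x - zB) \<le> norm (x - zO) + d" for x
    using dist_triangle[of x zO zB] dist_triangle[of x zB zO] by (auto simp: d_def dist_norm norm_minus_commute)
  \<comment> \<open>Three shells: \<open>aO\<close>, \<open>bO\<close> just inside
    \<partial>\<Omega>, \<open>a1\<close>, \<open>b1\<close> just inside \<partial>B and
    \<open>a2\<close>, \<open>b2\<close> just outside \<partial>B.\<close>
  define aO where "aO n = \<rho> + (-2) * \<delta> n" for n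
  define bO where "bO n = \<rho> + (-1) * \<delta> n" for n
  define a1 where "a1 n = r + (-2) * \<delta> n" for n
  define b1 where "b1 n = r + (-1) * \<delta> n" for n
  define a2 where "a2 n = r + 1 * \<delta> n" for n
  define b2 where "b2 n = r + 2 * \<delta> n" for n
  have ab: "0 < aO n" "aO n < bO n" "0 < a1 n" "a1 n < b1 n" "0 < a2 n" "a2 n < b2 n"
    "bO n < \<rho>" "b1 n < r" "r < a2 n" "d + b2 n < aO n" for n
    using dl[of n] d0 d r by (auto simp: aO_def bO_def a1_def b1_def a2_def b2_def)
  have ablim: "aO \<longlonglongrightarrow> \<rho>" "bO \<longlonglongrightarrow> \<rho>" "a1 \<longlonglongrightarrow> r" "b1 \<longlonglongrightarrow> r" "a2 \<longlonglongrightarrow> r" "b2 \<longlonglongrightarrow> r"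
    unfolding aO_def bO_def a1_def b1_def a2_def b2_def by (rule lims)+
  define GO where "GO x = Re ((x - zO) * q2 x)" for x
  \<comment> \<open>Gluing the normal components from both sides gives one function that is
    continuous across \<partial>B, so that both shells at \<partial>B have the same limit.\<close>
  define GB where "GB x = (if x \<in> cball zB r then Re ((x - zB) * q1 x) else Re ((x - zB) * q2 x))" for x
  have cO: "continuous_on (cball zO \<rho> - ball zB r) (\<lambda>x. \<phi> x * GO x)"
    unfolding GO_def by (intro continuous_intros continuous_on_subset[OF phi] q2) auto
  have cB: "continuous_on (cball zO \<rho>) (\<lambda>x. \<phi> x * GB x)"
  proof -
    have U: "cball zO \<rho> = cball zB r \<union> (cball zO \<rho> - ball zB r)"
      using B ball_subset_cball[of zO \<rho>] ball_subset_cball[of zB r] by auto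
    have "continuous_on (cball zB r \<union> (cball zO \<rho> - ball zB r)) (\<lambda>x. if x \<in> cball zB r then Re ((x - zB) * q1 x) else Re ((x - zB) * q2 x))"
      by (rule continuous_on_cases) (use match in \<open>auto intro!: continuous_intros q1 q2 closed_Diff\<close>)
    then have "continuous_on (cball zO \<rho>) GB"
      unfolding GB_def[abs_def] U[symmetric] .
    then show ?thesis by (intro continuous_intros phi)
  qed
  define kO where "kO n x = step_fn' ((aO n)\<^sup>2) ((bO n)\<^sup>2) ((norm (x - zO))\<^sup>2)" for n x
  define k1 where "k1 n x = step_fn' ((a1 n)\<^sup>2) ((b1 n)\<^sup>2) ((norm (x - zB))\<^sup>2)" for n x
  define k2 where "k2 n x = step_fn' ((a2 n)\<^sup>2) ((b2 n)\<^sup>2) ((norm (x - zB))\<^sup>2)" for n x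
  have sub: "cball zO \<rho> - ball zB r \<subseteq> cball zO \<rho>" by auto
  have rho: "\<rho> > 0" using d r by simp
  have coO: "compact (cball zO \<rho> - ball zB r)" by (intro compact_diff) auto
  have sO: "sphere zO \<rho> \<subseteq> cball zO \<rho> - ball zB r"
  proof
    fix x assume "x \<in> sphere zO \<rho>"
    then show "x \<in> cball zO \<rho> - ball zB r"
      using tri(1)[of x] d by (auto simp: dist_norm norm_minus_commute)
  qed
  have shO: "x \<in> (cball zO \<rho> - ball zB r) \<inter> ?O" if "aO n < norm (x - zO)" "norm (x - zO) < bO n" for n x
    using that tri(1)[of x] ab[of n] by (auto simp: dist_norm norm_minus_commute)
  have sB: "sphere zB r \<subseteq> cball zO \<rho>"
    using B ball_subset_cball[of zO \<rho>] sphere_cball[of zB r] by blast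
  have sh1: "x \<in> cball zO \<rho> \<inter> ?O" if "a1 n < norm (x - zB)" "norm (x - zB) < b1 n" for n x
    using that tri(1)[of x] ab[of n] d by (auto simp: dist_norm norm_minus_commute)
  have sh2: "x \<in> cball zO \<rho> \<inter> ?O" if "a2 n < norm (x - zB)" "norm (x - zB) < b2 n" for n x
    using that tri(1)[of x] ab[of n] d by (auto simp: dist_norm norm_minus_commute)
  have O: "(\<lambda>n. LINT x|?M. 2 * kO n x * (\<phi> x * GO x)) \<longlonglongrightarrow> - integral {0..2*pi} (\<lambda>t. \<phi> (zO + of_real \<rho> * cis t) * GO (zO + of_real \<rho> * cis t))"
    "integrable ?M (\<lambda>x. 2 * kO n x * (\<phi> x * GO x))" for n
    unfolding kO_def
    by (rule integral_sphere_shells[OF rho ab(1,2) ablim(1,2) coO cO sO sub]; rule shO; assumption)+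
  have B1: "(\<lambda>n. LINT x|?M. 2 * k1 n x * (\<phi> x * GB x)) \<longlonglongrightarrow> - integral {0..2*pi} (\<lambda>t. \<phi> (zB + of_real r * cis t) * GB (zB + of_real r * cis t))"
    "integrable ?M (\<lambda>x. 2 * k1 n x * (\<phi> x * GB x))" for n
    unfolding k1_def
    by (rule integral_sphere_shells[OF r ab(3,4) ablim(3,4) compact_cball cB sB order_refl]; rule sh1; assumption)+
  have B2: "(\<lambda>n. LINT x|?M. 2 * k2 n x * (\<phi> x * GB x)) \<longlonglongrightarrow> - integral {0..2*pi} (\<lambda>t. \<phi> (zB + of_real r * cis t) * GB (zB + of_real r * cis t))"
    "integrable ?M (\<lambda>x. 2 * k2 n x * (\<phi> x * GB x))" for n
    unfolding k2_def
    by (rule integral_sphere_shells[OF r ab(5,6) ablim(5,6) compact_cball cB sB order_refl]; rule sh2; assumption)+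
  \<comment> \<open>A smoothed indicator of \<Omega>, minus one of a slightly larger disk than B,
    plus one of a slightly smaller disk. It is 1 away from the circles and 0 near them, so its
    support avoids \<partial>B.\<close>
  define \<psi> where "\<psi> n x = cutoff ((aO n)\<^sup>2) ((bO n)\<^sup>2) zO x - cutoff ((a2 n)\<^sup>2) ((b2 n)\<^sup>2) zB x + cutoff ((a1 n)\<^sup>2) ((b1 n)\<^sup>2) zB x" for n x
  define D where "D n x = cutoff_grad ((aO n)\<^sup>2) ((bO n)\<^sup>2) zO x - cutoff_grad ((a2 n)\<^sup>2) ((b2 n)\<^sup>2) zB x + cutoff_grad ((a1 n)\<^sup>2) ((b1 n)\<^sup>2) zB x" for n x
  have lt: "(aO n)\<^sup>2 < (bO n)\<^sup>2" "(a1 n)\<^sup>2 < (b1 n)\<^sup>2" "(a2 n)\<^sup>2 < (b2 n)\<^sup>2" for n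
    using ab[of n] by (simp_all add: power_strict_mono)
  have GD: "GDERIV (\<psi> n) x :> D n x" for n x
    unfolding \<psi>_def[abs_def] D_def
    by (intro GDERIV_add GDERIV_diff GDERIV_cutoff lt)
  have cD: "continuous_on UNIV (D n)" for n
    unfolding D_def[abs_def] by (intro continuous_intros lt)
  let ?V = "?O - sphere zB r"
  have qV: "q holomorphic_on ?V"
  proof -
    have 1: "q holomorphic_on ball zB r"
      by (rule holomorphic_transform[OF q1(1)]) (simp add: q_def)
    have 2: "q holomorphic_on ?O - cball zB r"
      by (rule holomorphic_transform[OF q2(1)]) (auto simp: q_def)
    have "?V = ball zB r \<union> (?O - cball zB r)"
      using B ball_subset_cball[of zB r] by (force simp: less_le)
    then show ?thesis
      using holomorphic_on_Un[OF 1 2] by (simp add: open_Diff)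
  qed
  define K where "K n = cball zO (bO n) - ball zB (a2 n) \<union> cball zB (b1 n)" for n
  have K: "compact (K n)" "K n \<subseteq> ?V" "x \<notin> K n \<Longrightarrow> \<psi> n x = 0" for n x
  proof -
    show "compact (K n)" unfolding K_def by (intro compact_Un compact_diff) auto
    show "K n \<subseteq> ?V"
    proof
      fix x assume "x \<in> K n"
      then show "x \<in> ?V"
        using tri(1)[of x] ab[of n] d by (auto simp: K_def dist_norm norm_minus_commute)
    qed
    assume x: "x \<notin> K n"
    consider "norm (x - zO) > bO n" | "b1 n < norm (x - zB)" "norm (x - zB) < a2 n"
      using x by (force simp: K_def dist_norm norm_minus_commute)
    then show "\<psi> n x = 0"
    proof cases
      case 1
      then have "b2 n \<le> norm (x - zB)" "b1 n \<le> norm (x - zB)" using tri(1)[of x] ab[of n] by auto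
      with 1 show ?thesis
        using cutoff_square(2)[OF ab(1,2)[of n] less_imp_le[OF 1]] cutoff_square(2)[OF ab(3,4)[of n]] cutoff_square(2)[OF ab(5,6)[of n]]
        by (simp add: \<psi>_def)
    next
      case 2
      then have "norm (x - zO) \<le> aO n" using tri(1)[of x] ab[of n] by auto
      with 2 show ?thesis
        using cutoff_square(1)[OF ab(1,2)[of n], of x zO] cutoff_square(2)[OF ab(3,4)[of n], of x zB] cutoff_square(1)[OF ab(5,6)[of n], of x zB]
        by (simp add: \<psi>_def)
    qed
  qed
  have parts: "(LINT x|?M. \<psi> n x * (cnj (q x) \<bullet> H x)) = - (LINT x|?M. \<phi> x * (D n x \<bullet> cnj (q x)))" for n
    by (rule weak_divergence_holomorphic[OF H _ _ _ qV GD cD K]) auto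
  have point: "\<phi> x * (D n x \<bullet> cnj (q x))
      = 2 * kO n x * (\<phi> x * GO x) - 2 * k2 n x * (\<phi> x * GB x) + 2 * k1 n x * (\<phi> x * GB x)" for n x
  proof -
    have e: "D n x \<bullet> cnj (q x) = 2 * kO n x * Re ((x - zO) * q x) - 2 * k2 n x * Re ((x - zB) * q x) + 2 * k1 n x * Re ((x - zB) * q x)"
      by (simp only: D_def inner_add_left inner_diff_left cutoff_grad_inner kO_def k1_def k2_def)
    show ?thesis
    proof (cases "x \<in> ball zB r")
      case True
      then have "norm (x - zO) \<le> aO n" using tri(1)[of x] ab[of n] by (auto simp: dist_norm norm_minus_commute)
      then have "kO n x = 0" unfolding kO_def by (rule cutoff_square(3)[OF ab(1,2)])
      with True show ?thesis unfolding e by (simp add: q_def GB_def algebra_simps)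
    next
      case False
      have "Re ((x - zB) * q x) = GB x"
        using False match[of x] by (auto simp: q_def GB_def)
      moreover have "Re ((x - zO) * q x) = GO x"
        using False by (simp add: q_def GO_def)
      ultimately show ?thesis unfolding e by (simp add: algebra_simps)
    qed
  qed
  have "(\<lambda>n. LINT x|?M. \<psi> n x * (cnj (q x) \<bullet> H x)) \<longlonglongrightarrow>
    - (- integral {0..2*pi} (\<lambda>t. \<phi> (zO + of_real \<rho> * cis t) * GO (zO + of_real \<rho> * cis t))
      - (- integral {0..2*pi} (\<lambda>t. \<phi> (zB + of_real r * cis t) * GB (zB + of_real r * cis t)))
      + - integral {0..2*pi} (\<lambda>t. \<phi> (zB + of_real r * cis t) * GB (zB + of_real r * cis t)))"
  proof -
    have "(LINT x|?M. \<psi> n x * (cnj (q x) \<bullet> H x)) =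
      - ((LINT x|?M. 2 * kO n x * (\<phi> x * GO x)) - (LINT x|?M. 2 * k2 n x * (\<phi> x * GB x)) + (LINT x|?M. 2 * k1 n x * (\<phi> x * GB x)))" for n
      unfolding parts point using O(2)[of n] B1(2)[of n] B2(2)[of n] by simp
    then show ?thesis
      by (simp only:) (intro tendsto_intros O(1) B1(1) B2(1))
  qed
  then have lim1: "(\<lambda>n. LINT x|?M. \<psi> n x * (cnj (q x) \<bullet> H x)) \<longlonglongrightarrow>
    integral {0..2*pi} (\<lambda>t. \<phi> (zO + of_real \<rho> * cis t) * GO (zO + of_real \<rho> * cis t))"
    by simp
  note qm = piecewise_bounded_measurable[OF q1(2) q2(2), folded q_def]
  have mH: "H \<in> borel_measurable ?M" "integrable ?M (\<lambda>x. (norm (H x))\<^sup>2)"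
    using H by (auto simp: H1_gradient_def)
  have iqH: "integrable ?M (\<lambda>x. cnj (q x) \<bullet> H x)"
  proof (rule integrable_L2_inner)
    have "cnj \<in> borel_measurable borel"
      by (intro borel_measurable_continuous_onI continuous_intros)
    from measurable_compose[OF qm(1) this] show "(\<lambda>x. cnj (q x)) \<in> borel_measurable ?M" .
    show "integrable ?M (\<lambda>x. (norm (cnj (q x)))\<^sup>2)"
      using piecewise_bounded_measurable(3)[OF q1(2) q2(2)] by (simp add: q_def)
  qed (use mH in auto)
  have lim2: "(\<lambda>n. LINT x|?M. \<psi> n x * (cnj (q x) \<bullet> H x)) \<longlonglongrightarrow> (LINT x|?M. cnj (q x) \<bullet> H x)"
  \<comment> \<open>The bound 3 counts the three cutoffs in \<psi>, each with values in [0, 1].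
    Pointwise convergence to 1 fails only on \<partial>B, a null set.\<close>
  proof (rule integral_dominated_convergence[where w = "\<lambda>x. 3 * norm (cnj (q x) \<bullet> H x)"])
    have "continuous_on UNIV (\<psi> n)" for n
      using GD unfolding gderiv_def by (meson continuous_at_imp_continuous_on has_derivative_continuous)
    then have "\<psi> n \<in> borel_measurable ?M" for n
      by (intro measurable_restrict_space1 measurable_completion) (simp add: borel_measurable_continuous_onI)
    then show "(\<lambda>x. \<psi> n x * (cnj (q x) \<bullet> H x)) \<in> borel_measurable ?M" for n
      using iqH by auto
    show "AE x in ?M. norm (\<psi> n x * (cnj (q x) \<bullet> H x)) \<le> 3 * norm (cnj (q x) \<bullet> H x)" for n
    proof (rule AE_I2)
      fix x
      have "\<bar>\<psi> n x\<bar> \<le> 3"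
        using step_fn_eq(3,4)[OF lt(1)[of n], of "(norm (x - zO))\<^sup>2"] step_fn_eq(3,4)[OF lt(2)[of n], of "(norm (x - zB))\<^sup>2"]
          step_fn_eq(3,4)[OF lt(3)[of n], of "(norm (x - zB))\<^sup>2"]
        unfolding \<psi>_def cutoff_def by linarith
      then show "norm (\<psi> n x * (cnj (q x) \<bullet> H x)) \<le> 3 * norm (cnj (q x) \<bullet> H x)"
        by (simp only: real_norm_def abs_mult) (rule mult_right_mono, auto)
    qed
    show "integrable ?M (\<lambda>x. 3 * norm (cnj (q x) \<bullet> H x))" using iqH by simp
    have one: "(\<lambda>n. \<psi> n x) \<longlonglongrightarrow> 1" if x: "x \<in> ?O" "x \<notin> sphere zB r" for x
    proof -
      have 1: "\<forall>\<^sub>F n in sequentially. norm (x - zO) < aO n"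
        using x by (intro order_tendstoD(1)[OF ablim(1)]) (simp add: dist_norm norm_minus_commute)
      have "\<forall>\<^sub>F n in sequentially. \<psi> n x = 1"
      proof (cases "norm (x - zB) < r")
        case True
        have "\<forall>\<^sub>F n in sequentially. norm (x - zB) < a1 n"
          by (rule order_tendstoD(1)[OF ablim(3) True])
        with 1 show ?thesis
        proof eventually_elim
          case (elim n)
          then show ?case
            using cutoff_square(1)[OF ab(1,2)[of n], of x zO] cutoff_square(1)[OF ab(3,4)[of n], of x zB]
              cutoff_square(1)[OF ab(5,6)[of n], of x zB] ab[of n] by (simp add: \<psi>_def)
        qed
      next
        case False
        then have "r < norm (x - zB)" using x(2) by (simp add: dist_norm norm_minus_commute)
        then have "\<forall>\<^sub>F n in sequentially. b2 n < norm (x - zB)"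
          by (rule order_tendstoD(2)[OF ablim(6)])
        with 1 show ?thesis
        proof eventually_elim
          case (elim n)
          then show ?case
            using cutoff_square(1)[OF ab(1,2)[of n], of x zO] cutoff_square(2)[OF ab(3,4)[of n], of x zB]
              cutoff_square(2)[OF ab(5,6)[of n], of x zB] ab[of n] by (simp add: \<psi>_def)
        qed
      qed
      then show ?thesis by (rule tendsto_eventually)
    qed
    show "AE x in ?M. (\<lambda>n. \<psi> n x * (cnj (q x) \<bullet> H x)) \<longlonglongrightarrow> cnj (q x) \<bullet> H x"
      using AE_lebesgue_on_sphere[where zO = zO and \<rho> = \<rho> and zB = zB and r = r] AE_space
    proof eventually_elim
      case (elim x)
      then show ?case using tendsto_mult_right[OF one, of x "cnj (q x) \<bullet> H x"] by simp
    qed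
  qed (use iqH in auto)
  show ?thesis
    using LIMSEQ_unique[OF lim2 lim1] by (simp add: GO_def)
qed

subsection \<open>Uniqueness of the weak solution\<close>

text \<open>Differentiation under the integral sign. The gradient is turned into the bounded
  functional it represents, the form in which the parameter rule is stated, and the integral is
  pulled out of this bounded linear correspondence.\<close>

lemma GDERIV_integral:
  fixes f :: "complex \<Rightarrow> real \<Rightarrow> real" and D :: "complex \<Rightarrow> real \<Rightarrow> complex"
  assumes d: "\<And>x t. x \<in> U \<Longrightarrow> t \<in> {a..b} \<Longrightarrow> GDERIV (\<lambda>x. f x t) x :> D x t"
    and c: "continuous_on (U \<times> {a..b}) (\<lambda>(x, t). D x t)"
    and i: "\<And>x. x \<in> U \<Longrightarrow> f x integrable_on {a..b}"
    and U: "open U" "convex U" "x0 \<in> U"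
  shows "GDERIV (\<lambda>x. integral {a..b} (f x)) x0 :> integral {a..b} (D x0)"
proof -
  have bl: "bounded_linear (blinfun_inner_left :: complex \<Rightarrow> complex \<Rightarrow>\<^sub>L real)"
    by (rule bounded_linear_blinfun_inner_left)
  have cD: "continuous_on {a..b} (D x0)"
  proof -
    have "continuous_on {a..b} (\<lambda>t. case (x0, t) of (x, t) \<Rightarrow> D x t)"
      by (rule continuous_on_compose2[OF c]) (use U in \<open>auto intro!: continuous_intros\<close>)
    then show ?thesis by simp
  qed
  have "((\<lambda>x. integral (cbox a b) (f x)) has_derivative
      blinfun_apply (integral (cbox a b) (\<lambda>t. blinfun_inner_left (D x0 t)))) (at x0 within U)"
  proof (rule leibniz_rule[OF _ _ _ U(3,2)])
    show "((\<lambda>x. f x t) has_derivative blinfun_apply (blinfun_inner_left (D x t))) (at x within U)"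
      if "x \<in> U" "t \<in> cbox a b" for x t
      using d[of x t] that unfolding gderiv_def
      by (auto intro: has_derivative_at_withinI simp: blinfun_inner_left.rep_eq[abs_def] )
    show "continuous_on (U \<times> cbox a b) (\<lambda>(x, t). blinfun_inner_left (D x t))"
      using bounded_linear.continuous_on[OF bl c] by (simp add: split_def)
  qed (use i in auto)
  moreover have "integral (cbox a b) (\<lambda>t. blinfun_inner_left (D x0 t)) = blinfun_inner_left (integral {a..b} (D x0))"
    using integral_linear[OF integrable_continuous_real[OF cD] bl] by (simp add: comp_def)
  ultimately show ?thesis
    using U by (simp add: gderiv_def at_within_open[of x0 U] blinfun_inner_left.rep_eq[abs_def])
qed

text \<open>The points are roots of a quadratic equation. These are the finite exceptional sets on
  which the divergence theorem admits kinks.\<close>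

lemma finite_line_sphere:
  "finite {t. Complex a t \<in> sphere zB r}" "finite {t. Complex t a \<in> sphere zB r}"
proof -
  have *: "t \<in> {c - sqrt s, c + sqrt s}" if "(t - c)\<^sup>2 = s" for s t c :: real
  proof -
    have "\<bar>t - c\<bar> = sqrt s" using that by (metis real_sqrt_abs)
    then show ?thesis by (auto simp: abs_if split: if_splits)
  qed
  have "{t. Complex a t \<in> sphere zB r} \<subseteq> {Im zB - sqrt (r\<^sup>2 - (a - Re zB)\<^sup>2), Im zB + sqrt (r\<^sup>2 - (a - Re zB)\<^sup>2)}"
  proof clarify
    fix t assume "Complex a t \<in> sphere zB r"
    then have "norm (Complex a t - zB) = r" by (simp add: dist_norm norm_minus_commute)
    then have "(a - Re zB)\<^sup>2 + (t - Im zB)\<^sup>2 = r\<^sup>2"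
      using cmod_power2[of "Complex a t - zB"] by simp
    then show "t = Im zB + sqrt (r\<^sup>2 - (a - Re zB)\<^sup>2)" if "t \<notin> {}" "t \<noteq> Im zB - sqrt (r\<^sup>2 - (a - Re zB)\<^sup>2)"
      using *[of t "Im zB" "r\<^sup>2 - (a - Re zB)\<^sup>2"] that by auto
  qed
  then show "finite {t. Complex a t \<in> sphere zB r}" by (rule finite_subset) simp
  have "{t. Complex t a \<in> sphere zB r} \<subseteq> {Re zB - sqrt (r\<^sup>2 - (a - Im zB)\<^sup>2), Re zB + sqrt (r\<^sup>2 - (a - Im zB)\<^sup>2)}"
  proof clarify
    fix t assume "Complex t a \<in> sphere zB r"
    then have "norm (Complex t a - zB) = r" by (simp add: dist_norm norm_minus_commute)
    then have "(t - Re zB)\<^sup>2 + (a - Im zB)\<^sup>2 = r\<^sup>2"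
      using cmod_power2[of "Complex t a - zB"] by simp
    then show "t = Re zB + sqrt (r\<^sup>2 - (a - Im zB)\<^sup>2)" if "t \<notin> {}" "t \<noteq> Re zB - sqrt (r\<^sup>2 - (a - Im zB)\<^sup>2)"
      using *[of t "Re zB" "r\<^sup>2 - (a - Im zB)\<^sup>2"] that by auto
  qed
  then show "finite {t. Complex t a \<in> sphere zB r}" by (rule finite_subset) simp
qed

text \<open>Continuity of v across the circle means that the distributional gradient has no part
  concentrated on it: the product with a test function is continuous with finitely many kinks on
  each line parallel to an axis, so the integral of its gradient vanishes.\<close>

lemma H1_gradient_piecewise:
  fixes v :: "complex \<Rightarrow> real"
  assumes v: "continuous_on (cball zO \<rho>) v"
    and d: "\<And>x. x \<in> ball zO \<rho> \<Longrightarrow> x \<notin> sphere zB r \<Longrightarrow> GDERIV v x :> G x"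
    and m: "(\<lambda>x. indicator (ball zO \<rho>) x *\<^sub>R G x) \<in> borel_measurable borel"
    and M: "\<And>x. x \<in> ball zO \<rho> \<Longrightarrow> norm (G x) \<le> M"
  shows "H1_gradient (ball zO \<rho>) v G"
proof -
  let ?O = "ball zO \<rho>" and ?M = "lebesgue_on (ball zO \<rho>)"
  have fin: "finite_measure ?M"
    by (rule finite_measure_lebesgue_on) auto
  have "(\<lambda>x. indicator ?O x *\<^sub>R v x) \<in> borel_measurable borel"
    by (intro borel_measurable_continuous_on_indicator continuous_on_subset[OF v]) auto
  then have "(\<lambda>x. indicator ?O x *\<^sub>R v x) \<in> borel_measurable ?M"
    by (intro measurable_restrict_space1 measurable_completion) auto
  then have mv: "v \<in> borel_measurable ?M"
    by (rule measurable_cong[THEN iffD1, rotated]) auto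
  have "(\<lambda>x. indicator ?O x *\<^sub>R G x) \<in> borel_measurable ?M"
    using m by (intro measurable_restrict_space1 measurable_completion) auto
  then have mG: "G \<in> borel_measurable ?M"
    by (rule measurable_cong[THEN iffD1, rotated]) auto
  have "compact (v ` cball zO \<rho>)"
    by (intro compact_continuous_image v compact_cball)
  then obtain N where N: "\<And>x. x \<in> cball zO \<rho> \<Longrightarrow> norm (v x) \<le> N"
    using compact_imp_bounded bounded_iff by (metis image_eqI)
  have iv: "integrable ?M (\<lambda>x. (v x)\<^sup>2)"
  proof (rule finite_measure.integrable_const_bound[OF fin])
    show "AE x in ?M. norm ((v x)\<^sup>2) \<le> N\<^sup>2"
    proof (rule AE_I2)
      fix x assume "x \<in> space ?M"
      then have "\<bar>v x\<bar> \<le> N" using N[of x] by simp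
      then have "\<bar>v x\<bar>\<^sup>2 \<le> N\<^sup>2" by (intro power_mono) auto
      then show "norm ((v x)\<^sup>2) \<le> N\<^sup>2" by simp
    qed
  qed (use mv in measurable)
  have iG: "integrable ?M (\<lambda>x. (norm (G x))\<^sup>2)"
  proof (rule finite_measure.integrable_const_bound[OF fin])
    show "AE x in ?M. norm ((norm (G x))\<^sup>2) \<le> M\<^sup>2"
      using M by (intro AE_I2) (auto intro!: power_mono)
  qed (use mG in measurable)
  have "(LINT x|?M. v x *\<^sub>R gradient f x) = - (LINT x|?M. f x *\<^sub>R G x)" if t: "C1_test ?O f" for f
  proof -
    have c: "continuous_on UNIV (gradient f)" and df: "\<And>x. f differentiable (at x)"
      and K': "compact (closure {x. f x \<noteq> 0})" "closure {x. f x \<noteq> 0} \<subseteq> ?O"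
      using t by (auto simp: C1_test_def)
    define K where "K = closure {x. f x \<noteq> 0}"
    have K: "compact K" "K \<subseteq> ?O" "closed K" using K' by (auto simp: K_def)
    have f0: "f x = 0" if "x \<notin> K" for x
      using that closure_subset[of "{x. f x \<noteq> 0}"] by (auto simp: K_def)
    have g0: "gradient f x = 0" if "x \<notin> K" for x
      by (rule gradient_eqI, rule GDERIV_zero_outside[OF K(3) that], rule f0)
    have Df: "GDERIV f x :> gradient f x" for x
    proof -
      obtain F where F: "(f has_derivative F) (at x)" using df by (auto simp: differentiable_def)
      then have lin: "linear F" by (rule has_derivative_linear)
      have "F h = h \<bullet> Complex (F 1) (F \<i>)" for h
      proof -
        have "h = Re h *\<^sub>R 1 + Im h *\<^sub>R \<i>" by (simp add: complex_eq_iff)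
        then have "F h = F (Re h *\<^sub>R 1 + Im h *\<^sub>R \<i>)" by (rule arg_cong)
        also have "\<dots> = Re h * F 1 + Im h * F \<i>"
          by (simp only: linear_add[OF lin] linear_scale[OF lin] real_scaleR_def)
        finally show ?thesis by (simp add: inner_complex_def)
      qed
      then have "F = (\<lambda>h. h \<bullet> Complex (F 1) (F \<i>))" by (rule ext)
      with F have "GDERIV f x :> Complex (F 1) (F \<i>)"
        unfolding gderiv_def by metis
      then show ?thesis using gradient_eqI by metis
    qed
    have cf: "continuous_on UNIV f"
      using df by (meson continuous_at_imp_continuous_on differentiable_imp_continuous_within)
    \<comment> \<open>The gradient of the product f v extended by zero, an extension that is
      continuous because f vanishes near the boundary of the disk.\<close>
    define D where "D x = f x *\<^sub>R (indicator ?O x *\<^sub>R G x) + (indicator ?O x *\<^sub>R v x) *\<^sub>R gradient f x" for x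
    have mD: "D \<in> borel_measurable borel"
      unfolding D_def[abs_def]
      by (intro borel_measurable_add borel_measurable_scaleR m
          borel_measurable_continuous_on_indicator continuous_on_subset[OF v]
          borel_measurable_continuous_onI c cf) auto
    have "compact (f ` K)" "compact (gradient f ` K)"
      by (intro compact_continuous_image K continuous_on_subset[OF cf] continuous_on_subset[OF c]; simp)+
    then obtain F1 F2 where F: "\<And>x. x \<in> K \<Longrightarrow> norm (f x) \<le> F1" "\<And>x. x \<in> K \<Longrightarrow> norm (gradient f x) \<le> F2"
      using compact_imp_bounded bounded_iff by (metis (no_types, lifting) image_eqI)
    have D0: "D x = 0" if "x \<notin> K" for x
      using that by (simp add: D_def f0 g0)
    have bD: "norm (D x) \<le> \<bar>F1\<bar> * \<bar>M\<bar> + \<bar>N\<bar> * \<bar>F2\<bar>" for x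
    proof (cases "x \<in> K")
      case True
      then have xO: "x \<in> ?O" using K by auto
      have "norm (D x) \<le> norm (f x) * norm (G x) + norm (v x) * norm (gradient f x)"
        using xO by (auto simp: D_def intro: order_trans[OF norm_triangle_ineq])
      also have "\<dots> \<le> \<bar>F1\<bar> * \<bar>M\<bar> + \<bar>N\<bar> * \<bar>F2\<bar>"
        using F[OF True] M[OF xO] N[of x] xO by (intro add_mono mult_mono) auto
      finally show ?thesis .
    qed (simp add: D0)
    have iD: "integrable lborel D"
      by (rule integrable_compact_support[OF mD bD D0]) (use K compact_imp_bounded in auto)
    define R where "R = norm zO + \<bar>\<rho>\<bar> + 1"
    have KR: "norm x < R" if "x \<in> K" for x
    proof -
      have "dist zO x < \<rho>" using K that by auto
      then show ?thesis using norm_triangle_ineq2[of x zO] by (simp add: R_def dist_norm norm_minus_commute)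
    qed
    have "integral\<^sup>L lborel D = 0"
    proof (rule integral_gradient_zero[where f = "\<lambda>x. f x * (indicator ?O x *\<^sub>R v x)" and N = "sphere zB r \<inter> ?O" and R = R])
      show "continuous_on UNIV (\<lambda>x. f x * (indicator ?O x *\<^sub>R v x))"
      proof -
        have "continuous_on ?O (\<lambda>x. f x * v x)"
          by (intro continuous_intros continuous_on_subset[OF cf] continuous_on_subset[OF v]) auto
        then have 1: "continuous_on ?O (\<lambda>x. f x * (indicator ?O x *\<^sub>R v x))"
          by (rule continuous_on_eq) simp
        have 2: "continuous_on (- K) (\<lambda>x. f x * (indicator ?O x *\<^sub>R v x))"
          by (rule continuous_on_eq[of _ "\<lambda>x. 0"]) (auto simp: f0)
        have "UNIV = ?O \<union> - K" using K by auto
        then show ?thesis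
          using continuous_on_open_Un[OF _ _ 1 2] K by (simp add: open_Compl)
      qed
      show "GDERIV (\<lambda>x. f x * (indicator ?O x *\<^sub>R v x)) x :> D x" if "x \<notin> sphere zB r \<inter> ?O" for x
      proof (cases "x \<in> ?O")
        case True
        then have "GDERIV v x :> G x" using d that by auto
        then have "GDERIV (\<lambda>x. f x * v x) x :> f x *\<^sub>R G x + v x *\<^sub>R gradient f x"
          by (rule GDERIV_mult[OF Df])
        then have "GDERIV (\<lambda>x. f x * v x) x :> D x" using True by (simp add: D_def)
        then show ?thesis
          unfolding gderiv_def
          by (rule has_derivative_transform_within_open[of _ _ _ _ ?O]) (use True in auto)
      next
        case False
        then have "x \<notin> K" using K by auto
        then show ?thesis
          using GDERIV_zero_outside[OF K(3) \<open>x \<notin> K\<close>, of "\<lambda>x. f x * (indicator ?O x *\<^sub>R v x)"] by (simp add: D0 f0)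
      qed
      show "finite {t. Complex a t \<in> sphere zB r \<inter> ?O}" "finite {t. Complex t a \<in> sphere zB r \<inter> ?O}" for a
        by (rule finite_subset[OF _ finite_line_sphere(1)[of a zB r]] finite_subset[OF _ finite_line_sphere(2)[of a zB r]]; auto)+
      show "0 < R" by (simp add: R_def add_nonneg_pos)
      show "f x * (indicator ?O x *\<^sub>R v x) = 0" if "R \<le> norm x" for x
        using KR[of x] that by (cases "x \<in> K") (auto simp: f0)
      show "D x = 0" if "R < norm x" for x
        using KR[of x] that by (cases "x \<in> K") (auto simp: D0)
    qed (rule iD)
    moreover have "integral\<^sup>L ?M D = integral\<^sup>L lborel D"
    proof (rule integral_lebesgue_on_lborel[OF mD])
      show "D x = 0" if "x \<notin> ?O" for x using that K(2) by (intro D0) blast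
    qed simp
    moreover have "integral\<^sup>L ?M D = (LINT x|?M. f x *\<^sub>R G x + v x *\<^sub>R gradient f x)"
      by (intro Bochner_Integration.integral_cong refl) (simp add: D_def)
    moreover have "(LINT x|?M. f x *\<^sub>R G x + v x *\<^sub>R gradient f x)
      = (LINT x|?M. f x *\<^sub>R G x) + (LINT x|?M. v x *\<^sub>R gradient f x)"
    proof (rule Bochner_Integration.integral_add)
      have mf: "f \<in> borel_measurable ?M" "gradient f \<in> borel_measurable ?M"
        using integrable_lebesgue_on[OF integrable_continuous_support[OF c K(1) g0], of ?O]
          integrable_lebesgue_on[OF integrable_continuous_support[OF cf K(1) f0], of ?O] by auto
      have 1: "integrable ?M (\<lambda>x. (norm (gradient f x))\<^sup>2)"
        by (rule integrable_lebesgue_on[OF integrable_continuous_support[OF _ K(1)]])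
           (use c g0 in \<open>auto intro!: continuous_on_power continuous_on_norm\<close>)
      have 2: "integrable ?M (\<lambda>x. (f x)\<^sup>2)"
        by (rule integrable_lebesgue_on[OF integrable_continuous_support[OF _ K(1)]])
           (use cf f0 in \<open>auto intro!: continuous_on_power\<close>)
      show "integrable ?M (\<lambda>x. f x *\<^sub>R G x)" by (rule integrable_L2_scaleR[OF mf(1) mG 2 iG])
      show "integrable ?M (\<lambda>x. v x *\<^sub>R gradient f x)" by (rule integrable_L2_scaleR[OF mv mf(2) iv 1])
    qed
    ultimately show ?thesis by (simp add: eq_neg_iff_add_eq_0 add.commute)
  qed
  then show ?thesis
    unfolding H1_gradient_def using mv iv mG iG by blast
qed

section \<open>Functions with vanishing weak gradient and uniqueness\<close>

lemma cutoff_sym: "cutoff A B z x = cutoff A B x z"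
  by (simp add: cutoff_def norm_minus_commute)

lemma integral_cutoff_translate:
  "integral\<^sup>L lborel (cutoff A B p) = integral\<^sup>L lborel (cutoff A B (0::complex))" if "A < B"
proof -
  have m: "cutoff A B 0 \<in> borel_measurable borel"
    using that by (intro borel_measurable_continuous_onI continuous_intros)
  have "integral\<^sup>L lborel (cutoff A B 0) = integral\<^sup>L (distr lborel borel (\<lambda>x. - p + x)) (cutoff A B 0)"
    by (simp only: lborel_distr_plus)
  also have "\<dots> = (\<integral>x. cutoff A B 0 (- p + x) \<partial>lborel)"
    using m by (simp add: integral_distr)
  also have "(\<lambda>x. cutoff A B 0 (- p + x)) = cutoff A B p"
    by (simp add: cutoff_def fun_eq_iff)
  finally show ?thesis by simp
qed

text \<open>The average over \<open>[a, b]\<close> of a bump function is a test function whose derivative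
  in the direction \<open>b - a\<close> is the difference of the bumps at the end points.\<close>

lemma integral_cutoff_difference:
  fixes w :: "complex \<Rightarrow> real"
  assumes U: "U \<in> sets lebesgue" and AB: "0 < \<delta>"
    and K: "\<And>p. p \<in> closed_segment a b \<Longrightarrow> cball p \<delta> \<subseteq> U"
    and w: "\<And>f. C1_test U f \<Longrightarrow> integrable (lebesgue_on U) (\<lambda>x. w x *\<^sub>R gradient f x)"
      "\<And>f. C1_test U f \<Longrightarrow> (LINT x|lebesgue_on U. w x *\<^sub>R gradient f x) = 0"
  shows "(LINT x|lebesgue_on U. w x * (cutoff ((\<delta>/2)\<^sup>2) (\<delta>\<^sup>2) b x - cutoff ((\<delta>/2)\<^sup>2) (\<delta>\<^sup>2) a x)) = 0"
proof -
  let ?A = "(\<delta>/2)\<^sup>2" and ?B = "\<delta>\<^sup>2"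
  have lt: "?A < ?B" using AB by (intro power_strict_mono) auto
  define p where "p s = a + of_real s * (b - a)" for s :: real
  define f where "f x = integral {0..1} (\<lambda>s. cutoff ?A ?B (p s) x)" for x
  define D where "D x = integral {0..1} (\<lambda>s. cutoff_grad ?A ?B (p s) x)" for x
  have cp: "continuous_on S (\<lambda>y. p (g y))" if "continuous_on S g" for g and S :: "'x::topological_space set"
    unfolding p_def by (intro continuous_intros that)
  have cg: "continuous_on S (\<lambda>y. cutoff_grad ?A ?B (p (g y)) (h y))"
    if "continuous_on S g" "continuous_on S h" for g h and S :: "'x::topological_space set"
    unfolding cutoff_grad_def by (intro continuous_intros cp that lt)
  have cc: "continuous_on S (\<lambda>y. cutoff ?A ?B (p (g y)) (h y))"
    if "continuous_on S g" "continuous_on S h" for g h and S :: "'x::topological_space set"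
    unfolding cutoff_def by (intro continuous_intros cp that lt)
  have GD: "GDERIV f x :> D x" for x
    unfolding f_def[abs_def] D_def
  proof (rule GDERIV_integral[where U = UNIV])
    show "GDERIV (\<lambda>x. cutoff ?A ?B (p t) x) x :> cutoff_grad ?A ?B (p t) x" for x t
      using GDERIV_cutoff[OF lt] by simp
    show "continuous_on (UNIV \<times> {0..1}) (\<lambda>(x, t). cutoff_grad ?A ?B (p t) x)"
      unfolding split_def by (intro cg continuous_intros)
    show "(\<lambda>s. cutoff ?A ?B (p s) x) integrable_on {0..1}" for x
      by (intro integrable_continuous_real cc continuous_intros)
  qed auto
  have cD: "continuous_on UNIV D"
  proof -
    have "continuous_on (UNIV \<times> cbox 0 1) (\<lambda>(x, t). cutoff_grad ?A ?B (p t) x)"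
      unfolding split_def by (intro cg continuous_intros)
    from integral_continuous_on_param[OF this] show ?thesis by (simp add: D_def[abs_def])
  qed
  define S where "S = (\<Union>x\<in>closed_segment a b. \<Union>y\<in>cball 0 \<delta>. {x + y})"
  have S: "compact S"
    unfolding S_def by (rule compact_sums') auto
  have SU: "S \<subseteq> U"
  proof
    fix z assume "z \<in> S"
    then obtain x y where "x \<in> closed_segment a b" "y \<in> cball 0 \<delta>" "z = x + y" by (auto simp: S_def)
    then show "z \<in> U" using K[of x] by (auto simp: dist_norm subset_iff)
  qed
  have pseg: "p s \<in> closed_segment a b" if "s \<in> {0..1}" for s
    using that by (auto simp: p_def closed_segment_def scaleR_conv_of_real algebra_simps intro!: exI[of _ s])
  have f0: "f x = 0" if "x \<notin> S" for x
  proof -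
    have "cutoff ?A ?B (p s) x = 0" if s: "s \<in> {0..1}" for s
    proof -
      have "x - p s \<notin> cball 0 \<delta>"
      proof
        assume "x - p s \<in> cball 0 \<delta>"
        then have "p s + (x - p s) \<in> S" unfolding S_def using pseg[OF s] by blast
        then show False using \<open>x \<notin> S\<close> by simp
      qed
      then show ?thesis
        using cutoff_square(2)[of "\<delta>/2" \<delta> x "p s"] AB by simp
    qed
    then have "((\<lambda>s. cutoff ?A ?B (p s) x) has_integral 0) {0..1}"
      by (rule has_integral_is_0)
    then show ?thesis
      unfolding f_def by (rule integral_unique)
  qed
  have t: "C1_test U f" "gradient f = D"
    by (rule C1_testI[OF GD cD S SU]; rule f0; assumption)+
  \<comment> \<open>The fundamental theorem along the segment. A bump depends on the difference of
    point and center only, so moving the center differentiates with the opposite sign.\<close>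
  have diff: "cutoff ?A ?B b x - cutoff ?A ?B a x = - (D x \<bullet> (b - a))" for x
  proof -
    have "((\<lambda>s. cutoff ?A ?B (p s) x) has_vector_derivative - (cutoff_grad ?A ?B (p s) x \<bullet> (b - a))) (at s within {0..1})" for s
    proof -
      have 1: "(p has_derivative (\<lambda>h. of_real h * (b - a))) (at s)"
        unfolding p_def[abs_def] by (auto intro!: derivative_eq_intros)
      have "(cutoff ?A ?B x has_derivative (\<lambda>h. h \<bullet> cutoff_grad ?A ?B x (p s))) (at (p s))"
        using GDERIV_cutoff[OF lt] by (simp add: gderiv_def)
      from has_derivative_compose[OF 1 this]
      have "((\<lambda>s. cutoff ?A ?B x (p s)) has_derivative (\<lambda>h. (of_real h * (b - a)) \<bullet> cutoff_grad ?A ?B x (p s))) (at s)" .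
      moreover have "cutoff_grad ?A ?B x (p s) = - cutoff_grad ?A ?B (p s) x"
        by (simp add: cutoff_grad_def norm_minus_commute scaleR_conv_of_real algebra_simps)
      ultimately have "((\<lambda>s. cutoff ?A ?B x (p s)) has_vector_derivative - (cutoff_grad ?A ?B (p s) x \<bullet> (b - a))) (at s)"
        unfolding has_vector_derivative_def
        by (simp add: inner_commute flip: scaleR_conv_of_real)
      then show ?thesis
        by (subst cutoff_sym) (rule has_vector_derivative_at_within)
    qed
    then have 1: "((\<lambda>s. - (cutoff_grad ?A ?B (p s) x \<bullet> (b - a))) has_integral (cutoff ?A ?B (p 1) x - cutoff ?A ?B (p 0) x)) {0..1}"
      by (intro fundamental_theorem_of_calculus) auto
    have 2: "((\<lambda>s. - (cutoff_grad ?A ?B (p s) x \<bullet> (b - a))) has_integral - (D x \<bullet> (b - a))) {0..1}"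
    proof (rule has_integral_neg)
      have "(\<lambda>s. cutoff_grad ?A ?B (p s) x) integrable_on {0..1}"
        by (intro integrable_continuous_real cg continuous_intros)
      then have "((\<lambda>s. cutoff_grad ?A ?B (p s) x) has_integral D x) {0..1}"
        unfolding D_def by (rule integrable_integral)
      from has_integral_linear[OF this bounded_linear_inner_left]
      show "((\<lambda>s. cutoff_grad ?A ?B (p s) x \<bullet> (b - a)) has_integral (D x \<bullet> (b - a))) {0..1}"
        by (simp add: comp_def)
    qed
    have "p 0 = a" "p 1 = b" by (simp_all add: p_def)
    then show ?thesis
      using has_integral_unique[OF 1 2] by simp
  qed
  have "(LINT x|lebesgue_on U. w x * (cutoff ?A ?B b x - cutoff ?A ?B a x))
    = (LINT x|lebesgue_on U. - ((w x *\<^sub>R gradient f x) \<bullet> (b - a)))"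
    unfolding diff t(2) by simp
  also have "\<dots> = - ((LINT x|lebesgue_on U. w x *\<^sub>R gradient f x) \<bullet> (b - a))"
    using w(1)[OF t(1)] by (simp only: integral_minus integral_inner_left)
  also have "\<dots> = 0" using w(2)[OF t(1)] by simp
  finally show ?thesis .
qed

text \<open>Differences of bumps at two points are directional derivatives of test functions, so w
  has the same weighted averages near a and near b. Small bumps bring these averages close to the
  point values.\<close>

lemma weak_gradient_zero_constant:
  fixes w :: "complex \<Rightarrow> real"
  assumes U: "open U" "convex U" and c: "continuous_on U w"
    and w: "\<And>f. C1_test U f \<Longrightarrow> integrable (lebesgue_on U) (\<lambda>x. w x *\<^sub>R gradient f x)"
      "\<And>f. C1_test U f \<Longrightarrow> (LINT x|lebesgue_on U. w x *\<^sub>R gradient f x) = 0"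
    and ab: "a \<in> U" "b \<in> U"
  shows "w a = w b"
proof (rule ccontr)
  assume "w a \<noteq> w b"
  \<comment> \<open>Replacing averages by point values costs e at each end; a total of 2 e
    contradicts a difference of 4 e.\<close>
  define e where "e = \<bar>w a - w b\<bar> / 4"
  have e: "e > 0" using \<open>w a \<noteq> w b\<close> by (simp add: e_def)
  have seg: "closed_segment a b \<subseteq> U"
    using U(2) ab by (simp add: closed_segment_subset)
  obtain d1 where d1: "d1 > 0" "(\<Union>p\<in>closed_segment a b. cball p d1) \<subseteq> U"
    using compact_subset_open_imp_cball_epsilon_subset[OF compact_segment U(1) seg] by blast
  obtain d2 where d2: "d2 > 0" "\<And>x. x \<in> U \<Longrightarrow> dist x a < d2 \<Longrightarrow> dist (w x) (w a) < e"
    using c ab(1) e unfolding continuous_on_iff by meson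
  obtain d3 where d3: "d3 > 0" "\<And>x. x \<in> U \<Longrightarrow> dist x b < d3 \<Longrightarrow> dist (w x) (w b) < e"
    using c ab(2) e unfolding continuous_on_iff by meson
  define \<delta> where "\<delta> = min d1 (min d2 d3) / 2"
  have d: "0 < \<delta>" "\<delta> < d1" "\<delta> < d2" "\<delta> < d3" using d1 d2 d3 by (auto simp: \<delta>_def)
  let ?A = "(\<delta>/2)\<^sup>2" and ?B = "\<delta>\<^sup>2"
  have lt: "?A < ?B" and A: "?A > 0" using d by (auto intro!: power_strict_mono)
  let ?c = "\<lambda>p. cutoff ?A ?B p"
  let ?I = "integral\<^sup>L lborel (?c 0)"
  have UL: "U \<in> sets lebesgue" using U(1) by simp
  have cb: "cball p \<delta> \<subseteq> U" if "p \<in> closed_segment a b" for p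
    using d1(2) d(2) that by fastforce
  have est: "integrable (lebesgue_on U) (\<lambda>x. w x * ?c p x)"
    "\<bar>(LINT x|lebesgue_on U. w x * ?c p x) - w p * ?I\<bar> \<le> e * ?I"
    if p: "p \<in> closed_segment a b" and close: "\<And>x. x \<in> cball p \<delta> \<Longrightarrow> \<bar>w x - w p\<bar> \<le> e" for p
  proof -
    have z: "?c p x = 0" if "x \<notin> cball p \<delta>" for x
      using that cutoff_square(2)[of "\<delta>/2" \<delta> x p] d by (simp add: dist_norm norm_minus_commute)
    have ci: "integrable lborel (?c p)" by (rule integrable_cutoff_weight[OF lt])
    have nn: "0 \<le> ?c p x" for x using step_fn_eq(3)[OF lt] by (simp add: cutoff_def)
    have cpU: "integrable (lebesgue_on U) (?c p)" by (rule integrable_lebesgue_on[OF ci UL])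
    have cI: "integral\<^sup>L (lebesgue_on U) (?c p) = ?I"
      using integral_lebesgue_on_lborel[of "?c p" U] ci UL z cb[OF p] integral_cutoff_translate[OF lt, of p] by force
    have "(\<lambda>x. indicator U x *\<^sub>R w x) \<in> borel_measurable borel"
      by (intro borel_measurable_continuous_on_indicator c) (use U in auto)
    then have "(\<lambda>x. indicator U x *\<^sub>R w x) \<in> borel_measurable (lebesgue_on U)"
      by (intro measurable_restrict_space1 measurable_completion) auto
    then have mw: "w \<in> borel_measurable (lebesgue_on U)"
      by (rule measurable_cong[THEN iffD1, rotated]) auto
    have b: "\<bar>w x * ?c p x - w p * ?c p x\<bar> \<le> e * ?c p x" for x
    proof (cases "x \<in> cball p \<delta>")
      case True
      have "\<bar>w x - w p\<bar> * ?c p x \<le> e * ?c p x" by (rule mult_right_mono[OF close[OF True] nn])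
      then show ?thesis using nn[of x] by (simp add: left_diff_distrib[symmetric] abs_mult)
    qed (simp add: z)
    have i: "integrable (lebesgue_on U) (\<lambda>x. w x * ?c p x - w p * ?c p x)"
    proof (rule Bochner_Integration.integrable_bound)
      show "integrable (lebesgue_on U) (\<lambda>x. e * ?c p x)" using cpU by simp
      show "AE x in lebesgue_on U. norm (w x * ?c p x - w p * ?c p x) \<le> norm (e * ?c p x)"
        using order_trans[OF b abs_ge_self] by (intro AE_I2) (simp only: real_norm_def)
    qed (use mw cpU in measurable)
    show i': "integrable (lebesgue_on U) (\<lambda>x. w x * ?c p x)"
      using Bochner_Integration.integrable_add[OF i integrable_mult_right[OF cpU, of "w p"]] by simp
    have "(LINT x|lebesgue_on U. w x * ?c p x) - w p * ?I = (LINT x|lebesgue_on U. w x * ?c p x - w p * ?c p x)"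
      using i' cpU by (simp add: cI)
    then have "\<bar>(LINT x|lebesgue_on U. w x * ?c p x) - w p * ?I\<bar> = \<bar>LINT x|lebesgue_on U. w x * ?c p x - w p * ?c p x\<bar>"
      by (rule arg_cong)
    also have "\<dots> \<le> (LINT x|lebesgue_on U. \<bar>w x * ?c p x - w p * ?c p x\<bar>)"
      by (rule integral_abs_bound)
    also have "\<dots> \<le> (LINT x|lebesgue_on U. e * ?c p x)"
      by (rule integral_mono[OF integrable_abs[OF i] integrable_mult_right[OF cpU] b])
    also have "\<dots> = e * ?I" by (simp add: cI)
    finally show "\<bar>(LINT x|lebesgue_on U. w x * ?c p x) - w p * ?I\<bar> \<le> e * ?I" .
  qed
  have ca: "\<bar>w x - w a\<bar> \<le> e" if "x \<in> cball a \<delta>" for x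
  proof -
    have "x \<in> U" "dist x a < d2" using cb[of a] that d by (auto simp: dist_commute)
    then show ?thesis using d2(2)[of x] by (simp add: dist_real_def)
  qed
  have cbb: "\<bar>w x - w b\<bar> \<le> e" if "x \<in> cball b \<delta>" for x
  proof -
    have "x \<in> U" "dist x b < d3" using cb[of b] that d by (auto simp: dist_commute)
    then show ?thesis using d3(2)[of x] by (simp add: dist_real_def)
  qed
  note ea = est[of a, OF _ ca] and eb = est[of b, OF _ cbb]
  have "(LINT x|lebesgue_on U. w x * (?c b x - ?c a x)) = 0"
    by (rule integral_cutoff_difference[OF UL d(1) cb w])
  then have "(LINT x|lebesgue_on U. w x * ?c b x) = (LINT x|lebesgue_on U. w x * ?c a x)"
    using ea(1) eb(1) by (simp add: right_diff_distrib)
  then have "\<bar>w a * ?I - w b * ?I\<bar> \<le> 2 * e * ?I"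
    using ea(2) eb(2) by simp
  moreover have I: "?I > 0"
    using integral_cutoff_bounds(1)[OF A lt, of 0] A pi_gt_zero
    by (meson less_le_trans mult_pos_pos)
  ultimately have "\<bar>w a - w b\<bar> * ?I \<le> 2 * e * ?I"
    by (simp add: left_diff_distrib[symmetric] abs_mult)
  then have "\<bar>w a - w b\<bar> \<le> 2 * e" using I by simp
  then show False using e by (simp add: e_def)
qed

text \<open>The energy argument. The explicit candidate v satisfies the weak equation by Green's
  identity, and u and v are themselves admissible test functions, so the weighted energy of the
  difference of their gradients is zero. The coefficient is positive, hence the gradients agree
  almost everywhere.\<close>

lemma conductivity_solution_unique:
  fixes v :: "complex \<Rightarrow> real" and p1 p2 :: "complex \<Rightarrow> complex"
  assumes r: "r > 0" and B: "cball zB r \<subseteq> ball zO \<rho>" and k: "k > 0"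
    and v: "continuous_on (cball zO \<rho>) v"
    and v1: "\<And>x. x \<in> ball zB r \<Longrightarrow> GDERIV v x :> cnj (p1 x)"
    and v2: "\<And>x. x \<in> ball zO \<rho> - cball zB r \<Longrightarrow> GDERIV v x :> cnj (p2 x)"
    and p1: "p1 holomorphic_on ball zB r" "continuous_on (cball zB r) p1"
    and p2: "p2 holomorphic_on ball zO \<rho> - cball zB r" "continuous_on (cball zO \<rho> - ball zB r) p2"
    and match: "\<And>x. x \<in> sphere zB r \<Longrightarrow> k * Re ((x - zB) * p1 x) = Re ((x - zB) * p2 x)"
    and bd: "\<And>x. x \<in> sphere zO \<rho> \<Longrightarrow> Re ((x - zO) * p2 x) = \<rho> * g x"
    and u: "conductivity_solution zO \<rho> zB r k g u"
  shows "\<exists>c. \<forall>x\<in>cball zO \<rho>. u x = v x + c"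
proof -
  let ?M = "lebesgue_on (ball zO \<rho>)"
  define p where "p x = (if x \<in> ball zB r then p1 x else p2 x)" for x
  define E where "E x = cnj (p x)" for x
  define a where "a x = 1 + (k - 1) * indicator (ball zB r) x" for x
  have rho: "\<rho> > 0"
    using B r by (metis ball_empty cball_eq_empty linorder_not_le subset_empty less_imp_le not_less)
  note pp = piecewise_bounded_measurable[OF p1(2) p2(2)]
  have cnjm: "cnj \<in> borel_measurable borel"
    by (intro borel_measurable_continuous_onI continuous_intros)
  have HE: "H1_gradient (ball zO \<rho>) v E"
  proof -
    obtain M where M: "\<And>x. x \<in> cball zO \<rho> \<Longrightarrow> norm (p x) \<le> M"
      using pp(2) unfolding p_def by blast
    have "(\<lambda>x. if x \<in> ball zB r then p1 x else 0) \<in> borel_measurable borel"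
      by (intro borel_measurable_continuous_on_if continuous_on_subset[OF p1(2)]) auto
    moreover have "(\<lambda>x. if x \<in> ball zO \<rho> - ball zB r then p2 x else 0) \<in> borel_measurable borel"
      by (intro borel_measurable_continuous_on_if continuous_on_subset[OF p2(2)]) (auto intro!: sets.Diff)
    ultimately have "(\<lambda>x. (if x \<in> ball zB r then p1 x else 0) + (if x \<in> ball zO \<rho> - ball zB r then p2 x else 0)) \<in> borel_measurable borel"
      by (rule borel_measurable_add)
    moreover have "(\<lambda>x. (if x \<in> ball zB r then p1 x else 0) + (if x \<in> ball zO \<rho> - ball zB r then p2 x else 0)) = (\<lambda>x. indicator (ball zO \<rho>) x *\<^sub>R p x)"
    proof
      fix x
      have "x \<in> ball zO \<rho>" if "x \<in> ball zB r"
        using that B ball_subset_cball by blast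
      then show "(if x \<in> ball zB r then p1 x else 0) + (if x \<in> ball zO \<rho> - ball zB r then p2 x else 0) = indicator (ball zO \<rho>) x *\<^sub>R p x"
        by (auto simp: p_def indicator_def)
    qed
    ultimately have "(\<lambda>x. indicator (ball zO \<rho>) x *\<^sub>R p x) \<in> borel_measurable borel" by simp
    from measurable_compose[OF this cnjm]
    have m: "(\<lambda>x. indicator (ball zO \<rho>) x *\<^sub>R E x) \<in> borel_measurable borel"
      by (simp add: E_def)
    show ?thesis
    proof (rule H1_gradient_piecewise[OF v _ m])
      show "GDERIV v x :> E x" if "x \<in> ball zO \<rho>" "x \<notin> sphere zB r" for x
        using v1[of x] v2[of x] that by (cases "x \<in> ball zB r") (auto simp: E_def p_def less_le)
      show "norm (E x) \<le> M" if "x \<in> ball zO \<rho>" for x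
        using M[of x] that by (simp add: E_def)
    qed
  qed
  \<comment> \<open>The divergence-free field is the flux, that is \<open>k\<close> times the
    gradient inside B. The transmission condition says exactly that its normal component is
    continuous.\<close>
  have green: "(LINT x|?M. a x * (E x \<bullet> H x)) = arc_integral zO \<rho> (\<lambda>y. g y * \<phi> y)"
    if "continuous_on (cball zO \<rho>) \<phi>" "H1_gradient (ball zO \<rho>) \<phi> H" for \<phi> H
  proof -
    have "(LINT x|?M. cnj (if x \<in> ball zB r then of_real k * p1 x else p2 x) \<bullet> H x)
      = integral {0..2*pi} (\<lambda>t. \<phi> (zO + of_real \<rho> * cis t) * Re (of_real \<rho> * cis t * p2 (zO + of_real \<rho> * cis t)))"
    proof (rule green_transmission[OF r B _ _ p2 _ that(2,1)])
      show "(\<lambda>x. of_real k * p1 x) holomorphic_on ball zB r" "continuous_on (cball zB r) (\<lambda>x. of_real k * p1 x)"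
        by (intro holomorphic_intros continuous_intros p1)+
      show "Re ((x - zB) * (of_real k * p1 x)) = Re ((x - zB) * p2 x)" if "x \<in> sphere zB r" for x
      proof -
        have "Re ((x - zB) * (of_real k * p1 x)) = k * Re ((x - zB) * p1 x)" by (simp add: algebra_simps)
        then show ?thesis using match[OF that] by simp
      qed
    qed
    also have "(LINT x|?M. cnj (if x \<in> ball zB r then of_real k * p1 x else p2 x) \<bullet> H x) = (LINT x|?M. a x * (E x \<bullet> H x))"
      by (intro Bochner_Integration.integral_cong refl) (auto simp: a_def E_def p_def inner_complex_def algebra_simps)
    also have "integral {0..2*pi} (\<lambda>t. \<phi> (zO + of_real \<rho> * cis t) * Re (of_real \<rho> * cis t * p2 (zO + of_real \<rho> * cis t)))
      = arc_integral zO \<rho> (\<lambda>y. g y * \<phi> y)"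
      unfolding arc_integral_def
    proof (rule Henstock_Kurzweil_Integration.integral_cong)
      fix t
      have "zO + of_real \<rho> * cis t \<in> sphere zO \<rho>" using rho by (simp add: dist_norm norm_mult)
      from bd[OF this] show "\<phi> (zO + of_real \<rho> * cis t) * Re (of_real \<rho> * cis t * p2 (zO + of_real \<rho> * cis t))
        = g (zO + of_real \<rho> * cis t) * \<phi> (zO + of_real \<rho> * cis t) * \<rho>"
        by (simp del: times_complex.sel)
    qed
    finally show ?thesis .
  qed
  from u obtain G where cu: "continuous_on (cball zO \<rho>) u" and HG: "H1_gradient (ball zO \<rho>) u G"
    and weak: "\<And>\<phi> H. continuous_on (cball zO \<rho>) \<phi> \<Longrightarrow> H1_gradient (ball zO \<rho>) \<phi> H \<Longrightarrow>
      (LINT x|?M. a x * (G x \<bullet> H x)) = arc_integral zO \<rho> (\<lambda>y. g y * \<phi> y)"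
    unfolding conductivity_solution_def a_def by blast
  have mG: "G \<in> borel_measurable ?M" "integrable ?M (\<lambda>x. (norm (G x))\<^sup>2)"
    and mE: "E \<in> borel_measurable ?M" "integrable ?M (\<lambda>x. (norm (E x))\<^sup>2)"
    using HG HE by (auto simp: H1_gradient_def)
  have ma: "a \<in> borel_measurable ?M"
  proof -
    have "(indicator (ball zB r) :: complex \<Rightarrow> real) \<in> borel_measurable borel"
      by (rule borel_measurable_indicator) simp
    then have "a \<in> borel_measurable borel"
      unfolding a_def[abs_def] by (intro borel_measurable_add borel_measurable_times borel_measurable_const)
    then show ?thesis by (intro measurable_restrict_space1 measurable_completion) simp
  qed
  have apos: "a x > 0" "a x \<le> 1 + k" for x
    using k by (auto simp: a_def indicator_def)
  have ia: "integrable ?M (\<lambda>x. a x * f x)" if "integrable ?M f" for f :: "complex \<Rightarrow> real"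
  proof (rule Bochner_Integration.integrable_bound)
    show "integrable ?M (\<lambda>x. (1 + k) * f x)" using that by simp
    show "AE x in ?M. norm (a x * f x) \<le> norm ((1 + k) * f x)"
      using apos k by (intro AE_I2) (simp add: abs_mult mult_right_mono less_imp_le)
  qed (use ma that in measurable)
  note iGG = ia[OF integrable_L2_inner[OF mG(1) mG(1) mG(2) mG(2)]]
    and iGE = ia[OF integrable_L2_inner[OF mG(1) mE(1) mG(2) mE(2)]]
    and iEG = ia[OF integrable_L2_inner[OF mE(1) mG(1) mE(2) mG(2)]]
    and iEE = ia[OF integrable_L2_inner[OF mE(1) mE(1) mE(2) mE(2)]]
  have e: "a x * (norm (G x - E x))\<^sup>2 = a x * (G x \<bullet> G x) - a x * (G x \<bullet> E x) - a x * (E x \<bullet> G x) + a x * (E x \<bullet> E x)" for x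
    by (simp add: power2_norm_eq_inner inner_diff_left inner_diff_right algebra_simps)
  have i: "integrable ?M (\<lambda>x. a x * (norm (G x - E x))\<^sup>2)"
    unfolding e by (intro Bochner_Integration.integrable_add Bochner_Integration.integrable_diff iGG iGE iEG iEE)
  have "(LINT x|?M. a x * (norm (G x - E x))\<^sup>2)
    = (LINT x|?M. a x * (G x \<bullet> G x)) - (LINT x|?M. a x * (G x \<bullet> E x)) - (LINT x|?M. a x * (E x \<bullet> G x)) + (LINT x|?M. a x * (E x \<bullet> E x))"
    unfolding e using iGG iGE iEG iEE by simp
  \<comment> \<open>Testing the equations of u and of v with u and with v turns the four terms into
    boundary integrals of g u, g v, g u, g v with signs +, -, -, +.\<close>
  also have "\<dots> = 0"
    using weak[OF cu HG] weak[OF v HE] green[OF cu HG] green[OF v HE] by simp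
  finally have "AE x in ?M. a x * (norm (G x - E x))\<^sup>2 = 0"
    using integral_nonneg_eq_0_iff_AE[OF i] apos by (simp add: less_imp_le)
  then have AE: "AE x in ?M. G x = E x"
    by eventually_elim (use apos in \<open>auto simp: less_le\<close>)
  have const: "u x - v x = u y - v y" if "x \<in> ball zO \<rho>" "y \<in> ball zO \<rho>" for x y
  proof (rule weak_gradient_zero_constant[where w = "\<lambda>x. u x - v x", OF _ _ _ _ _ that])
    show "continuous_on (ball zO \<rho>) (\<lambda>x. u x - v x)"
      by (intro continuous_intros continuous_on_subset[OF cu] continuous_on_subset[OF v]) auto
    fix f assume t: "C1_test (ball zO \<rho>) f"
    have O: "ball zO \<rho> \<in> sets lebesgue" by simp
    note hu = H1_gradient_test[OF HG O t] and hv = H1_gradient_test[OF HE O t]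
    show "integrable ?M (\<lambda>x. (u x - v x) *\<^sub>R gradient f x)"
      using hu(1) hv(1) by (simp add: scaleR_diff_left)
    have "(LINT x|?M. (u x - v x) *\<^sub>R gradient f x) = (LINT x|?M. u x *\<^sub>R gradient f x) - (LINT x|?M. v x *\<^sub>R gradient f x)"
      unfolding scaleR_diff_left using hu(1) hv(1) by simp
    also have "\<dots> = (LINT x|?M. f x *\<^sub>R E x) - (LINT x|?M. f x *\<^sub>R G x)"
      unfolding hu(3) hv(3) by simp
    also have "(LINT x|?M. f x *\<^sub>R G x) = (LINT x|?M. f x *\<^sub>R E x)"
    proof (rule integral_cong_AE)
      show "AE x in ?M. f x *\<^sub>R G x = f x *\<^sub>R E x"
        using AE by eventually_elim simp
    qed (rule borel_measurable_integrable[OF hu(2)] borel_measurable_integrable[OF hv(2)])+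
    finally show "(LINT x|?M. (u x - v x) *\<^sub>R gradient f x) = 0" by simp
  qed auto
  \<comment> \<open>The difference is constant on the open disk; continuity carries the constant to
    the closed disk.\<close>
  have cw: "continuous_on (closure (ball zO \<rho>)) (\<lambda>x. u x - v x)"
    using rho by (intro continuous_intros) (simp_all add: cu v)
  have "u x = v x + (u zO - v zO)" if "x \<in> cball zO \<rho>" for x
  proof -
    have x: "x \<in> closure (ball zO \<rho>)" using that rho by simp
    have "u x - v x = u zO - v zO"
      by (rule continuous_constant_on_closure[OF cw _ x], erule const) (simp add: rho)
    then show ?thesis by linarith
  qed
  then show ?thesis by blast
qed

subsection \<open>The Cauchy integral of a Hoelder density on a circle\<close>

lemma norm_cis_minus_one: "norm (cis t - 1) = 2 * \<bar>sin (t / 2)\<bar>"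
proof -
  have "cos t = 1 - 2 * (sin (t/2))\<^sup>2"
    using cos_double_sin[of "t/2"] by simp
  then have "(norm (cis t - 1))\<^sup>2 = (2 * \<bar>sin (t/2)\<bar>)\<^sup>2"
    using sin_cos_squared_add[of t] by (simp add: cmod_power2 power2_diff power_mult_distrib algebra_simps)
  then show ?thesis by (rule power2_eq_imp_eq) auto
qed

text \<open>A crude form of Jordan's inequality: for x = t/2 of modulus at most 2, the cubic error
  bound gives |sin x| \<ge> |x| (1 - 4/6).\<close>

lemma angle_le_chord:
  assumes "\<bar>t\<bar> \<le> pi" shows "\<bar>t\<bar> \<le> 3 * norm (cis t - 1)"
proof -
  define x where "x = t / 2"
  have x: "\<bar>x\<bar> \<le> 2" using assms pi_less_4 by (simp add: x_def)
  have "\<bar>sin x - x\<bar> \<le> \<bar>x\<bar> ^ 3 / 6"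
    using Maclaurin_sin_bound[of x 3] by (simp add: sin_coeff_def numeral_3_eq_3 eval_nat_numeral fact_numeral field_simps)
  also have "\<bar>x\<bar> ^ 3 / 6 = \<bar>x\<bar> * (\<bar>x\<bar>\<^sup>2 / 6)"
    by (simp add: power3_eq_cube power2_eq_square)
  also have "\<dots> \<le> \<bar>x\<bar> * (2\<^sup>2 / 6)"
    using x by (intro mult_left_mono divide_right_mono power_mono) auto
  finally have "\<bar>x\<bar> \<le> 3 * \<bar>sin x\<bar>" by (simp add: abs_if split: if_splits)
  then show ?thesis by (simp add: norm_cis_minus_one x_def)
qed

lemma chord_lower_bound:
  assumes "0 \<le> t" "t \<le> 2 * pi" shows "min t (2 * pi - t) \<le> 3 * norm (cis t - 1)"
proof (cases "t \<le> pi")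
  case True
  then show ?thesis using angle_le_chord[of t] assms by simp
next
  case False
  have "cis (t - 2 * pi) = cis t" by (simp add: cis_divide[symmetric])
  then show ?thesis using angle_le_chord[of "t - 2 * pi"] assms False by simp
qed

text \<open>For s > 0 the primitive is (\<i>/s) Ln(1 - s exp(- \<i> t)). The argument has positive
  real part because s < 1, so the principal branch is smooth along the circle and returns to its
  initial value. It is this vanishing that allows a constant to be subtracted from the
  density.\<close>

lemma integral_inverse_circle:
  fixes s :: real
  assumes "0 \<le> s" "s < 1"
  shows "((\<lambda>t. 1 / (of_real s - cis t)) has_integral 0) {0..2*pi}"
proof -
  have ce: "cis t = exp (\<i> * of_real t)" for t by (simp add: cis_conv_exp)
  have ne: "of_real s - cis t \<noteq> 0" for t
  proof
    assume "of_real s - cis t = 0"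
    then have "norm (of_real s :: complex) = norm (cis t)" by simp
    then show False using assms by simp
  qed
  have "\<exists>F. (\<forall>t. (F has_vector_derivative 1 / (of_real s - cis t)) (at t)) \<and> F (2*pi) = F 0"
  proof (cases "s = 0")
    case True
    have "((\<lambda>w. - \<i> * exp (- \<i> * w)) has_field_derivative - exp (- \<i> * of_real t)) (at (of_real t))" for t :: real
      by (auto intro!: derivative_eq_intros simp: algebra_simps)
    from has_vector_derivative_real_field[OF this]
    have "((\<lambda>x. - \<i> * exp (- \<i> * of_real x)) has_vector_derivative 1 / (of_real s - cis t)) (at t)" for t :: real
      by (simp add: True ce exp_minus divide_inverse)
    moreover have "exp (- (\<i> * (2 * of_real pi))) = 1"
      by (simp add: exp_minus exp_two_pi_i mult.commute mult.left_commute)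
    ultimately show ?thesis
      by (intro exI[of _ "\<lambda>x. - \<i> * exp (- \<i> * of_real x)"]) simp
  next
    case False
    let ?F = "\<lambda>w. (\<i> / of_real s) * Ln (1 - of_real s * exp (- \<i> * w))"
    have "(?F has_field_derivative 1 / (of_real s - cis t)) (at (of_real t))" for t :: real
    proof -
      have "norm (of_real s * exp (- \<i> * of_real t)) < 1"
        using assms by (simp add: norm_mult)
      then have "Re (of_real s * exp (- \<i> * of_real t)) < 1"
        using complex_Re_le_cmod[of "of_real s * exp (- \<i> * of_real t)"] by linarith
      then have nn: "1 - of_real s * exp (- \<i> * of_real t) \<notin> \<real>\<^sub>\<le>\<^sub>0"
        by (auto simp: complex_nonpos_Reals_iff)
      define c where "c = cis t"
      have c: "exp (- (\<i> * of_real t)) = 1 / c" "c \<noteq> 0" "of_real s - c \<noteq> 0"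
        using ne[of t] by (simp_all add: c_def ce exp_minus divide_inverse)
      have "(?F has_field_derivative (\<i> / of_real s) * ((of_real s * (\<i> * exp (- \<i> * of_real t))) / (1 - of_real s * exp (- \<i> * of_real t)))) (at (of_real t))"
        using nn by (auto intro!: derivative_eq_intros simp: divide_inverse)
      moreover have "(\<i> / of_real s) * ((of_real s * (\<i> * exp (- \<i> * of_real t))) / (1 - of_real s * exp (- \<i> * of_real t)))
          = 1 / (of_real s - c)"
      proof -
        have "(\<i> / of_real s) * ((of_real s * (\<i> * exp (- \<i> * of_real t))) / (1 - of_real s * exp (- \<i> * of_real t)))
          = - ((1 / c) / (1 - of_real s * (1 / c)))"
          using False by (simp add: c(1))
        also have "1 - of_real s * (1 / c) = (c - of_real s) / c"
          using c(2) by (simp add: divide_simps)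
        also have "- ((1 / c) / ((c - of_real s) / c)) = 1 / (of_real s - c)"
          using c(2,3) by (simp add: minus_divide_right)
        finally show ?thesis .
      qed
      ultimately show ?thesis unfolding c_def[symmetric] by simp
    qed
    from has_vector_derivative_real_field[OF this]
    have "((\<lambda>x. ?F (of_real x)) has_vector_derivative 1 / (of_real s - cis t)) (at t)" for t :: real .
    moreover have "exp (- (\<i> * (2 * of_real pi))) = 1"
      by (simp add: exp_minus exp_two_pi_i mult.commute mult.left_commute)
    ultimately show ?thesis
      by (intro exI[of _ "\<lambda>x. ?F (of_real x)"]) simp
  qed
  then obtain F where F: "\<And>t. (F has_vector_derivative 1 / (of_real s - cis t)) (at t)" "F (2*pi) = F 0"
    by blast
  have "((\<lambda>t. 1 / (of_real s - cis t)) has_integral (F (2*pi) - F 0)) {0..2*pi}"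
    by (rule fundamental_theorem_of_calculus) (simp_all add: has_vector_derivative_at_within F(1))
  then show ?thesis using F(2) by simp
qed

text \<open>Off the circle this is the conjugate of the gradient of the single layer potential,
  since the gradient of ln |x - y| is 1 / cnj (x - y); see
  \<open>gradient_single_layer\<close>.\<close>

definition layer_field :: "complex \<Rightarrow> real \<Rightarrow> (complex \<Rightarrow> real) \<Rightarrow> complex \<Rightarrow> complex" where
  "layer_field zO \<rho> g z = integral {0..2*pi}
     (\<lambda>t. of_real (g (zO + of_real \<rho> * cis t) * \<rho>) / (z - (zO + of_real \<rho> * cis t))) / of_real (2*pi)"

section \<open>Hoelder densities and the regularized Cauchy kernel\<close>

locale circle_density =
  fixes zO :: complex and \<rho> :: real and g :: "complex \<Rightarrow> real" and C \<beta> :: real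
  assumes rho: "\<rho> > 0" and beta: "0 < \<beta>" "\<beta> \<le> 1" and C: "C \<ge> 0"
    and holder: "\<And>x y. x \<in> sphere zO \<rho> \<Longrightarrow> y \<in> sphere zO \<rho> \<Longrightarrow> \<bar>g x - g y\<bar> \<le> C * dist x y powr \<beta>"
    and mean: "arc_integral zO \<rho> g = 0"
begin

definition pt :: "complex \<Rightarrow> complex" where "pt v = zO + of_real \<rho> * v"

lemma pt_sphere: "norm v = 1 \<Longrightarrow> pt v \<in> sphere zO \<rho>"
proof -
  have "norm (zO - pt v) = \<bar>\<rho>\<bar> * norm v"
    by (simp add: pt_def norm_mult)
  then show "norm v = 1 \<Longrightarrow> pt v \<in> sphere zO \<rho>"
    using rho by (simp add: dist_norm)
qed

lemma continuous_density: "continuous_on (sphere zO \<rho>) g"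
proof (rule continuous_onI)
  fix x e :: "_" assume x: "x \<in> sphere zO \<rho>" and e: "(e::real) > 0"
  define d where "d = (e / (C + 1)) powr (1 / \<beta>)"
  have d: "d > 0" using e C by (simp add: d_def)
  show "\<exists>d>0. \<forall>x'\<in>sphere zO \<rho>. dist x' x < d \<longrightarrow> dist (g x') (g x) \<le> e"
  proof (intro exI[of _ d] conjI d ballI impI)
    fix y assume y: "y \<in> sphere zO \<rho>" "dist y x < d"
    have "dist y x powr \<beta> \<le> d powr \<beta>"
      using y beta by (intro powr_mono2) auto
    also have "d powr \<beta> = e / (C + 1)"
      using beta e C by (simp add: d_def powr_powr)
    finally have "C * dist y x powr \<beta> \<le> C * (e / (C + 1))"
      using C by (rule mult_left_mono)
    also have "\<dots> \<le> e" using C e by (simp add: field_simps)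
    finally show "dist (g y) (g x) \<le> e"
      using holder[OF y(1) x] by (simp add: dist_real_def)
  qed
qed

lemma continuous_density_pt:
  "continuous_on S f \<Longrightarrow> (\<And>x. x \<in> S \<Longrightarrow> norm (f x) = 1) \<Longrightarrow> continuous_on S (\<lambda>x. g (pt (f x)))"
  by (rule continuous_on_compose2[OF continuous_density])
     (auto intro!: continuous_intros simp: pt_def dist_norm norm_mult less_imp_le[OF rho])

text \<open>The Cauchy kernel at zO + \<rho> s c in the angle relative to c, with the value of the
  density at the boundary point in direction c subtracted. The radius cancels against the arc
  length. Up to s = 1 the singularity is only of order |t|^(\<beta> - 1).\<close>

definition kern :: "complex \<Rightarrow> real \<Rightarrow> real \<Rightarrow> complex" where
  "kern c s t = of_real (g (pt (c * cis t)) - g (pt c)) / (c * (of_real s - cis t))"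

text \<open>The distance 1 - s to the circle is itself at most |s - cis t|. This makes the kernel
  bound uniform up to the boundary.\<close>

lemma norm_one_minus_cis:
  assumes "0 \<le> s" "s \<le> 1" shows "norm (cis t - 1) \<le> 2 * norm (of_real s - cis t)"
proof -
  have "1 - s \<le> norm (of_real s - cis t)"
    using norm_triangle_ineq3[of "cis t" "of_real s"] assms by (simp add: norm_minus_commute)
  moreover have "norm (cis t - 1) \<le> norm (cis t - of_real s) + norm (of_real s - 1 :: complex)"
    using norm_triangle_ineq[of "cis t - of_real s" "of_real s - 1"] by simp
  moreover have "norm (of_real s - 1 :: complex) = 1 - s"
    using assms by (metis abs_minus_commute abs_of_nonneg diff_ge_0_iff_ge norm_of_real of_real_1 of_real_diff)
  ultimately show ?thesis by (simp add: norm_minus_commute)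
qed

text \<open>Both ends of the parameter interval are the same point of the circle, hence two singular
  terms. They are integrable because \<beta> > 0.\<close>

definition major :: "real \<Rightarrow> real" where
  "major t = t powr (\<beta> - 1) + (2 * pi - t) powr (\<beta> - 1)"

lemma major_integrable: "major integrable_on {0..2*pi}"
proof -
  have 1: "(\<lambda>t. t powr (\<beta> - 1)) integrable_on {0..2*pi}"
    using beta by (intro integrable_on_powr_from_0) auto
  then have "((\<lambda>t. t powr (\<beta> - 1)) has_integral (integral {0..2*pi} (\<lambda>t. t powr (\<beta> - 1)))) (cbox 0 (2*pi))"
    by (simp add: integrable_integral)
  from has_integral_affinity[OF this, of "-1" "2*pi"]
  have "(\<lambda>t. (2*pi - t) powr (\<beta> - 1)) integrable_on (\<lambda>x. - x + 2 * pi) ` {0..2*pi}"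
    by (auto simp: integrable_on_def algebra_simps)
  moreover have "(\<lambda>x. - x + 2 * pi) ` {0..2*pi} = {0..2*pi}"
  proof -
    have "x \<in> (\<lambda>x. - x + 2 * pi) ` {0..2*pi}" if "x \<in> {0..2*pi}" for x
      using that by (intro image_eqI[of _ _ "2*pi - x"]) auto
    then show ?thesis by auto
  qed
  ultimately show ?thesis
    unfolding major_def[abs_def] using 1 by (intro integrable_add) auto
qed

text \<open>The constant 6 is 2 from \<open>norm_one_minus_cis\<close> times 3, which bounds the
  power \<open>3 powr (1 - \<beta>)\<close> lost in passing from the chord to the angle.\<close>

lemma kern_bound:
  assumes c: "norm c = 1" and s: "0 \<le> s" "s \<le> 1" and t: "t \<in> {0..2*pi}"
  shows "norm (kern c s t) \<le> 6 * C * \<rho> powr \<beta> * major t"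
proof (cases "cis t = 1")
  case True
  then show ?thesis
    using C by (simp add: kern_def major_def)
next
  case False
  let ?n = "norm (cis t - 1)"
  have n: "?n > 0" using False by simp
  have t': "0 < t" "t < 2 * pi"
    using False t by (auto simp: less_le)
  have "\<bar>g (pt (c * cis t)) - g (pt c)\<bar> \<le> C * dist (pt (c * cis t)) (pt c) powr \<beta>"
    using c by (intro holder pt_sphere) (simp_all add: norm_mult)
  also have "dist (pt (c * cis t)) (pt c) = \<rho> * ?n"
  proof -
    have "pt (c * cis t) - pt c = of_real \<rho> * (c * (cis t - 1))"
      by (simp add: pt_def algebra_simps)
    then show ?thesis using c rho by (simp add: dist_norm norm_mult)
  qed
  also have "(\<rho> * ?n) powr \<beta> = \<rho> powr \<beta> * ?n powr \<beta>"
    using rho by (simp add: powr_mult)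
  finally have num: "\<bar>g (pt (c * cis t)) - g (pt c)\<bar> \<le> C * (\<rho> powr \<beta> * ?n powr \<beta>)" .
  have "norm (kern c s t) = \<bar>g (pt (c * cis t)) - g (pt c)\<bar> / norm (of_real s - cis t)"
    using c by (simp add: kern_def norm_divide norm_mult flip: of_real_diff)
  also have "\<dots> \<le> (C * (\<rho> powr \<beta> * ?n powr \<beta>)) / (?n / 2)"
    using norm_one_minus_cis[OF s, of t] n by (intro frac_le num) (use C in auto)
  also have "\<dots> = 2 * C * \<rho> powr \<beta> * ?n powr (\<beta> - 1)"
    using n by (simp add: powr_diff)
  also have "?n powr (\<beta> - 1) \<le> 3 * major t"
  proof -
    define m where "m = min t (2 * pi - t)"
    have m: "m > 0" "m / 3 \<le> ?n"
      using chord_lower_bound[of t] t' by (auto simp: m_def)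
    have "?n powr (\<beta> - 1) \<le> (m / 3) powr (\<beta> - 1)"
      using m beta by (intro powr_mono2') auto
    also have "\<dots> = 3 powr (1 - \<beta>) * m powr (\<beta> - 1)"
      using m by (simp add: powr_divide powr_diff field_simps)
    also have "\<dots> \<le> 3 * m powr (\<beta> - 1)"
      using beta powr_mono[of "1 - \<beta>" 1 "3::real"] by (intro mult_right_mono) auto
    also have "m powr (\<beta> - 1) \<le> major t"
      by (auto simp: m_def major_def min_def)
    finally show ?thesis by simp
  qed
  then have "2 * C * \<rho> powr \<beta> * ?n powr (\<beta> - 1) \<le> 2 * C * \<rho> powr \<beta> * (3 * major t)"
    using C by (intro mult_left_mono) auto
  finally show ?thesis by simp
qed

lemma kern_tendsto:
  assumes c: "\<And>n. norm (c n) = 1" "c \<longlonglongrightarrow> c'" and s: "\<And>n. 0 \<le> s n" "\<And>n. s n \<le> 1" "s \<longlonglongrightarrow> s'"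
  shows "(\<lambda>n. kern (c n) (s n) t) \<longlonglongrightarrow> kern c' s' t"
proof (cases "cis t = 1")
  case True
  then show ?thesis by (simp add: kern_def)
next
  case False
  have c': "norm c' = 1"
    using tendsto_norm[OF c(2)] c(1) by (simp add: LIMSEQ_const_iff)
  have s': "0 \<le> s'" "s' \<le> 1"
    using s by (auto intro: LIMSEQ_le_const LIMSEQ_le_const2)
  have ne: "of_real s' - cis t \<noteq> 0"
    using norm_one_minus_cis[OF s', of t] False by auto
  have g: "(\<lambda>n. g (pt (d n))) \<longlonglongrightarrow> g (pt d')" if "\<And>n. norm (d n) = 1" "d \<longlonglongrightarrow> d'" "norm d' = 1" for d d'
  proof -
    have "(\<lambda>n. pt (d n)) \<longlonglongrightarrow> pt d'" unfolding pt_def by (intro tendsto_intros that)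
    then show ?thesis
      by (rule continuous_on_tendsto_compose[OF continuous_density])
         (use that pt_sphere in \<open>auto intro!: always_eventually simp del: mem_sphere\<close>)
  qed
  have "(\<lambda>n. g (pt (c n * cis t))) \<longlonglongrightarrow> g (pt (c' * cis t))"
    by (rule g) (use c c' in \<open>auto simp: norm_mult intro!: tendsto_intros\<close>)
  moreover have "(\<lambda>n. g (pt (c n))) \<longlonglongrightarrow> g (pt c')"
    by (rule g) (use c c' in auto)
  ultimately show ?thesis
    unfolding kern_def using ne c' by (intro tendsto_intros c s) auto
qed

lemma kern_integrable_interior:
  assumes c: "norm c = 1" and s: "0 \<le> s" "s < 1"
  shows "kern c s integrable_on {0..2*pi}"
proof (rule integrable_continuous_real)
  have ne: "of_real s - cis t \<noteq> 0" for t
  proof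
    assume "of_real s - cis t = 0"
    then have "norm (of_real s :: complex) = norm (cis t)" by simp
    then show False using s by simp
  qed
  show "continuous_on {0..2*pi} (kern c s)"
    unfolding kern_def[abs_def]
    by (intro continuous_intros continuous_density_pt) (use c ne in \<open>auto simp: norm_mult\<close>)
qed

text \<open>For s = 1 the kernel may be unbounded. It is the pointwise limit of kernels with smaller
  radius, which are continuous and share the majorant.\<close>

lemma kern_integrable:
  assumes c: "norm c = 1" and s: "0 \<le> s" "s \<le> 1"
  shows "kern c s integrable_on {0..2*pi}"
proof (rule dominated_convergence(1))
  define i where "i n = inverse (real (Suc n))" for n
  define q where "q n = s * (1 - i n)" for n
  have iv: "0 < i n" "i n \<le> 1" for n
    by (simp_all add: i_def field_simps)
  have li: "i \<longlonglongrightarrow> 0"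
    unfolding i_def by (rule LIMSEQ_inverse_real_of_nat)
  have q: "0 \<le> q n" "q n < 1" for n
  proof -
    show "0 \<le> q n" unfolding q_def using iv[of n] s by (intro mult_nonneg_nonneg) auto
    have "q n \<le> 1 * (1 - i n)"
      unfolding q_def using iv[of n] s by (intro mult_right_mono) auto
    also have "\<dots> < 1" using iv(1)[of n] by simp
    finally show "q n < 1" .
  qed
  have lq: "q \<longlonglongrightarrow> s"
    unfolding q_def using tendsto_mult[OF tendsto_const tendsto_diff[OF tendsto_const li], of s 1] by simp
  show "kern c (q n) integrable_on {0..2*pi}" for n
    by (rule kern_integrable_interior[OF c q])
  show "(\<lambda>t. 6 * C * \<rho> powr \<beta> * major t) integrable_on {0..2*pi}"
    using integrable_cmul[OF major_integrable] by simp
  show "norm (kern c (q n) t) \<le> 6 * C * \<rho> powr \<beta> * major t" if "t \<in> {0..2*pi}" for n t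
    using q[of n] that by (intro kern_bound c) auto
  show "(\<lambda>n. kern c (q n) t) \<longlonglongrightarrow> kern c s t" for t
    by (rule kern_tendsto[OF c tendsto_const q(1) less_imp_le[OF q(2)] lq])
qed

lemma kern_zero_mean:
  assumes c: "norm c = 1"
  shows "integral {0..2*pi} (\<lambda>t. g (pt (c * cis t))) = 0"
proof -
  have cg: "continuous_on (sphere 0 1) (\<lambda>v. g (pt v))"
    by (rule continuous_density_pt) (auto intro!: continuous_intros)
  have "integral {0..2*pi} (\<lambda>t. g (pt (cis t)) * \<rho>) = 0"
    using mean by (simp add: arc_integral_def pt_def)
  then have "integral {0..2*pi} (\<lambda>t. g (pt (cis t))) = 0"
    using rho by simp
  then show ?thesis
    using integral_circle_shift[OF cg c] by (simp add: mult.commute)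
qed

end

section \<open>The gradient field up to the boundary, its flux and its reflection\<close>

context circle_density
begin

text \<open>The continuous extension of \<open>layer_field\<close> from the open disk to the closed
  one, written in polar coordinates. At the center the direction is arbitrary and set to 1. On the
  circle this is the limit from inside, not the value of the singular integral.\<close>

definition field :: "complex \<Rightarrow> complex" where
  "field z = integral {0..2*pi} (kern (if z = zO then 1 else sgn (z - zO)) (norm (z - zO) / \<rho>)) / of_real (2*pi)"

lemma circle_coords:
  assumes "z \<in> cball zO \<rho>"
  shows "norm (if z = zO then 1 else sgn (z - zO)) = 1" "0 \<le> norm (z - zO) / \<rho>" "norm (z - zO) / \<rho> \<le> 1"
    and "z = pt ((if z = zO then 1 else sgn (z - zO)) * of_real (norm (z - zO) / \<rho>))"
proof -
  have n: "norm (z - zO) \<le> \<rho>" using assms by (simp add: dist_norm norm_minus_commute)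
  show "norm (if z = zO then 1 else sgn (z - zO)) = 1" by (simp add: norm_sgn)
  show "0 \<le> norm (z - zO) / \<rho>" "norm (z - zO) / \<rho> \<le> 1" using n rho by simp_all
  show "z = pt ((if z = zO then 1 else sgn (z - zO)) * of_real (norm (z - zO) / \<rho>))"
    using rho by (simp add: pt_def sgn_eq)
qed

text \<open>Rotating the circle does not change the integral, and the subtracted constant
  contributes a multiple of the integral in \<open>integral_inverse_circle\<close>, which is zero
  inside.\<close>

lemma layer_field_eq_kern:
  assumes c: "norm c = 1" and s: "0 \<le> s" "s < 1"
  shows "layer_field zO \<rho> g (pt (c * of_real s)) = integral {0..2*pi} (kern c s) / of_real (2*pi)"
proof -
  define p where "p v = of_real (g (pt v)) / (c * of_real s - v)" for v
  have ne: "c * of_real s - v \<noteq> 0" if "norm v = 1" for v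
  proof
    assume "c * of_real s - v = 0"
    then have "norm (c * of_real s) = norm v" by simp
    then show False using s that c by (simp add: norm_mult)
  qed
  have p: "continuous_on (sphere 0 1) p"
    unfolding p_def by (intro continuous_intros continuous_density_pt) (use ne in auto)
  have "integral {0..2*pi} (\<lambda>t. of_real (g (zO + of_real \<rho> * cis t) * \<rho>) / (pt (c * of_real s) - (zO + of_real \<rho> * cis t)))
      = integral {0..2*pi} (\<lambda>t. p (cis t))"
  proof (rule Henstock_Kurzweil_Integration.integral_cong)
    fix t
    have "pt (c * of_real s) - (zO + of_real \<rho> * cis t) = of_real \<rho> * (c * of_real s - cis t)"
      by (simp add: pt_def algebra_simps)
    then show "of_real (g (zO + of_real \<rho> * cis t) * \<rho>) / (pt (c * of_real s) - (zO + of_real \<rho> * cis t)) = p (cis t)"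
      using rho by (simp add: p_def pt_def)
  qed
  also have "\<dots> = integral {0..2*pi} (\<lambda>t. p (cis t * c))"
    by (rule integral_circle_shift[OF p c, symmetric])
  also have "\<dots> = integral {0..2*pi} (\<lambda>t. kern c s t + of_real (g (pt c)) / c * (1 / (of_real s - cis t)))"
  proof (rule Henstock_Kurzweil_Integration.integral_cong)
    fix t
    have "c * of_real s - cis t * c = c * (of_real s - cis t)" by (simp add: algebra_simps)
    then show "p (cis t * c) = kern c s t + of_real (g (pt c)) / c * (1 / (of_real s - cis t))"
      by (simp add: p_def kern_def mult.commute diff_divide_distrib)
  qed
  also have "\<dots> = integral {0..2*pi} (kern c s)"
  proof -
    have "((\<lambda>t. kern c s t + of_real (g (pt c)) / c * (1 / (of_real s - cis t))) has_integral
        (integral {0..2*pi} (kern c s) + of_real (g (pt c)) / c * 0)) {0..2*pi}"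
      by (intro has_integral_add has_integral_mult_right integral_inverse_circle s integrable_integral
          kern_integrable_interior c)
    then show ?thesis by (simp add: integral_unique)
  qed
  finally show ?thesis by (simp add: layer_field_def)
qed

lemma field_eq_layer_field:
  assumes "z \<in> ball zO \<rho>" shows "field z = layer_field zO \<rho> g z"
proof -
  have z: "z \<in> cball zO \<rho>" using assms by auto
  have "norm (z - zO) / \<rho> < 1" using assms rho by (simp add: dist_norm norm_minus_commute)
  from layer_field_eq_kern[OF circle_coords(1,2)[OF z] this] show ?thesis
    unfolding field_def circle_coords(4)[OF z, symmetric] by simp
qed

text \<open>The bound is C times a number depending on \<rho> and \<beta> only. This is the origin
  of the constant in (ii) and of its independence of g and of the inclusion.\<close>

lemma field_bound:
  assumes "z \<in> cball zO \<rho>"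
  shows "norm (field z) \<le> C * (6 * \<rho> powr \<beta> * integral {0..2*pi} major / (2 * pi))"
proof -
  let ?c = "if z = zO then 1 else sgn (z - zO)" and ?s = "norm (z - zO) / \<rho>"
  note cc = circle_coords[OF assms]
  have "norm (integral {0..2*pi} (kern ?c ?s)) \<le> integral {0..2*pi} (\<lambda>t. 6 * C * \<rho> powr \<beta> * major t)"
    by (rule integral_norm_bound_integral[OF kern_integrable[OF cc(1-3)] _ kern_bound[OF cc(1-3)]])
       (use integrable_cmul[OF major_integrable] in auto)
  also have "\<dots> = 6 * C * \<rho> powr \<beta> * integral {0..2*pi} major"
    by simp
  finally have "norm (integral {0..2*pi} (kern ?c ?s)) / (2*pi) \<le> 6 * C * \<rho> powr \<beta> * integral {0..2*pi} major / (2*pi)"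
    by (rule divide_right_mono) simp
  then show ?thesis
    by (simp add: field_def norm_divide norm_mult mult_ac)
qed

lemma layer_field_holomorphic: "layer_field zO \<rho> g holomorphic_on - sphere zO \<rho>"
proof (rule holomorphic_onI)
  fix x assume x: "x \<in> - sphere zO \<rho>"
  have "open (- sphere zO \<rho>)" by (simp add: open_Compl)
  then obtain e where e: "e > 0" "ball x e \<subseteq> - sphere zO \<rho>"
    using x openE by blast
  have ne: "y - pt (cis t) \<noteq> 0" if "y \<in> ball x e" for y t
    using e(2) that pt_sphere[of "cis t"] by auto
  have "((\<lambda>y. integral (cbox 0 (2*pi)) (\<lambda>t. of_real (g (pt (cis t)) * \<rho>) / (y - pt (cis t)))) has_field_derivative
     integral (cbox 0 (2*pi)) (\<lambda>t. - (of_real (g (pt (cis t)) * \<rho>) / (y - pt (cis t))\<^sup>2))) (at y within ball x e)"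
    if "y \<in> ball x e" for y
  proof (rule leibniz_rule_field_derivative[OF _ _ _ that])
    show "((\<lambda>y. of_real (g (pt (cis t)) * \<rho>) / (y - pt (cis t))) has_field_derivative - (of_real (g (pt (cis t)) * \<rho>) / (y - pt (cis t))\<^sup>2)) (at y within ball x e)"
      if "y \<in> ball x e" for y t
      using ne[OF that, of t] by (auto intro!: derivative_eq_intros simp: power2_eq_square)
    have cp: "continuous_on S (\<lambda>t. pt (cis (f t)))" if "continuous_on S f" for f :: "'x::topological_space \<Rightarrow> real" and S
      unfolding pt_def by (intro continuous_intros that)
    show "(\<lambda>t. of_real (g (pt (cis t)) * \<rho>) / (y - pt (cis t))) integrable_on cbox 0 (2*pi)" if "y \<in> ball x e" for y
      by (intro integrable_continuous continuous_intros continuous_density_pt cp) (use ne[OF that] in auto)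
    show "continuous_on (ball x e \<times> cbox 0 (2*pi)) (\<lambda>(y, t). - (of_real (g (pt (cis t)) * \<rho>) / (y - pt (cis t))\<^sup>2))"
      unfolding split_def
      by (intro continuous_intros continuous_density_pt cp) (use ne in auto)
  qed simp
  from this[of x] e have "(\<lambda>y. integral (cbox 0 (2*pi)) (\<lambda>t. of_real (g (pt (cis t)) * \<rho>) / (y - pt (cis t)))) field_differentiable at x"
    by (auto simp: field_differentiable_def at_within_open[of x "ball x e"])
  then have "(\<lambda>y. integral (cbox 0 (2*pi)) (\<lambda>t. of_real (g (pt (cis t)) * \<rho>) / (y - pt (cis t))) / of_real (2*pi)) field_differentiable at x"
    by (intro derivative_intros field_differentiable_divide) auto
  then show "layer_field zO \<rho> g field_differentiable at x within - sphere zO \<rho>"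
    by (simp add: layer_field_def[abs_def] pt_def field_differentiable_at_within)
qed

text \<open>Inside, continuity comes from holomorphy, since the direction used in
  \<open>field\<close> jumps at the center. At boundary points the kernels converge pointwise and
  are dominated by \<open>major\<close>.\<close>

lemma field_continuous: "continuous_on (cball zO \<rho>) field"
proof (rule continuous_on_sequentiallyI)
  fix u a assume u: "\<forall>n. u n \<in> cball zO \<rho>" and a: "a \<in> cball zO \<rho>" and lim: "u \<longlonglongrightarrow> a"
  show "(\<lambda>n. field (u n)) \<longlonglongrightarrow> field a"
  proof (cases "a \<in> ball zO \<rho>")
    case True
    have "continuous_on (ball zO \<rho>) (layer_field zO \<rho> g)"
      by (intro holomorphic_on_imp_continuous_on holomorphic_on_subset[OF layer_field_holomorphic]) auto
    then have "isCont (layer_field zO \<rho> g) a"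
      using True by (simp add: continuous_on_eq_continuous_at)
    then have 1: "(\<lambda>n. layer_field zO \<rho> g (u n)) \<longlonglongrightarrow> layer_field zO \<rho> g a"
      using lim by (rule isCont_tendsto_compose)
    have "\<forall>\<^sub>F n in sequentially. u n \<in> ball zO \<rho>"
      using lim True by (rule topological_tendstoD[OF _ open_ball])
    then have "\<forall>\<^sub>F n in sequentially. layer_field zO \<rho> g (u n) = field (u n)"
      by eventually_elim (simp add: field_eq_layer_field)
    then show ?thesis
      using 1 True by (simp add: field_eq_layer_field tendsto_cong)
  next
    case False
    then have ne: "a \<noteq> zO" using rho by auto
    let ?c = "\<lambda>z. if z = zO then 1 else sgn (z - zO)" and ?s = "\<lambda>z. norm (z - zO) / \<rho>"
    have "(\<lambda>n. sgn (u n - zO)) \<longlonglongrightarrow> sgn (a - zO)"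
      using ne by (intro tendsto_intros lim) auto
    moreover have "\<forall>\<^sub>F n in sequentially. u n \<noteq> zO"
      using tendsto_imp_eventually_ne[OF lim ne] .
    then have "\<forall>\<^sub>F n in sequentially. sgn (u n - zO) = ?c (u n)"
      by eventually_elim simp
    ultimately have lc: "(\<lambda>n. ?c (u n)) \<longlonglongrightarrow> ?c a"
      using ne by (simp add: tendsto_cong)
    have ls: "(\<lambda>n. ?s (u n)) \<longlonglongrightarrow> ?s a"
      using rho by (intro tendsto_intros lim) auto
    note cu = circle_coords[OF u[rule_format]] and ca = circle_coords[OF a]
    have "(\<lambda>n. integral {0..2*pi} (kern (?c (u n)) (?s (u n)))) \<longlonglongrightarrow> integral {0..2*pi} (kern (?c a) (?s a))"
    proof (rule dominated_convergence(2))
      show "kern (?c (u n)) (?s (u n)) integrable_on {0..2*pi}" for n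
        by (rule kern_integrable[OF cu(1-3)])
      show "(\<lambda>t. 6 * C * \<rho> powr \<beta> * major t) integrable_on {0..2*pi}"
        using integrable_cmul[OF major_integrable] by simp
      show "norm (kern (?c (u n)) (?s (u n)) t) \<le> 6 * C * \<rho> powr \<beta> * major t" if "t \<in> {0..2*pi}" for n t
        by (rule kern_bound[OF cu(1-3) that])
      show "(\<lambda>n. kern (?c (u n)) (?s (u n)) t) \<longlonglongrightarrow> kern (?c a) (?s a) t" for t
        by (rule kern_tendsto[OF cu(1) lc cu(2,3) ls])
    qed
    then show ?thesis
      unfolding field_def by (intro tendsto_intros) auto
  qed
qed

text \<open>The jump relation. For s = 1 the real part of 1/(1 - cis t) is 1/2 for every t, so the
  normal component is half the mean of g(y) - g(x); the mean of g is zero.\<close>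

lemma field_normal:
  assumes x: "x \<in> sphere zO \<rho>"
  shows "Re ((x - zO) * field x) = - (\<rho> / 2) * g x"
proof -
  define c where "c = sgn (x - zO)"
  have nx: "norm (x - zO) = \<rho>" using x by (simp add: dist_norm norm_minus_commute)
  then have x0: "x \<noteq> zO" using rho by auto
  have c: "norm c = 1" using x0 by (simp add: c_def norm_sgn)
  have c0: "c \<noteq> 0" using c by auto
  have xc: "x - zO = of_real \<rho> * c" using rho nx by (simp add: c_def sgn_eq)
  then have ptc: "pt c = x" by (simp add: pt_def algebra_simps)
  have f: "field x = integral {0..2*pi} (kern c 1) / of_real (2*pi)"
    using x0 nx rho by (simp add: field_def c_def)
  have ki: "kern c 1 integrable_on {0..2*pi}" by (rule kern_integrable[OF c]) auto
  have r: "Re (c * kern c 1 t) = (g (pt (c * cis t)) - g x) / 2" for t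
  proof (cases "cis t = 1")
    case True
    then show ?thesis by (simp add: kern_def ptc)
  next
    case False
    have "Re (1 / (1 - cis t)) = 1 / 2"
    proof -
      have n: "(1 - cos t)\<^sup>2 + (sin t)\<^sup>2 = 2 * (1 - cos t)"
        using sin_cos_squared_add[of t] by (simp add: power2_eq_square algebra_simps)
      have "cos t \<noteq> 1"
      proof
        assume "cos t = 1"
        then have "sin t = 0" using sin_cos_squared_add[of t] by simp
        with \<open>cos t = 1\<close> have "cis t = 1" by (simp add: complex_eq_iff)
        with False show False by simp
      qed
      then show ?thesis by (simp add: Re_divide n)
    qed
    moreover have "c * kern c 1 t = of_real (g (pt (c * cis t)) - g x) * (1 / (1 - cis t))"
      using c0 by (simp add: kern_def ptc)
    moreover have "Re (of_real a * w) = a * Re w" for a w by simp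
    ultimately show ?thesis by (simp only:)
  qed
  have ci: "(\<lambda>t. g (pt (c * cis t))) integrable_on {0..2*pi}"
    by (intro integrable_continuous_real continuous_density_pt continuous_intros) (simp add: norm_mult c)
  have "Re (c * integral {0..2*pi} (kern c 1)) = integral {0..2*pi} (\<lambda>t. Re (c * kern c 1 t))"
  proof -
    have "((\<lambda>t. Re (c * kern c 1 t)) has_integral Re (c * integral {0..2*pi} (kern c 1))) {0..2*pi}"
      by (intro has_integral_Re has_integral_mult_right integrable_integral ki)
    then show ?thesis by (simp add: integral_unique)
  qed
  also have "\<dots> = integral {0..2*pi} (\<lambda>t. (g (pt (c * cis t)) - g x) / 2)"
    by (simp only: r)
  also have "\<dots> = (integral {0..2*pi} (\<lambda>t. g (pt (c * cis t))) - 2 * pi * g x) / 2"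
    using has_integral_diff[OF integrable_integral[OF ci] has_integral_const_real[of "g x" 0 "2*pi"]]
    by (simp add: integral_unique)
  also have "\<dots> = - pi * g x"
    by (simp add: kern_zero_mean[OF c])
  finally have "Re (c * integral {0..2*pi} (kern c 1)) = - pi * g x" .
  then have "\<rho> / (2*pi) * Re (c * integral {0..2*pi} (kern c 1)) = - (\<rho> / 2) * g x"
    by simp
  moreover have "(x - zO) * field x = of_real (\<rho> / (2*pi)) * (c * integral {0..2*pi} (kern c 1))"
    by (simp add: xc f)
  ultimately show ?thesis by simp
qed

text \<open>Reflection multiplies the distances from X to all points of the circle by the same
  factor, so for a density of mean zero the potential takes equal values at X and at its reflection.
  The lemma is the derivative of this fact; in the kernel the common factor shows up as a term
  independent of the point of the circle.\<close>

lemma layer_field_reflection: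
  assumes X: "X \<in> ball zO \<rho>" "X \<noteq> zO"
  shows "layer_field zO \<rho> g (circle_reflection zO \<rho> X)
    = - cnj ((X - zO)\<^sup>2 / of_real (\<rho>\<^sup>2) * layer_field zO \<rho> g X)"
proof -
  define w where "w = X - zO"
  have w0: "w \<noteq> 0" and wr: "norm w < \<rho>"
    using X by (auto simp: w_def dist_norm norm_minus_commute)
  have R: "circle_reflection zO \<rho> X = zO + of_real (\<rho>\<^sup>2) / cnj w"
  proof -
    have "of_real (\<rho>\<^sup>2 / (norm w)\<^sup>2) = of_real (\<rho>\<^sup>2) / (w * cnj w)"
      by (simp only: of_real_divide complex_norm_square)
    then have "of_real (\<rho>\<^sup>2 / (norm w)\<^sup>2) * w = of_real (\<rho>\<^sup>2) / (w * cnj w) * w"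
      by (simp only:)
    also have "\<dots> = of_real (\<rho>\<^sup>2) / cnj w"
      using w0 by simp
    finally have "of_real (\<rho>\<^sup>2 / (norm w)\<^sup>2) * w = of_real (\<rho>\<^sup>2) / cnj w" .
    then show ?thesis
      by (simp only: circle_reflection_def w_def[symmetric] scaleR_conv_of_real add.commute)
  qed
  have point: "1 / (of_real (\<rho>\<^sup>2) / cnj w - of_real \<rho> * v) = - cnj (w\<^sup>2 / of_real (\<rho>\<^sup>2) * (1 / (w - of_real \<rho> * v)) - w / of_real (\<rho>\<^sup>2))"
    if v: "norm v = 1" for v
  proof -
    have v0: "v \<noteq> 0" and cv: "cnj v = 1 / v"
    proof -
      have "v * cnj v = of_real ((norm v)\<^sup>2)" by (rule complex_norm_square[symmetric])
      then have "v * cnj v = 1" using v by simp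
      then show "v \<noteq> 0" by auto
      with \<open>v * cnj v = 1\<close> show "cnj v = 1 / v"
        by (intro eq_divide_imp) (simp_all add: mult.commute)
    qed
    define a where "a = cnj w"
    have a0: "a \<noteq> 0" using w0 by (simp add: a_def)
    have ne: "a * v - of_real \<rho> \<noteq> 0"
    proof
      assume "a * v - of_real \<rho> = 0"
      then have "norm (a * v) = norm (of_real \<rho> :: complex)" by simp
      then show False using v wr rho by (simp add: norm_mult a_def)
    qed
    have r0: "(of_real \<rho> :: complex) \<noteq> 0" using rho by simp
    have "cnj (w\<^sup>2 / of_real (\<rho>\<^sup>2) * (1 / (w - of_real \<rho> * v)) - w / of_real (\<rho>\<^sup>2))
        = a\<^sup>2 / of_real (\<rho>\<^sup>2) * (1 / (a - of_real \<rho> * (1 / v))) - a / of_real (\<rho>\<^sup>2)"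
      by (simp add: a_def cv)
    also have "a - of_real \<rho> * (1 / v) = (a * v - of_real \<rho>) / v"
      using v0 by (simp add: field_simps)
    also have "a\<^sup>2 / of_real (\<rho>\<^sup>2) * (1 / ((a * v - of_real \<rho>) / v)) - a / of_real (\<rho>\<^sup>2)
        = a / (of_real \<rho> * (a * v - of_real \<rho>))"
      using ne r0 v0 by (simp add: divide_simps power2_eq_square) (simp add: algebra_simps)
    finally have 1: "cnj (w\<^sup>2 / of_real (\<rho>\<^sup>2) * (1 / (w - of_real \<rho> * v)) - w / of_real (\<rho>\<^sup>2)) = a / (of_real \<rho> * (a * v - of_real \<rho>))" .
    have 2: "of_real (\<rho>\<^sup>2) / a - of_real \<rho> * v = - (of_real \<rho> * (a * v - of_real \<rho>)) / a"
      using a0 by (simp add: field_simps power2_eq_square)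
    show ?thesis
      unfolding a_def[symmetric] 1 2 by simp
  qed
  define m where "m t = complex_of_real (g (pt (cis t)) * \<rho>)" for t
  define J where "J = integral {0..2*pi} (\<lambda>t. m t / (w - of_real \<rho> * cis t))"
  have neX: "w - of_real \<rho> * cis t \<noteq> 0" for t
  proof
    assume "w - of_real \<rho> * cis t = 0"
    then have "norm w = norm (of_real \<rho> * cis t)" by simp
    then show False using wr rho by (simp add: norm_mult)
  qed
  have cm: "continuous_on {0..2*pi} m"
    unfolding m_def by (intro continuous_intros continuous_density_pt) auto
  have iJ: "((\<lambda>t. m t / (w - of_real \<rho> * cis t)) has_integral J) {0..2*pi}"
    unfolding J_def
    by (intro integrable_integral integrable_continuous_real continuous_intros cm) (use neX in auto)
  have im: "(m has_integral 0) {0..2*pi}"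
  proof -
    have "((\<lambda>t. g (pt (1 * cis t))) has_integral 0) {0..2*pi}"
      using kern_zero_mean[of 1]
      by (intro has_integral_eq_rhs[OF integrable_integral] integrable_continuous_real continuous_density_pt continuous_intros) auto
    from has_integral_linear[OF has_integral_mult_left[OF this, of \<rho>] bounded_linear_of_real]
    show ?thesis by (simp add: comp_def m_def[abs_def])
  qed
  have "((\<lambda>t. w\<^sup>2 / of_real (\<rho>\<^sup>2) * (m t / (w - of_real \<rho> * cis t)) - w / of_real (\<rho>\<^sup>2) * m t) has_integral
      (w\<^sup>2 / of_real (\<rho>\<^sup>2) * J - w / of_real (\<rho>\<^sup>2) * 0)) {0..2*pi}"
    by (intro has_integral_diff has_integral_mult_right iJ im)
  then have "((\<lambda>t. - cnj (w\<^sup>2 / of_real (\<rho>\<^sup>2) * (m t / (w - of_real \<rho> * cis t)) - w / of_real (\<rho>\<^sup>2) * m t)) has_integral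
      - cnj (w\<^sup>2 / of_real (\<rho>\<^sup>2) * J)) {0..2*pi}"
    by (intro has_integral_neg) (subst (asm) has_integral_cnj[symmetric], simp add: comp_def)
  moreover have "- cnj (w\<^sup>2 / of_real (\<rho>\<^sup>2) * (m t / (w - of_real \<rho> * cis t)) - w / of_real (\<rho>\<^sup>2) * m t)
     = m t / (of_real (\<rho>\<^sup>2) / cnj w - of_real \<rho> * cis t)" for t
  proof -
    have "m t / (of_real (\<rho>\<^sup>2) / cnj w - of_real \<rho> * cis t) = m t * (1 / (of_real (\<rho>\<^sup>2) / cnj w - of_real \<rho> * cis t))"
      by simp
    also have "\<dots> = - cnj (m t * (w\<^sup>2 / of_real (\<rho>\<^sup>2) * (1 / (w - of_real \<rho> * cis t)) - w / of_real (\<rho>\<^sup>2)))"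
    proof -
      have "cnj (m t) = m t" by (simp add: m_def)
      then show ?thesis
        by (simp only: point[OF norm_cis] complex_cnj_mult mult_minus_right)
    qed
    also have "m t * (w\<^sup>2 / of_real (\<rho>\<^sup>2) * (1 / (w - of_real \<rho> * cis t)) - w / of_real (\<rho>\<^sup>2))
      = w\<^sup>2 / of_real (\<rho>\<^sup>2) * (m t / (w - of_real \<rho> * cis t)) - w / of_real (\<rho>\<^sup>2) * m t"
      by (simp add: right_diff_distrib mult.commute)
    finally show ?thesis by simp
  qed
  ultimately have "((\<lambda>t. m t / (of_real (\<rho>\<^sup>2) / cnj w - of_real \<rho> * cis t)) has_integral - cnj (w\<^sup>2 / of_real (\<rho>\<^sup>2) * J)) {0..2*pi}"
    by (simp only:)
  then have "integral {0..2*pi} (\<lambda>t. m t / (of_real (\<rho>\<^sup>2) / cnj w - of_real \<rho> * cis t)) = - cnj (w\<^sup>2 / of_real (\<rho>\<^sup>2) * J)"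
    by (rule integral_unique)
  moreover have "layer_field zO \<rho> g (circle_reflection zO \<rho> X) = integral {0..2*pi} (\<lambda>t. m t / (of_real (\<rho>\<^sup>2) / cnj w - of_real \<rho> * cis t)) / of_real (2*pi)"
    by (simp add: layer_field_def R m_def pt_def)
  moreover have "layer_field zO \<rho> g X = J / of_real (2*pi)"
    by (simp add: layer_field_def J_def m_def pt_def w_def diff_diff_eq)
  ultimately show ?thesis by (simp add: w_def)
qed

lemma gradient_single_layer:
  assumes x: "x \<notin> sphere zO \<rho>"
  shows "gradient (single_layer zO \<rho> g) x = cnj (layer_field zO \<rho> g x)"
proof -
  have "open (- sphere zO \<rho>)" by (simp add: open_Compl)
  then obtain e where e: "e > 0" "ball x e \<subseteq> - sphere zO \<rho>"
    using x openE by blast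
  have ne: "y - pt (cis t) \<noteq> 0" if "y \<in> ball x e" for y t
    using e(2) that pt_sphere[of "cis t"] by auto
  have cp: "continuous_on S (\<lambda>t. pt (cis (f t)))" if "continuous_on S f" for f :: "'x::topological_space \<Rightarrow> real" and S
    unfolding pt_def by (intro continuous_intros that)
  let ?f = "\<lambda>y t. ln (norm (y - pt (cis t))) * g (pt (cis t)) * \<rho>"
  let ?D = "\<lambda>y t. cnj (of_real (g (pt (cis t)) * \<rho>) / (y - pt (cis t)))"
  have G: "GDERIV (\<lambda>y. integral {0..2*pi} (?f y)) x :> integral {0..2*pi} (?D x)"
  proof (rule GDERIV_integral[where U = "ball x e"])
    show "GDERIV (\<lambda>y. ?f y t) y :> ?D y t" if y: "y \<in> ball x e" for y t
    proof -
      let ?w = "y - pt (cis t)"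
      have w: "?w \<noteq> 0" by (rule ne[OF y])
      have "((\<lambda>y. y - pt (cis t)) has_derivative (\<lambda>h. h)) (at y)"
        by (auto intro!: derivative_eq_intros)
      from has_derivative_compose[OF this GDERIV_norm[OF w, unfolded gderiv_def]]
      have "GDERIV (\<lambda>y. norm (y - pt (cis t))) y :> sgn ?w"
        by (simp add: gderiv_def)
      moreover have "DERIV ln (norm ?w) :> 1 / norm ?w"
        using w by (auto intro!: derivative_eq_intros)
      ultimately have "GDERIV (\<lambda>y. ln (norm (y - pt (cis t)))) y :> (1 / norm ?w) *\<^sub>R sgn ?w"
        by (rule GDERIV_DERIV_compose)
      from GDERIV_mult[OF this GDERIV_const[of "g (pt (cis t)) * \<rho>"]]
      have "GDERIV (\<lambda>y. ln (norm (y - pt (cis t))) * (g (pt (cis t)) * \<rho>)) y :> (g (pt (cis t)) * \<rho>) *\<^sub>R ((1 / norm ?w) *\<^sub>R sgn ?w)"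
        by simp
      moreover have "(1 / norm ?w) *\<^sub>R sgn ?w = 1 / cnj ?w"
      proof -
        have "(1 / norm ?w) *\<^sub>R sgn ?w = ?w / of_real ((norm ?w)\<^sup>2)"
          by (simp add: sgn_eq scaleR_conv_of_real power2_eq_square)
        also have "\<dots> = ?w / (?w * cnj ?w)"
          by (simp only: complex_norm_square)
        also have "\<dots> = 1 / cnj ?w"
          using w by (simp del: complex_cnj_diff)
        finally show ?thesis .
      qed
      ultimately have "GDERIV (\<lambda>y. ?f y t) y :> (g (pt (cis t)) * \<rho>) *\<^sub>R (1 / cnj ?w)"
        by (simp only: mult.assoc)
      moreover have "(g (pt (cis t)) * \<rho>) *\<^sub>R (1 / cnj ?w) = ?D y t"
        by (simp add: scaleR_conv_of_real)
      ultimately show ?thesis by (simp only:)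
    qed
    show "continuous_on (ball x e \<times> {0..2*pi}) (\<lambda>(y, t). ?D y t)"
      unfolding split_def
      by (intro continuous_intros continuous_density_pt cp) (use ne in auto)
    show "?f y integrable_on {0..2*pi}" if "y \<in> ball x e" for y
      by (intro integrable_continuous_real continuous_intros continuous_density_pt cp) (use ne[OF that] in auto)
  qed (use e in auto)
  have "GDERIV (\<lambda>y. 1 / (2*pi) * integral {0..2*pi} (?f y)) x :> (1 / (2*pi)) *\<^sub>R integral {0..2*pi} (?D x)"
    using GDERIV_mult[OF GDERIV_const[of "1 / (2*pi)"] G] by simp
  moreover have "(\<lambda>y. 1 / (2*pi) * integral {0..2*pi} (?f y)) = single_layer zO \<rho> g"
    by (simp add: single_layer_def[abs_def] arc_integral_def pt_def)
  moreover have "(1 / (2*pi)) *\<^sub>R integral {0..2*pi} (?D x) = cnj (layer_field zO \<rho> g x)"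
    unfolding integral_cnj[symmetric]
    by (simp add: layer_field_def pt_def scaleR_conv_of_real)
  ultimately have "GDERIV (single_layer zO \<rho> g) x :> cnj (layer_field zO \<rho> g x)"
    by (simp only:)
  then show ?thesis by (rule gradient_eqI)
qed

end

section \<open>Hoelder norms on a circle\<close>

lemma sphere_rotation:
  fixes x y z :: complex
  assumes "s > 0" "x \<in> sphere z s" "y \<in> sphere z s"
  obtains \<theta> where "\<bar>\<theta>\<bar> \<le> pi" "y = z + (x - z) * cis \<theta>" "s * \<bar>\<theta>\<bar> \<le> 3 * dist x y"
proof -
  have n: "norm (x - z) = s" "norm (y - z) = s"
    using assms by (simp_all add: dist_norm norm_minus_commute)
  then have x0: "x - z \<noteq> 0" using assms(1) by auto
  define c where "c = (y - z) / (x - z)"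
  have c: "norm c = 1" using n assms(1) by (simp add: c_def norm_divide)
  define \<theta> where "\<theta> = Arg c"
  have th: "c = cis \<theta>" using c by (metis \<theta>_def cis_Arg norm_eq_zero sgn_div_norm zero_neq_one inverse_1 scaleR_one)
  have "\<bar>\<theta>\<bar> \<le> pi" using Arg_bounded[of c] by (simp add: \<theta>_def abs_le_iff)
  moreover have y: "y = z + (x - z) * cis \<theta>"
    using x0 by (simp add: th[symmetric] c_def)
  moreover have "s * \<bar>\<theta>\<bar> \<le> 3 * dist x y"
  proof -
    have "y - x = (x - z) * (cis \<theta> - 1)" using y by (simp add: algebra_simps)
    then have "dist x y = s * norm (cis \<theta> - 1)"
      using n by (simp add: dist_norm norm_minus_commute[of x y] norm_mult)
    moreover have "s * \<bar>\<theta>\<bar> \<le> s * (3 * norm (cis \<theta> - 1))"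
      using angle_le_chord[of \<theta>] \<open>\<bar>\<theta>\<bar> \<le> pi\<close> assms(1) by (intro mult_left_mono) auto
    ultimately show ?thesis by simp
  qed
  ultimately show ?thesis by (rule that)
qed

text \<open>For \<alpha> \<le> 1 the seminorm is a Hoelder constant of g itself. For larger \<alpha>
  the first derivative is bounded by the norm, and the mean value theorem along the arc gives
  exponent 1; the factor 3 compares arc and chord. The exponent is fixed before g, so later
  constants do not depend on g.\<close>

lemma holder_norm_controls:
  assumes rho: "\<rho> > 0" and alpha: "\<alpha> > 0"
  obtains \<beta> where "0 < \<beta>" "\<beta> \<le> 1"
    "\<And>g. holder_circle zO \<rho> \<alpha> g \<Longrightarrow> 0 \<le> holder_norm zO \<rho> \<alpha> g"
    "\<And>g x y. holder_circle zO \<rho> \<alpha> g \<Longrightarrow> x \<in> sphere zO \<rho> \<Longrightarrow> y \<in> sphere zO \<rho> \<Longrightarrow>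
       \<bar>g x - g y\<bar> \<le> 3 * holder_norm zO \<rho> \<alpha> g * dist x y powr \<beta>"
proof -
  let ?S = "sphere zO \<rho>"
  define m where "m = holder_order \<alpha>"
  define \<gamma> where "\<gamma> = holder_frac \<alpha>"
  have "\<lceil>\<alpha>\<rceil> \<ge> 1" using alpha by linarith
  then have "real m = real_of_int \<lceil>\<alpha>\<rceil> - 1"
    by (simp add: m_def holder_order_def)
  then have gam: "0 < \<gamma>" "\<gamma> \<le> 1"
    unfolding \<gamma>_def holder_frac_def m_def[symmetric] by linarith+
  \<comment> \<open>A point and its antipode witness that the suprema in the norm are taken over
    nonempty sets.\<close>
  define x0 where "x0 = zO + of_real \<rho>"
  have x0: "x0 \<in> ?S" "zO - of_real \<rho> \<in> ?S" "x0 \<noteq> zO - of_real \<rho>"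
    using rho by (auto simp: x0_def dist_norm complex_eq_iff)
  have rot: "zO + (x - zO) * cis a \<in> ?S" if "x \<in> ?S" for x a
    using that by (simp add: dist_norm norm_mult norm_minus_commute)
  have main: "0 \<le> holder_norm zO \<rho> \<alpha> g \<and> (\<forall>x\<in>?S. \<forall>y\<in>?S. \<bar>g x - g y\<bar> \<le> 3 * holder_norm zO \<rho> \<alpha> g * dist x y powr (if m = 0 then \<gamma> else 1))"
    if g: "holder_circle zO \<rho> \<alpha> g" for g
  proof -
    define D where "D j = (circle_deriv zO \<rho> ^^ j) g" for j
    have dif: "(\<lambda>t. D j (zO + (x - zO) * cis (t / \<rho>))) differentiable (at (0::real))" if "j < m" "x \<in> ?S" for j x
      using g that by (simp add: holder_circle_def m_def D_def)
    obtain C where C: "\<And>x y. x \<in> ?S \<Longrightarrow> y \<in> ?S \<Longrightarrow> \<bar>D m x - D m y\<bar> \<le> C * dist x y powr \<gamma>"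
      using g unfolding holder_circle_def m_def D_def \<gamma>_def by blast
    \<comment> \<open>Differentiability is postulated at parameter 0 for every base point; moving
      the base point along the circle yields it at every parameter.\<close>
    have D1: "((\<lambda>t. D j (zO + (x - zO) * cis (t / \<rho>))) has_field_derivative D (Suc j) (zO + (x - zO) * cis (s / \<rho>))) (at s)"
      if j: "j < m" "x \<in> ?S" for j x s
    proof -
      let ?y = "zO + (x - zO) * cis (s / \<rho>)"
      have "((\<lambda>t. D j (zO + (?y - zO) * cis (t / \<rho>))) has_field_derivative D (Suc j) ?y) (at 0)"
        using dif[OF j(1) rot[OF j(2)]] by (simp add: D_def circle_deriv_def DERIV_deriv_iff_real_differentiable)
      moreover have "(\<lambda>t. D j (zO + (?y - zO) * cis (t / \<rho>))) = (\<lambda>t. D j (zO + (x - zO) * cis ((t + s) / \<rho>)))"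
        by (simp add: cis_mult add_divide_distrib mult.assoc add.commute)
      ultimately have "((\<lambda>t. D j (zO + (x - zO) * cis ((t + s) / \<rho>))) has_field_derivative D (Suc j) ?y) (at 0)"
        by simp
      then show ?thesis
        using DERIV_shift[of "\<lambda>t. D j (zO + (x - zO) * cis (t / \<rho>))" _ 0 s] by simp
    qed
    \<comment> \<open>A supremum bounds its members only if the set is bounded above. The top
      derivative is bounded by its Hoelder condition, the lower ones because they are continuous
      along an arc of length 2 pi \<rho>, which covers the circle.\<close>
    have bdd: "\<exists>M. \<forall>x\<in>?S. \<bar>D j x\<bar> \<le> M" if "j \<le> m" for j
    proof (cases "j = m")
      case True
      show ?thesis
      proof (intro exI ballI)
        fix x assume x: "x \<in> ?S"
        have "dist x x0 \<le> 2 * \<rho>"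
          using dist_triangle[of x x0 zO] x x0(1) by (simp add: dist_commute)
        then have "dist x x0 powr \<gamma> \<le> (2 * \<rho>) powr \<gamma>"
          using gam by (intro powr_mono2) auto
        then have "C * dist x x0 powr \<gamma> \<le> \<bar>C\<bar> * (2 * \<rho>) powr \<gamma>"
          by (intro mult_mono) auto
        then show "\<bar>D j x\<bar> \<le> \<bar>D m x0\<bar> + \<bar>C\<bar> * (2 * \<rho>) powr \<gamma>"
          unfolding True using C[OF x x0(1)] by linarith
      qed
    next
      case False
      let ?h = "\<lambda>t. D j (zO + (x0 - zO) * cis (t / \<rho>))"
      have "continuous_on {-(pi * \<rho>)..pi * \<rho>} ?h"
        using D1[of j x0] x0 that False
        by (intro continuous_at_imp_continuous_on ballI) (auto intro!: DERIV_isCont)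
      then have "compact (?h ` {-(pi * \<rho>)..pi * \<rho>})"
        by (intro compact_continuous_image) auto
      then obtain M where M: "\<And>t. t \<in> {-(pi * \<rho>)..pi * \<rho>} \<Longrightarrow> \<bar>?h t\<bar> \<le> M"
        using compact_imp_bounded bounded_iff by (metis (no_types, lifting) image_eqI real_norm_def)
      show ?thesis
      proof (intro exI ballI)
        fix x assume x: "x \<in> ?S"
        obtain \<theta> where th: "\<bar>\<theta>\<bar> \<le> pi" "x = zO + (x0 - zO) * cis \<theta>"
          using sphere_rotation[OF rho x0(1) x] by blast
        have "\<bar>\<rho> * \<theta>\<bar> \<le> pi * \<rho>"
          using th(1) rho mult_left_mono[of "\<bar>\<theta>\<bar>" pi \<rho>] by (simp add: abs_mult mult.commute)
        then have "\<rho> * \<theta> \<in> {-(pi * \<rho>)..pi * \<rho>}"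
          unfolding atLeastAtMost_iff abs_le_iff by linarith
        from M[OF this] show "\<bar>D j x\<bar> \<le> M" using rho th(2) by simp
      qed
    qed
    define N where "N j = (SUP x\<in>?S. \<bar>D j x\<bar>)" for j
    have Nle: "\<bar>D j x\<bar> \<le> N j" if jm: "j \<le> m" and xS: "x \<in> ?S" for j x
      unfolding N_def
    proof (rule cSUP_upper[OF xS])
      obtain M where M: "\<And>x. x \<in> ?S \<Longrightarrow> \<bar>D j x\<bar> \<le> M" using bdd[OF jm] by blast
      then show "bdd_above ((\<lambda>x. \<bar>D j x\<bar>) ` ?S)"
        by (rule bdd_aboveI2)
    qed
    have N0: "0 \<le> N j" if "j \<le> m" for j
      using Nle[OF that x0(1)] by linarith
    define Q where "Q = {(x, y). x \<in> ?S \<and> y \<in> ?S \<and> x \<noteq> y}"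
    define R where "R = (SUP (x, y)\<in>Q. \<bar>D m x - D m y\<bar> / dist x y powr \<gamma>)"
    have Rle: "\<bar>D m x - D m y\<bar> / dist x y powr \<gamma> \<le> R" if "x \<in> ?S" "y \<in> ?S" "x \<noteq> y" for x y
    proof -
      have "bdd_above ((\<lambda>(x, y). \<bar>D m x - D m y\<bar> / dist x y powr \<gamma>) ` Q)"
      proof (rule bdd_aboveI2[where M = C])
        fix p assume p: "p \<in> Q"
        obtain x y where xy: "p = (x, y)" "x \<in> ?S" "y \<in> ?S" "x \<noteq> y"
          using p by (auto simp: Q_def)
        then show "(case p of (x, y) \<Rightarrow> \<bar>D m x - D m y\<bar> / dist x y powr \<gamma>) \<le> C"
          using C[OF xy(2,3)] by (simp add: pos_divide_le_eq)
      qed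
      moreover have "(x, y) \<in> Q" using that by (simp add: Q_def)
      ultimately have "(case (x, y) of (x, y) \<Rightarrow> \<bar>D m x - D m y\<bar> / dist x y powr \<gamma>) \<le> R"
        unfolding R_def by (rule cSUP_upper[rotated])
      then show ?thesis by simp
    qed
    have R0: "0 \<le> R"
      by (rule order_trans[OF _ Rle[OF x0]]) simp
    have norm: "holder_norm zO \<rho> \<alpha> g = (\<Sum>j\<le>m. N j) + R"
      by (simp add: holder_norm_def N_def R_def Q_def D_def m_def \<gamma>_def)
    have sum0: "0 \<le> (\<Sum>j\<le>m. N j)" using N0 by (intro sum_nonneg) auto
    have "0 \<le> holder_norm zO \<rho> \<alpha> g" using norm sum0 R0 by simp
    moreover have "\<bar>g x - g y\<bar> \<le> 3 * holder_norm zO \<rho> \<alpha> g * dist x y powr (if m = 0 then \<gamma> else 1)"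
      if x: "x \<in> ?S" and y: "y \<in> ?S" for x y
    proof (cases "x = y")
      case True
      then show ?thesis by simp
    next
      case False
      show ?thesis
      proof (cases "m = 0")
        case True
        have "\<bar>g x - g y\<bar> \<le> R * dist x y powr \<gamma>"
          using Rle[OF x y False] False True by (simp add: D_def pos_divide_le_eq)
        also have "\<dots> \<le> 3 * holder_norm zO \<rho> \<alpha> g * dist x y powr \<gamma>"
          using norm sum0 R0 by (intro mult_right_mono) auto
        finally show ?thesis using True by simp
      next
        case m: False
        obtain \<theta> where th: "y = zO + (x - zO) * cis \<theta>" "\<rho> * \<bar>\<theta>\<bar> \<le> 3 * dist x y"
          using sphere_rotation[OF rho x y] by blast
        let ?h = "\<lambda>t. D 0 (zO + (x - zO) * cis (t / \<rho>))"
        have "norm (?h (\<rho> * \<theta>) - ?h 0) \<le> N 1 * norm (\<rho> * \<theta> - 0)"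
        proof (rule field_differentiable_bound[where S = UNIV])
          show "(?h has_field_derivative D 1 (zO + (x - zO) * cis (t / \<rho>))) (at t within UNIV)" for t
            using D1[of 0 x t] m x by simp
          show "norm (D 1 (zO + (x - zO) * cis (t / \<rho>))) \<le> N 1" for t
            using Nle[OF _ rot[OF x], of 1] m by simp
        qed auto
        then have "\<bar>g x - g y\<bar> \<le> N 1 * (\<rho> * \<bar>\<theta>\<bar>)"
          using rho th(1) by (simp add: D_def abs_mult abs_minus_commute)
        also have "\<dots> \<le> N 1 * (3 * dist x y)"
          using th(2) N0[of 1] m by (intro mult_left_mono) auto
        also have "N 1 \<le> holder_norm zO \<rho> \<alpha> g"
          using member_le_sum[of 1 "{..m}" N] N0 m norm R0 by auto
        then have "N 1 * (3 * dist x y) \<le> holder_norm zO \<rho> \<alpha> g * (3 * dist x y)"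
          by (rule mult_right_mono) simp
        finally show ?thesis using m False by simp
      qed
    qed
    ultimately show ?thesis by blast
  qed
  show ?thesis
    by (rule that[of "if m = 0 then \<gamma> else 1"]) (use gam main in auto)
qed

subsection \<open>The Moebius map of two nested circles\<close>

text \<open>The unit vector e points from the center of \<Omega> to that of B. Positive d excludes
  concentric circles, for which the outer fixed point would be at infinity.\<close>

locale nested_disks =
  fixes zO e :: complex and \<rho> r d :: real
  assumes e: "norm e = 1" and r: "0 < r" and d: "0 < d" and dr: "d + r < \<rho>"
begin

definition zB :: complex where "zB = zO + of_real d * e"
definition gap :: real where "gap = \<rho> - d - r"
text \<open>The inversive distance of the two circles. With L its inverse hyperbolic cosine,
  \<open>mu\<close> is exp(-L), the ratio of radii of the concentric pair to which the circles are
  Moebius equivalent. The product of the two reflections is then a dilation by the square of this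
  ratio, whence \<open>lam\<close>.\<close>

definition cosh_len :: real where "cosh_len = (\<rho>\<^sup>2 + r\<^sup>2 - d\<^sup>2) / (2 * \<rho> * r)"
definition mu :: real where "mu = cosh_len - sqrt (cosh_len\<^sup>2 - 1)"
definition lam :: real where "lam = mu\<^sup>2"
definition p1 :: real where "p1 = \<rho> * (\<rho> - r / mu) / d"
definition p2 :: real where "p2 = \<rho> * (\<rho> - r * mu) / d"

text \<open>The fixed points of \<open>R\<^sub>B R\<^sub>\<Omega>\<close> are \<open>zO + p1 e\<close> and \<open>zO + p2 e\<close>, with multiplier \<open>lam\<close>; in the
  coordinate \<open>\<zeta> = (z - zO) / e\<close> the map \<open>moeb n\<close> is the \<open>n\<close>-th iterate.\<close>

definition den :: "nat \<Rightarrow> complex \<Rightarrow> complex" where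
  "den n z = of_real p2 * e - (z - zO) + of_real (lam ^ n) * (z - zO - of_real p1 * e)"

definition moeb :: "nat \<Rightarrow> complex \<Rightarrow> complex" where
  "moeb n z = zO + of_real p1 * e + of_real (lam ^ n * (p2 - p1)) * e * (z - zO - of_real p1 * e) / den n z"

definition moeb' :: "nat \<Rightarrow> complex \<Rightarrow> complex" where
  "moeb' n z = of_real (lam ^ n * (p2 - p1)\<^sup>2) * e\<^sup>2 / (den n z)\<^sup>2"

lemma rho: "\<rho> > 0" and e0: "e \<noteq> 0" and gap_pos: "gap > 0"
proof -
  show "\<rho> > 0" "gap > 0" using r d dr by (simp_all add: gap_def)
  show "e \<noteq> 0" using e by auto
qed

text \<open>This is how \<epsilon> enters: up to a factor between 1/2 and 1 the right side is the
  square of \<open>sqrt ((\<rho> - r) / (\<rho> * r)) * sqrt gap\<close>.\<close>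

lemma cosh_len_minus_one: "cosh_len - 1 = gap * (2 * (\<rho> - r) - gap) / (2 * \<rho> * r)"
proof -
  have "\<rho>\<^sup>2 + r\<^sup>2 - d\<^sup>2 = 2 * \<rho> * r + gap * (2 * (\<rho> - r) - gap)"
    unfolding gap_def by (simp add: power2_eq_square algebra_simps)
  then show ?thesis
    using rho r by (simp add: cosh_len_def add_divide_distrib)
qed

lemma cosh_len_gt: "cosh_len > 1"
proof -
  have "gap * (2 * (\<rho> - r) - gap) / (2 * \<rho> * r) > 0"
    using gap_pos rho r d dr by (intro divide_pos_pos mult_pos_pos) (auto simp: gap_def)
  then show ?thesis using cosh_len_minus_one by simp
qed

lemma mu: "0 < mu" "mu < 1" "mu + 1 / mu = 2 * cosh_len"
proof -
  let ?c = cosh_len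
  have c2: "?c\<^sup>2 > 1" using cosh_len_gt by (simp add: one_less_power)
  have s: "(sqrt (?c\<^sup>2 - 1))\<^sup>2 = ?c\<^sup>2 - 1" using c2 by simp
  have prod: "mu * (?c + sqrt (?c\<^sup>2 - 1)) = 1"
    unfolding mu_def using s by (simp add: algebra_simps power2_eq_square)
  have s0: "sqrt (?c\<^sup>2 - 1) > 0" using c2 by simp
  have pos: "?c + sqrt (?c\<^sup>2 - 1) > 1" using cosh_len_gt s0 by linarith
  have inv: "mu = 1 / (?c + sqrt (?c\<^sup>2 - 1))"
    using prod pos by (simp add: field_simps)
  show "0 < mu" "mu < 1" unfolding inv using pos by auto
  have "1 / mu = ?c + sqrt (?c\<^sup>2 - 1)" using pos by (simp add: inv)
  then show "mu + 1 / mu = 2 * ?c" by (simp add: mu_def)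
qed

lemma lam: "0 < lam" "lam < 1" "0 \<le> lam"
  using mu by (auto simp: lam_def power_less_one_iff)

lemma one_minus_mu: "(1 - mu)\<^sup>2 = 2 * mu * (cosh_len - 1)"
proof -
  have "mu * (mu + 1 / mu) = mu * (2 * cosh_len)" using mu(3) by simp
  then have "mu\<^sup>2 + 1 = 2 * mu * cosh_len"
    using mu(1) by (simp add: distrib_left power2_eq_square)
  then show ?thesis by (simp add: power2_eq_square algebra_simps)
qed

lemma r_mu: "r * (mu + 1 / mu) = (\<rho>\<^sup>2 + r\<^sup>2 - d\<^sup>2) / \<rho>"
proof -
  have "r * (2 * (X / (2 * \<rho> * r))) = X / \<rho>" for X :: real
    using rho r by simp
  then show ?thesis unfolding mu(3) cosh_len_def .
qed

lemma p_sum: "p1 + p2 = (\<rho>\<^sup>2 + d\<^sup>2 - r\<^sup>2) / d"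
proof -
  have "\<rho> * (\<rho> - r / mu) + \<rho> * (\<rho> - r * mu) = 2 * \<rho>\<^sup>2 - \<rho> * (r * (mu + 1 / mu))"
    by (simp add: algebra_simps power2_eq_square)
  also have "\<dots> = \<rho>\<^sup>2 + d\<^sup>2 - r\<^sup>2"
    unfolding r_mu using rho by simp
  finally show ?thesis
    by (simp add: p1_def p2_def add_divide_distrib[symmetric])
qed

lemma p_prod: "p1 * p2 = \<rho>\<^sup>2"
proof -
  define i where "i = 1 / mu"
  have i: "i * mu = 1" using mu by (simp add: i_def)
  have "(\<rho> - r * i) * (\<rho> - r * mu) = \<rho>\<^sup>2 - \<rho> * (r * (mu + i)) + r\<^sup>2 * (i * mu)"
    by (simp add: algebra_simps power2_eq_square)
  also have "\<dots> = d\<^sup>2"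
    unfolding i r_mu[folded i_def] using rho by simp
  finally have "(\<rho> - r / mu) * (\<rho> - r * mu) = d\<^sup>2"
    by (simp add: i_def)
  moreover have "p1 * p2 = \<rho>\<^sup>2 * ((\<rho> - r / mu) * (\<rho> - r * mu)) / d\<^sup>2"
    by (simp add: p1_def p2_def power2_eq_square)
  ultimately show ?thesis using d by simp
qed

lemma p2_gt: "\<rho> < p2"
proof -
  have "r * mu < r * 1" using r mu by (intro mult_strict_left_mono) auto
  then have "d < \<rho> - r * mu" using dr by linarith
  then have "\<rho> * d < \<rho> * (\<rho> - r * mu)" using rho by simp
  then show ?thesis using d by (simp add: p2_def pos_less_divide_eq)
qed

lemma p1_eq: "p1 = \<rho>\<^sup>2 / p2"
  using p_prod p2_gt rho by (simp add: eq_divide_imp)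

lemma p1_less: "0 < p1" "p1 < \<rho>"
proof -
  show "0 < p1" unfolding p1_eq using p2_gt rho by simp
  have "\<rho> * \<rho> < \<rho> * p2" using p2_gt rho by simp
  then show "p1 < \<rho>" unfolding p1_eq using p2_gt rho by (simp add: pos_divide_less_eq power2_eq_square)
qed

text \<open>Together with \<open>p_prod\<close> this says that P_1 and P_2 are reflections of each
  other in both circles, hence fixed by both products of the reflections.\<close>

lemma p_shift: "(p1 - d) * (p2 - d) = r\<^sup>2"
proof -
  have "(p1 - d) * (p2 - d) = p1 * p2 - d * (p1 + p2) + d\<^sup>2"
    by (simp add: algebra_simps power2_eq_square)
  then show ?thesis unfolding p_prod p_sum using d by simp
qed

lemma p1_in: "d < p1" "p1 < d + r"
proof -
  have p2d: "p2 - d > r" using p2_gt dr by linarith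
  have eq: "p1 - d = r\<^sup>2 / (p2 - d)" using p_shift p2d r by (simp add: eq_divide_imp)
  then show "d < p1" using p2d r by (metis diff_gt_0_iff_gt divide_pos_pos less_trans zero_less_power)
  have "r * r < r * (p2 - d)" using p2d r by simp
  then have "r\<^sup>2 / (p2 - d) < r" using p2d r by (simp add: pos_divide_less_eq power2_eq_square)
  then show "p1 < d + r" using eq by linarith
qed

text \<open>Since P_1 and P_2 are mutual reflections in \<partial>\<Omega>, the inner one is no
  farther from the circle than the outer one.\<close>

lemma p_diff: "0 < p2 - p1" "p2 - p1 \<le> 2 * (p2 - \<rho>)"
proof -
  show "0 < p2 - p1" using p1_less p2_gt by linarith
  have "\<rho> - p1 = \<rho> * (p2 - \<rho>) / p2"
    using p2_gt rho by (simp add: p1_eq field_simps power2_eq_square)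
  also have "\<dots> \<le> p2 - \<rho>"
    using p2_gt rho by (simp add: pos_divide_le_eq)
  finally show "p2 - p1 \<le> 2 * (p2 - \<rho>)" by simp
qed

text \<open>Up to the unit factor e, \<open>den n z\<close> is p2 minus a convex combination of the
  point z in the coordinate along e and of p1, and the real parts of both are at most
  \<rho>.\<close>

lemma den_lower:
  assumes "z \<in> cball zO \<rho>" shows "p2 - \<rho> \<le> norm (den n z)"
proof -
  define w where "w = (z - zO) * cnj e"
  have ee: "e * cnj e = 1" using complex_norm_square[of e] e by simp
  have "norm w \<le> \<rho>" using assms e by (simp add: w_def norm_mult dist_norm norm_minus_commute)
  then have rw: "Re w \<le> \<rho>" using complex_Re_le_cmod order_trans by blast
  have q: "0 \<le> lam ^ n" "lam ^ n \<le> 1" using lam by (auto simp: power_le_one)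
  have "den n z * cnj e = of_real p2 * (e * cnj e) - w + of_real (lam ^ n) * (w - of_real p1 * (e * cnj e))"
    by (simp add: den_def w_def algebra_simps)
  then have eq: "den n z * cnj e = of_real p2 - w + of_real (lam ^ n) * (w - of_real p1)"
    by (simp add: ee)
  have "Re (den n z * cnj e) = p2 - lam ^ n * p1 - (1 - lam ^ n) * Re w"
    unfolding eq by (simp add: algebra_simps)
  moreover have "(1 - lam ^ n) * Re w \<le> (1 - lam ^ n) * \<rho>"
    using q rw by (intro mult_left_mono) auto
  moreover have "lam ^ n * p1 \<le> lam ^ n * \<rho>" using q p1_less by (intro mult_left_mono) auto
  ultimately have "p2 - \<rho> \<le> Re (den n z * cnj e)" by (simp add: algebra_simps)
  also have "\<dots> \<le> norm (den n z * cnj e)" by (rule complex_Re_le_cmod)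
  also have "\<dots> = norm (den n z)" using e by (simp add: norm_mult)
  finally show ?thesis .
qed

lemma den_nonzero: "z \<in> cball zO \<rho> \<Longrightarrow> den n z \<noteq> 0"
  using den_lower[of z n] p2_gt by auto

text \<open>The numerator p2 - p1 is at most twice the lower bound p2 - \<rho> of the denominator,
  and the quotient is squared. Both differences may be arbitrarily small, but the constant 4 does
  not depend on them.\<close>

lemma moeb'_bound:
  assumes "z \<in> cball zO \<rho>" shows "norm (moeb' n z) \<le> 4 * lam ^ n"
proof -
  have a: "0 < p2 - \<rho>" using p2_gt by simp
  define L where "L = p2 - p1"
  have "norm (moeb' n z) = lam ^ n * (L / norm (den n z))\<^sup>2"
    unfolding moeb'_def L_def[symmetric]
    using e lam by (simp add: norm_divide norm_mult norm_power power_divide)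
  then have eq: "norm (moeb' n z) = lam ^ n * ((p2 - p1) / norm (den n z))\<^sup>2"
    unfolding L_def .
  have n0: "0 < norm (den n z)" using a den_lower[OF assms, of n] by linarith
  then have "(p2 - p1) / norm (den n z) \<le> 2"
    using p_diff(2) den_lower[OF assms, of n] by (simp add: pos_divide_le_eq)
  then have "((p2 - p1) / norm (den n z))\<^sup>2 \<le> 2\<^sup>2"
    using n0 p_diff by (intro power_mono) auto
  then have "lam ^ n * ((p2 - p1) / norm (den n z))\<^sup>2 \<le> lam ^ n * 4"
    using lam by (intro mult_left_mono) auto
  with eq show ?thesis by (simp add: mult.commute)
qed

lemma moeb_deriv:
  assumes "z \<in> cball zO \<rho>"
  shows "(moeb n has_field_derivative moeb' n z) (at z)"
proof -
  have D: "den n z \<noteq> 0" by (rule den_nonzero[OF assms])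
  have "(den n has_field_derivative of_real (lam ^ n) - 1) (at z)"
    unfolding den_def[abs_def] by (auto intro!: derivative_eq_intros)
  then have "(moeb n has_field_derivative
      (of_real (lam ^ n * (p2 - p1)) * e * den n z - of_real (lam ^ n * (p2 - p1)) * e * (z - zO - of_real p1 * e) * (of_real (lam ^ n) - 1)) / (den n z * den n z)) (at z)"
    unfolding moeb_def[abs_def] using D by (auto intro!: derivative_eq_intros)
  moreover have "of_real (lam ^ n * (p2 - p1)) * e * den n z - of_real (lam ^ n * (p2 - p1)) * e * (z - zO - of_real p1 * e) * (of_real (lam ^ n) - 1)
     = of_real (lam ^ n * (p2 - p1)\<^sup>2) * e\<^sup>2"
    by (simp add: den_def algebra_simps power2_eq_square)
  ultimately show ?thesis by (simp add: moeb'_def power2_eq_square)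
qed

lemma moeb_0: "moeb 0 z = z"
proof -
  have "den 0 z = of_real (p2 - p1) * e" by (simp add: den_def algebra_simps)
  then show ?thesis using e0 p_diff by (simp add: moeb_def)
qed

lemma moeb'_0: "moeb' 0 z = 1"
proof -
  have "den 0 z = of_real (p2 - p1) * e" by (simp add: den_def algebra_simps)
  then show ?thesis using e0 p_diff by (simp add: moeb'_def power_mult_distrib)
qed

lemma den_comp:
  assumes "z \<in> cball zO \<rho>"
  shows "den n (moeb 1 z) = of_real (p2 - p1) * e * den (Suc n) z / den 1 z"
proof -
  have D: "den 1 z \<noteq> 0" by (rule den_nonzero[OF assms])
  define u where "u = z - zO - of_real p1 * e"
  define L where "L = of_real (p2 - p1) * e"
  have pe: "of_real p2 * e = of_real p1 * e + L" by (simp add: L_def algebra_simps)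
  have d1: "den m z = L - u + of_real (lam ^ m) * u" for m
    by (simp add: den_def pe u_def)
  have m1: "moeb 1 z - zO - of_real p1 * e = of_real lam * L * u / den 1 z"
    by (simp add: moeb_def u_def L_def mult.assoc)
  have "den n (moeb 1 z) = L - (moeb 1 z - zO - of_real p1 * e) + of_real (lam ^ n) * (moeb 1 z - zO - of_real p1 * e)"
    by (simp add: den_def pe)
  also have "\<dots> = (L * den 1 z - of_real lam * L * u + of_real (lam ^ n) * (of_real lam * L * u)) / den 1 z"
    unfolding m1 using D by (simp add: diff_divide_distrib add_divide_distrib)
  also have "L * den 1 z - of_real lam * L * u + of_real (lam ^ n) * (of_real lam * L * u) = L * den (Suc n) z"
    by (simp add: d1 algebra_simps)
  finally show ?thesis by (simp add: L_def)
qed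

text \<open>In the coordinate (z - P_1)/(z - P_2) the map \<open>moeb n\<close> is multiplication by
  \<open>lam ^ n\<close>; the second equation is the chain rule. Here both are verified through the
  composition rule for \<open>den\<close>.\<close>

lemma moeb_Suc:
  assumes "z \<in> cball zO \<rho>"
  shows "moeb (Suc n) z = moeb n (moeb 1 z)" and "moeb' (Suc n) z = moeb' n (moeb 1 z) * moeb' 1 z"
proof -
  have D: "den 1 z \<noteq> 0" "den (Suc n) z \<noteq> 0" using den_nonzero[OF assms] by auto
  define L where "L = of_real (p2 - p1) * e"
  have L: "L \<noteq> 0" using e0 p_diff by (simp add: L_def)
  define u where "u = z - zO - of_real p1 * e"
  have m1: "moeb 1 z - zO - of_real p1 * e = of_real lam * L * u / den 1 z"
    by (simp add: moeb_def u_def L_def mult.assoc)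
  have m: "moeb m x = zO + of_real p1 * e + of_real (lam ^ m) * L * (x - zO - of_real p1 * e) / den m x" for m x
    by (simp add: moeb_def L_def)
  have m': "moeb' m x = of_real (lam ^ m) * L\<^sup>2 / (den m x)\<^sup>2" for m x
    by (simp add: moeb'_def L_def power_mult_distrib)
  have dc: "den n (moeb 1 z) = L * den (Suc n) z / den 1 z"
    using den_comp[OF assms] by (simp add: L_def)
  show "moeb (Suc n) z = moeb n (moeb 1 z)"
    unfolding m[of n "moeb 1 z"] m1 dc m[of "Suc n" z] u_def[symmetric] using D L by (simp add: field_simps)
  show "moeb' (Suc n) z = moeb' n (moeb 1 z) * moeb' 1 z"
    unfolding m' dc using D L by (simp add: field_simps power2_eq_square)
qed

lemma den_1: "den 1 z = of_real ((1 - lam) / d) * (of_real (\<rho>\<^sup>2) - of_real d * cnj e * (z - zO)) * e"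
proof -
  have ee: "cnj e * e = 1" using complex_norm_square[of e] e by (simp add: mult.commute)
  have l: "lam / mu = mu" using mu by (simp add: lam_def power2_eq_square)
  have "p2 - lam * p1 = \<rho> * (\<rho> * (1 - lam) - r * (mu - lam / mu)) / d"
    using d mu by (simp add: p1_def p2_def field_simps)
  then have P: "p2 - lam * p1 = (1 - lam) / d * \<rho>\<^sup>2"
    unfolding l by (simp add: power2_eq_square)
  have "den 1 z = of_real (p2 - lam * p1) * e - of_real (1 - lam) * (z - zO)"
    by (simp add: den_def algebra_simps)
  also have "\<dots> = of_real ((1 - lam) / d) * (of_real (\<rho>\<^sup>2) * e - of_real d * (z - zO))"
    unfolding P using d by (simp add: right_diff_distrib)
  also have "of_real (\<rho>\<^sup>2) * e - of_real d * (z - zO) = (of_real (\<rho>\<^sup>2) - of_real d * cnj e * (z - zO)) * e"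
  proof -
    have "of_real d * cnj e * (z - zO) * e = of_real d * (z - zO) * (cnj e * e)"
      by (simp only: mult_ac)
    then show ?thesis
      by (simp only: left_diff_distrib[of "of_real (\<rho>\<^sup>2)" _ e] ee mult_1_right)
  qed
  finally show ?thesis by (simp add: mult.assoc)
qed

lemma denB_nonzero:
  assumes "z \<in> cball zO \<rho>" shows "of_real (\<rho>\<^sup>2) - of_real d * cnj e * (z - zO) \<noteq> 0"
  using den_nonzero[OF assms, of 1] unfolding den_1 by auto

lemma p_diff_eq: "p2 - p1 = \<rho> * r * (1 - lam) / (mu * d)"
  using d mu by (simp add: p1_def p2_def lam_def field_simps power2_eq_square)

text \<open>The right sides are R_B R_\<Omega> and its derivative with the two conjugations
  cancelled. They make sense at the center of \<Omega> too, which is mapped to the center of B. The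
  proof matches coefficients by means of the relations between p1, p2 and the radii.\<close>

lemma moeb_1:
  assumes "z \<in> cball zO \<rho>"
  shows "moeb 1 z = zB + of_real (r\<^sup>2) * (z - zO) / (of_real (\<rho>\<^sup>2) - of_real d * cnj e * (z - zO))"
    and "moeb' 1 z = of_real (r\<^sup>2 * \<rho>\<^sup>2) / (of_real (\<rho>\<^sup>2) - of_real d * cnj e * (z - zO))\<^sup>2"
proof -
  define N where "N = of_real (\<rho>\<^sup>2) - of_real d * cnj e * (z - zO)"
  have N: "N \<noteq> 0" unfolding N_def by (rule denB_nonzero[OF assms])
  have ee: "cnj e * e = 1" using complex_norm_square[of e] e by (simp add: mult.commute)
  have dN: "den 1 z = of_real ((1 - lam) / d) * N * e" unfolding N_def by (rule den_1)
  have L: "p2 - p1 = (1 - lam) / d * (\<rho> * r / mu)" by (simp add: p_diff_eq field_simps)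
  define c where "c = (1 - lam) / d"
  have c: "c \<noteq> 0" using lam d by (simp add: c_def)
  have mn: "mu \<noteq> 0" using mu by simp
  have "of_real (lam * (p2 - p1)) * e * (z - zO - of_real p1 * e) / den 1 z
      = of_real (lam * (c * (\<rho> * r / mu))) * (z - zO - of_real p1 * e) / (of_real c * N)"
    unfolding dN L c_def[symmetric] using e0 by simp
  also have "\<dots> = of_real (mu * \<rho> * r) * (z - zO - of_real p1 * e) / N"
    using c mn by (simp add: lam_def power2_eq_square)
  finally have 1: "moeb 1 z = zO + of_real p1 * e + of_real (mu * \<rho> * r) * (z - zO - of_real p1 * e) / N"
    by (simp add: moeb_def)
  have dp: "\<rho>\<^sup>2 - d * p1 = \<rho> * r / mu"
    using d mn by (simp add: p1_def field_simps power2_eq_square)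
  have Q: "(p1 - d) * (\<rho>\<^sup>2 - d * p1) = r\<^sup>2 * p1"
  proof -
    have "(p1 - d) * (\<rho>\<^sup>2 - d * p1) = p1 * ((p1 - d) * (p2 - d))"
      unfolding p_prod[symmetric] by (simp add: algebra_simps)
    then show ?thesis unfolding p_shift by simp
  qed
  have A: "(p1 - d) * (\<rho> * r) = r\<^sup>2 * p1 * mu"
    using Q[unfolded dp] mn by (simp add: field_simps)
  have B: "(p1 - d) * \<rho>\<^sup>2 = mu * \<rho> * r * p1"
  proof -
    have "r * ((p1 - d) * \<rho>\<^sup>2) = r * (mu * \<rho> * r * p1)"
      using A rho by (simp add: power2_eq_square algebra_simps)
    then show ?thesis using r by simp
  qed
  have B': "mu * \<rho> * r - (p1 - d) * d = r\<^sup>2"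
  proof -
    have "p1 * (mu * \<rho> * r - (p1 - d) * d) = (p1 - d) * (\<rho>\<^sup>2 - d * p1)"
      using B by (simp add: algebra_simps)
    then have "p1 * (mu * \<rho> * r - (p1 - d) * d) = p1 * r\<^sup>2" unfolding Q by simp
    then show ?thesis using p1_less by simp
  qed
  \<comment> \<open>Both sides are affine in z - zO; the coefficients agree by B' and the constant
    terms by B.\<close>
  have key: "of_real (p1 - d) * e * N + of_real (mu * \<rho> * r) * (z - zO - of_real p1 * e) = of_real (r\<^sup>2) * (z - zO)"
  proof -
    have eN: "e * N = of_real (\<rho>\<^sup>2) * e - of_real d * (z - zO)"
    proof -
      have "e * (of_real d * cnj e * (z - zO)) = of_real d * (z - zO) * (cnj e * e)"
        by (simp only: mult_ac)
      then show ?thesis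
        unfolding N_def right_diff_distrib[of e] ee by (simp add: mult.commute)
    qed
    have "of_real (p1 - d) * (e * N) + of_real (mu * \<rho> * r) * (z - zO - of_real p1 * e)
       = of_real (mu * \<rho> * r - (p1 - d) * d) * (z - zO) + of_real ((p1 - d) * \<rho>\<^sup>2 - mu * \<rho> * r * p1) * e"
      unfolding eN by (simp add: algebra_simps)
    then show ?thesis unfolding B B' by (simp add: mult.assoc)
  qed
  define Y where "Y = of_real (mu * \<rho> * r) * (z - zO - of_real p1 * e)"
  have "moeb 1 z - zB = (of_real (p1 - d) * e * N + Y) / N"
  proof -
    have "(of_real (p1 - d) * e * N + Y) / N = of_real (p1 - d) * e + Y / N"
      using N by (simp add: add_divide_distrib del: of_real_diff)
    then show ?thesis
      unfolding 1 zB_def Y_def[symmetric] by (simp add: left_diff_distrib)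
  qed
  then show "moeb 1 z = zB + of_real (r\<^sup>2) * (z - zO) / N"
    unfolding Y_def key by (simp add: diff_eq_eq add.commute)
  have "moeb' 1 z = of_real (lam * (c * (\<rho> * r / mu))\<^sup>2) * e\<^sup>2 / (of_real c * N * e)\<^sup>2"
    unfolding moeb'_def dN L c_def[symmetric] by simp
  also have "\<dots> = of_real (lam * (\<rho> * r / mu)\<^sup>2) / N\<^sup>2"
    using c e0 by (simp add: power_mult_distrib power_divide)
  also have "lam * (\<rho> * r / mu)\<^sup>2 = r\<^sup>2 * \<rho>\<^sup>2"
    using mn by (simp add: lam_def power_divide power_mult_distrib)
  finally show "moeb' 1 z = of_real (r\<^sup>2 * \<rho>\<^sup>2) / N\<^sup>2" .
qed

lemma zB_dist: "dist zO zB = d"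
  using e d by (simp add: zB_def dist_norm norm_mult)

lemma moeb_1_in:
  assumes "z \<in> cball zO \<rho>" shows "moeb 1 z \<in> ball zB r"
proof -
  have w: "norm (z - zO) \<le> \<rho>" using assms by (simp add: dist_norm norm_minus_commute)
  define N where "N = of_real (\<rho>\<^sup>2) - of_real d * cnj e * (z - zO)"
  have "norm (of_real d * cnj e * (z - zO)) \<le> d * \<rho>"
    using w d e by (simp add: norm_mult)
  moreover have "norm (of_real (\<rho>\<^sup>2) :: complex) - norm (of_real d * cnj e * (z - zO)) \<le> norm N"
    unfolding N_def by (rule norm_triangle_ineq2)
  moreover have "norm (of_real (\<rho>\<^sup>2) :: complex) = \<rho> * \<rho>"
    using rho by (simp add: power2_eq_square norm_mult)
  moreover have "\<rho> * (\<rho> - d) = \<rho> * \<rho> - d * \<rho>" by (simp add: algebra_simps)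
  ultimately have N: "\<rho> * (\<rho> - d) \<le> norm N"
    by linarith
  have rd: "0 < \<rho> - d" "r < \<rho> - d" using dr r by auto
  have "norm (moeb 1 z - zB) = r\<^sup>2 * norm (z - zO) / norm N"
    unfolding moeb_1(1)[OF assms] N_def[symmetric] by (simp add: norm_divide norm_mult norm_power)
  also have "\<dots> \<le> r\<^sup>2 * \<rho> / (\<rho> * (\<rho> - d))"
    using w N rho rd by (intro frac_le mult_left_mono mult_pos_pos) auto
  also have "\<dots> = r * (r / (\<rho> - d))"
    using rho by (simp add: power2_eq_square)
  also have "\<dots> < r * 1"
    using r rd by (intro mult_strict_left_mono) auto
  finally show ?thesis by (simp add: dist_norm norm_minus_commute)
qed

lemma B_sub: "cball zB r \<subseteq> ball zO \<rho>"
  using dr d zB_dist by (simp add: cball_subset_ball_iff dist_commute)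

lemma moeb_1_in': "z \<in> cball zO \<rho> \<Longrightarrow> moeb 1 z \<in> ball zO \<rho>"
  using moeb_1_in B_sub ball_subset_cball by blast

lemma moeb_in: "z \<in> cball zO \<rho> \<Longrightarrow> moeb n z \<in> cball zO \<rho>"
proof (induction n arbitrary: z)
  case 0
  then show ?case by (simp add: moeb_0)
next
  case (Suc n)
  then show ?case using moeb_1_in' ball_subset_cball by (metis moeb_Suc(1) subsetD)
qed

lemma moeb_in_ball: "z \<in> ball zO \<rho> \<Longrightarrow> moeb n z \<in> ball zO \<rho>"
proof (induction n arbitrary: z)
  case 0
  then show ?case by (simp add: moeb_0)
next
  case (Suc n)
  then show ?case using moeb_1_in' ball_subset_cball by (metis moeb_Suc(1) subsetD)
qed

text \<open>Between P_1 and \<partial>\<Omega> the denominator is a real multiple D of e with 0 < D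
  \<le> p2 - p1. So the derivative is real and at least \<open>lam ^ n\<close>, and iteration moves
  the point along the axis towards P_1.\<close>

lemma moeb_axis:
  assumes x: "p1 \<le> x" "x \<le> \<rho>"
  obtains y where "p1 \<le> y" "y \<le> x" "moeb n (zO + of_real x * e) = zO + of_real y * e"
    "\<exists>q. moeb' n (zO + of_real x * e) = of_real q \<and> lam ^ n \<le> q"
proof -
  define D where "D = p2 - x + lam ^ n * (x - p1)"
  have q: "0 < lam ^ n" "lam ^ n \<le> 1" using lam by (auto simp: power_le_one)
  have px: "0 < p2 - x" using x p2_gt by linarith
  have D: "0 < D" using px q x by (simp add: D_def add_pos_nonneg)
  have DL: "D \<le> p2 - p1"
    using mult_right_mono[OF q(2), of "x - p1"] x by (simp add: D_def)
  have den: "den n (zO + of_real x * e) = of_real D * e"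
    by (simp add: den_def D_def algebra_simps)
  define y where "y = p1 + lam ^ n * (p2 - p1) * (x - p1) / D"
  have y1: "p1 \<le> y" using q p_diff x D by (simp add: y_def)
  have y2: "y \<le> x"
  proof -
    have "lam ^ n * (p2 - p1) \<le> D"
      using mult_right_mono[OF q(2), of "p2 - x"] px by (simp add: D_def algebra_simps)
    then have "lam ^ n * (p2 - p1) * (x - p1) \<le> D * (x - p1)"
      using x by (intro mult_right_mono) auto
    then have "lam ^ n * (p2 - p1) * (x - p1) / D \<le> x - p1"
      using D by (simp add: pos_divide_le_eq mult.commute)
    then show ?thesis by (simp add: y_def)
  qed
  have m: "moeb n (zO + of_real x * e) = zO + of_real y * e"
    unfolding moeb_def den y_def using e0 D by (simp add: field_simps)
  have m': "moeb' n (zO + of_real x * e) = of_real (lam ^ n * (p2 - p1)\<^sup>2 / D\<^sup>2)"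
    unfolding moeb'_def den using e0 by (simp add: power_mult_distrib)
  have "D\<^sup>2 \<le> (p2 - p1)\<^sup>2" using DL D by (intro power_mono) auto
  then have "lam ^ n * D\<^sup>2 \<le> lam ^ n * (p2 - p1)\<^sup>2" using q by (intro mult_left_mono) auto
  then have "lam ^ n \<le> lam ^ n * (p2 - p1)\<^sup>2 / D\<^sup>2" using D by (simp add: pos_le_divide_eq)
  with m' show ?thesis using that[OF y1 y2 m] by blast
qed

text \<open>With s the product of the square roots, (1 - mu)^2 is at most 2 s^2. Rounding sqrt 2 up
  to 2 and bounding 1 + mu by 2 produces the 4 in the denominators of (i).\<close>

lemma lam_upper: "1 - lam \<le> 4 * sqrt ((\<rho> - r) / (\<rho> * r)) * sqrt gap"
proof -
  define s where "s = sqrt ((\<rho> - r) / (\<rho> * r)) * sqrt gap"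
  have nn: "0 \<le> (\<rho> - r) / (\<rho> * r)" using rho r dr d by (intro divide_nonneg_nonneg) auto
  have s0: "0 \<le> s" using nn gap_pos by (simp add: s_def)
  have s2: "s\<^sup>2 = (\<rho> - r) / (\<rho> * r) * gap"
    using nn gap_pos by (simp add: s_def power_mult_distrib)
  have "cosh_len - 1 \<le> s\<^sup>2"
    unfolding cosh_len_minus_one s2 using rho r gap_pos by (simp add: field_simps)
  moreover have "mu * (cosh_len - 1) \<le> 1 * (cosh_len - 1)"
    using mu cosh_len_gt by (intro mult_right_mono) auto
  ultimately have "(1 - mu)\<^sup>2 \<le> 2 * s\<^sup>2"
    unfolding one_minus_mu by (simp add: mult.assoc)
  also have "\<dots> \<le> (2 * s)\<^sup>2" by (simp add: power_mult_distrib)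
  finally have "1 - mu \<le> 2 * s" by (rule power2_le_imp_le) (use s0 in simp)
  have "1 - lam = (1 - mu) * (1 + mu)" by (simp add: lam_def power2_eq_square algebra_simps)
  also have "\<dots> \<le> (1 - mu) * 2" using mu by (intro mult_left_mono) auto
  also have "\<dots> \<le> 4 * s" using \<open>1 - mu \<le> 2 * s\<close> by simp
  finally have "1 - lam \<le> 4 * s" .
  then show ?thesis by (simp add: s_def mult.assoc)
qed

text \<open>The gap is at most \<rho> - r, so \<open>cosh_len - 1\<close> is at least half the
  square of s, the product of the square roots. The relation \<open>one_minus_mu\<close> turns this
  into a bound for 1 - mu.\<close>

lemma lam_lower:
  assumes "sqrt ((\<rho> - r) / (\<rho> * r)) * sqrt gap \<le> 1"
  shows "sqrt ((\<rho> - r) / (\<rho> * r)) * sqrt gap / 2 \<le> 1 - lam"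
proof -
  define s where "s = sqrt ((\<rho> - r) / (\<rho> * r)) * sqrt gap"
  have nn: "0 \<le> (\<rho> - r) / (\<rho> * r)" using rho r dr d by (intro divide_nonneg_nonneg) auto
  have s0: "0 \<le> s" using nn gap_pos by (simp add: s_def)
  have s2: "s\<^sup>2 = (\<rho> - r) / (\<rho> * r) * gap"
    using nn gap_pos by (simp add: s_def power_mult_distrib)
  have gr: "gap \<le> \<rho> - r" using d by (simp add: gap_def)
  have "s\<^sup>2 / 2 = gap * (\<rho> - r) / (2 * \<rho> * r)" unfolding s2 using rho r by (simp add: field_simps)
  also have "\<dots> \<le> gap * (2 * (\<rho> - r) - gap) / (2 * \<rho> * r)"
    using rho r gap_pos gr by (intro divide_right_mono mult_left_mono) auto
  finally have c: "s\<^sup>2 / 2 \<le> cosh_len - 1" unfolding cosh_len_minus_one .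
  have "s / 2 \<le> 1 - mu"
  \<comment> \<open>For small mu the relation gives no lower bound, but then 1 - mu is at least 1/2,
    and s is at most 1.\<close>
  proof (cases "mu \<le> 1 / 2")
    case True
    then show ?thesis using assms by (simp add: s_def)
  next
    case False
    then have "1 * (s\<^sup>2 / 2) \<le> 2 * mu * (cosh_len - 1)"
      using c by (intro mult_mono) auto
    then have "(s / 2)\<^sup>2 \<le> (1 - mu)\<^sup>2"
      unfolding one_minus_mu by (simp add: power_divide) (use zero_le_power2[of s] in linarith)
    then show ?thesis using mu by (intro power2_le_imp_le[of "s/2" "1 - mu"]) auto
  qed
  also have "\<dots> \<le> 1 - lam" using mu by (simp add: lam_def power2_eq_square mult_left_le)
  finally show ?thesis by (simp add: s_def)
qed

end

subsection \<open>The solution as a series of images\<close>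

locale transmission = nested_disks zO e \<rho> r d + cd: circle_density zO \<rho> g C \<beta>
  for zO e :: complex and \<rho> r d :: real and g :: "complex \<Rightarrow> real" and C \<beta> :: real +
  fixes k :: real
  assumes k: "0 < k"
begin

definition contrast :: real where "contrast = (k - 1) / (k + 1)"

lemma contrast: "\<bar>contrast\<bar> < 1" "k * (1 - contrast) = 1 + contrast"
  using k by (auto simp: contrast_def abs_if field_simps)

definition f0 :: "complex \<Rightarrow> complex" where "f0 z = - 2 * cd.field z"

lemma f0_continuous: "continuous_on (cball zO \<rho>) f0"
  unfolding f0_def by (intro continuous_intros cd.field_continuous)

lemma f0_holomorphic: "f0 holomorphic_on ball zO \<rho>"
proof -
  have "(\<lambda>z. - 2 * layer_field zO \<rho> g z) holomorphic_on ball zO \<rho>"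
    by (intro holomorphic_intros holomorphic_on_subset[OF cd.layer_field_holomorphic]) auto
  then show ?thesis
    by (rule holomorphic_transform) (simp add: f0_def cd.field_eq_layer_field)
qed

definition bnd :: real where
  "bnd = 2 * (C * (6 * \<rho> powr \<beta> * integral {0..2*pi} cd.major / (2 * pi)))"

lemma f0_bound: "z \<in> cball zO \<rho> \<Longrightarrow> norm (f0 z) \<le> bnd"
  using cd.field_bound[of z] by (simp add: f0_def bnd_def norm_mult)

lemma bnd_nonneg: "0 \<le> bnd"
proof -
  have "zO \<in> cball zO \<rho>" using rho by simp
  from f0_bound[OF this] show ?thesis by (rule order_trans[OF norm_ge_zero])
qed

definition summand :: "nat \<Rightarrow> complex \<Rightarrow> complex" where
  "summand n z = of_real ((- contrast) ^ n) * (moeb' n z * f0 (moeb n z))"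

definition hd' :: "complex \<Rightarrow> complex" where "hd' z = (\<Sum>n. summand n z)"

lemma summand_bound:
  assumes "z \<in> cball zO \<rho>" shows "norm (summand n z) \<le> 4 * bnd * (\<bar>contrast\<bar> * lam) ^ n"
proof -
  have "norm (summand n z) = \<bar>contrast\<bar> ^ n * (norm (moeb' n z) * norm (f0 (moeb n z)))"
    by (simp add: summand_def norm_mult norm_power power_abs)
  also have "\<dots> \<le> \<bar>contrast\<bar> ^ n * ((4 * lam ^ n) * bnd)"
    using moeb'_bound[OF assms, of n] f0_bound[OF moeb_in[OF assms, of n]] lam
    by (intro mult_left_mono mult_mono) auto
  finally show ?thesis by (simp add: power_mult_distrib mult_ac)
qed

lemma ratio: "0 \<le> \<bar>contrast\<bar> * lam" "\<bar>contrast\<bar> * lam < 1"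
proof -
  show "0 \<le> \<bar>contrast\<bar> * lam" using lam by simp
  have "\<bar>contrast\<bar> * lam \<le> 1 * lam" using contrast(1) lam by (intro mult_right_mono) auto
  then show "\<bar>contrast\<bar> * lam < 1" using lam by linarith
qed

lemma summable_bound: "summable (\<lambda>n. 4 * bnd * (\<bar>contrast\<bar> * lam) ^ n)"
  using ratio by (intro summable_mult summable_geometric) simp

lemma summand_summable: "z \<in> cball zO \<rho> \<Longrightarrow> summable (\<lambda>n. summand n z)"
  by (rule summable_comparison_test'[OF summable_bound, of 0]) (simp add: summand_bound del: mem_cball)

lemma hd'_bound:
  assumes "z \<in> cball zO \<rho>" shows "norm (hd' z) \<le> 4 * bnd / (1 - \<bar>contrast\<bar> * lam)"
proof -
  have s: "summable (\<lambda>n. norm (summand n z))"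
    by (rule summable_comparison_test'[OF summable_bound, of 0]) (simp add: summand_bound[OF assms])
  have "norm (hd' z) \<le> (\<Sum>n. norm (summand n z))"
    unfolding hd'_def by (rule summable_norm[OF s])
  also have "\<dots> \<le> (\<Sum>n. 4 * bnd * (\<bar>contrast\<bar> * lam) ^ n)"
    by (intro suminf_le summand_bound assms s summable_bound)
  also have "\<dots> = 4 * bnd * (1 / (1 - \<bar>contrast\<bar> * lam))"
    using ratio by (subst suminf_mult) (auto simp: suminf_geometric intro: summable_geometric)
  finally show ?thesis by simp
qed

lemma hd'_uniform: "uniform_limit (cball zO \<rho>) (\<lambda>n z. \<Sum>i<n. summand i z) hd' sequentially"
  unfolding hd'_def[abs_def] by (rule Weierstrass_m_test[OF summand_bound summable_bound])

lemma moeb_continuous: "continuous_on (cball zO \<rho>) (moeb n)"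
  using moeb_deriv by (intro continuous_at_imp_continuous_on ballI DERIV_isCont) blast

lemma moeb'_continuous: "continuous_on (cball zO \<rho>) (moeb' n)"
  unfolding moeb'_def[abs_def]
proof (intro continuous_intros)
  show "continuous_on (cball zO \<rho>) (den n)"
    unfolding den_def[abs_def] by (intro continuous_intros)
qed (simp add: den_nonzero del: mem_cball)

lemma moeb'_holomorphic: "moeb' n holomorphic_on ball zO \<rho>"
  unfolding moeb'_def[abs_def]
proof (intro holomorphic_intros)
  show "den n holomorphic_on ball zO \<rho>"
    unfolding den_def[abs_def] by (intro holomorphic_intros)
qed (simp add: den_nonzero less_imp_le)

lemma moeb_holomorphic: "moeb n holomorphic_on ball zO \<rho>"
proof (rule holomorphic_onI)
  fix x assume "x \<in> ball zO \<rho>"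
  then have "(moeb n has_field_derivative moeb' n x) (at x)" by (intro moeb_deriv) auto
  then show "moeb n field_differentiable at x within ball zO \<rho>"
    using field_differentiable_at_within field_differentiable_def by blast
qed

lemma summand_continuous: "continuous_on (cball zO \<rho>) (summand n)"
  unfolding summand_def[abs_def]
proof (intro continuous_intros moeb'_continuous)
  show "continuous_on (cball zO \<rho>) (\<lambda>z. f0 (moeb n z))"
    by (rule continuous_on_compose2[OF f0_continuous moeb_continuous]) (use moeb_in in blast)
qed

lemma summand_holomorphic: "summand n holomorphic_on ball zO \<rho>"
  unfolding summand_def[abs_def]
proof (intro holomorphic_intros moeb'_holomorphic)
  have "(f0 \<circ> moeb n) holomorphic_on ball zO \<rho>"
    by (rule holomorphic_on_compose_gen[OF moeb_holomorphic f0_holomorphic]) (use moeb_in_ball in blast)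
  then show "(\<lambda>z. f0 (moeb n z)) holomorphic_on ball zO \<rho>" by (simp add: comp_def)
qed

lemma hd'_continuous: "continuous_on (cball zO \<rho>) hd'"
  by (rule uniform_limit_theorem[OF _ hd'_uniform])
     (auto intro!: always_eventually continuous_on_sum summand_continuous)

lemma hd'_holomorphic: "hd' holomorphic_on ball zO \<rho>"
proof (rule holomorphic_uniform_sequence[OF open_ball])
  show "(\<lambda>z. \<Sum>i<n. summand i z) holomorphic_on ball zO \<rho>" for n
    by (intro holomorphic_on_sum summand_holomorphic)
  fix x assume "x \<in> ball zO \<rho>"
  then obtain s where s: "s > 0" "cball x s \<subseteq> ball zO \<rho>"
    using open_contains_cball[of "ball zO \<rho>"] open_ball by blast
  then have "cball x s \<subseteq> cball zO \<rho>" using ball_subset_cball by blast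
  then have "uniform_limit (cball x s) (\<lambda>n z. \<Sum>i<n. summand i z) hd' sequentially"
    by (rule uniform_limit_on_subset[OF hd'_uniform])
  then show "\<exists>s>0. cball x s \<subseteq> ball zO \<rho> \<and> uniform_limit (cball x s) (\<lambda>n z. \<Sum>i<n. summand i z) hd' sequentially"
    using s by blast
qed

text \<open>Splitting off the zeroth term and applying the chain rule to the others gives the
  functional equation h = f - \<sigma> M' (h o M). The subtracted term is the one that the
  reflection in \<partial>B has to compensate on \<partial>\<Omega>.\<close>

lemma hd'_fixed:
  assumes z: "z \<in> cball zO \<rho>"
  shows "hd' z = f0 z - of_real contrast * (moeb' 1 z * hd' (moeb 1 z))"
proof -
  have m: "moeb 1 z \<in> cball zO \<rho>" by (rule moeb_in[OF z])
  have "hd' z = summand 0 z + (\<Sum>n. summand (Suc n) z)"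
    unfolding hd'_def using suminf_split_head[OF summand_summable[OF z]] by simp
  also have "summand (Suc n) z = of_real (- contrast) * moeb' 1 z * summand n (moeb 1 z)" for n
    unfolding summand_def moeb_Suc[OF z] by (simp add: mult_ac)
  then have "(\<Sum>n. summand (Suc n) z) = of_real (- contrast) * moeb' 1 z * hd' (moeb 1 z)"
    unfolding hd'_def using suminf_mult[OF summand_summable[OF m], of "of_real (- contrast) * moeb' 1 z"]
    by (simp only:)
  also have "summand 0 z = f0 z"
    by (simp add: summand_def moeb_0 moeb'_0)
  finally show ?thesis by simp
qed

section \<open>The field reflected in the inner circle, and the boundary conditions\<close>

definition RB :: "complex \<Rightarrow> complex" where "RB z = zB + of_real (r\<^sup>2) / cnj (z - zB)"

text \<open>If H is a primitive of \<open>hd'\<close>, this is minus the complex derivative of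
  \<open>cnj (H (RB z))\<close>, a function holomorphic outside B because two conjugations
  compose.\<close>

definition rd' :: "complex \<Rightarrow> complex" where
  "rd' z = cnj (hd' (RB z)) * of_real (r\<^sup>2) / (z - zB)\<^sup>2"

definition q1 :: "complex \<Rightarrow> complex" where "q1 z = of_real (1 - contrast) * hd' z"
definition q2 :: "complex \<Rightarrow> complex" where "q2 z = hd' z + of_real contrast * rd' z"

lemma RB_in:
  assumes "z \<notin> ball zB r" shows "RB z \<in> cball zB r"
proof -
  have n: "r \<le> norm (z - zB)" using assms by (simp add: dist_norm norm_minus_commute)
  have "norm (RB z - zB) = r\<^sup>2 / norm (z - zB)"
    unfolding RB_def using r by (simp add: norm_divide norm_power flip: complex_cnj_diff)
  also have "\<dots> \<le> r\<^sup>2 / r" using n r by (intro divide_left_mono mult_pos_pos) auto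
  also have "\<dots> = r" using r by (simp add: power2_eq_square)
  finally show ?thesis by (simp add: dist_norm norm_minus_commute)
qed

lemma RB_in_cball: "z \<notin> ball zB r \<Longrightarrow> RB z \<in> ball zO \<rho>" "z \<notin> ball zB r \<Longrightarrow> RB z \<in> cball zO \<rho>"
  using RB_in B_sub ball_subset_cball by blast+

lemma RB_sphere:
  assumes "z \<in> sphere zB r" shows "RB z = z"
proof -
  have n: "norm (z - zB) = r" using assms by (simp add: dist_norm norm_minus_commute)
  then have z: "cnj (z - zB) \<noteq> 0" using r by auto
  have "of_real (r\<^sup>2) = (z - zB) * cnj (z - zB)"
    using complex_norm_square[of "z - zB"] n by simp
  then have "of_real (r\<^sup>2) / cnj (z - zB) = z - zB"
    using z by (simp del: complex_cnj_diff)
  then show ?thesis by (simp add: RB_def del: complex_cnj_diff)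
qed

lemma RB_continuous: "continuous_on (- ball zB r) RB"
  unfolding RB_def[abs_def] using r by (intro continuous_intros) (auto simp: dist_norm)

lemma rd'_continuous: "continuous_on (cball zO \<rho> - ball zB r) rd'"
  unfolding rd'_def[abs_def]
proof (intro continuous_intros)
  show "continuous_on (cball zO \<rho> - ball zB r) (\<lambda>z. hd' (RB z))"
    by (rule continuous_on_compose2[OF hd'_continuous])
       (use RB_in_cball in \<open>auto intro: continuous_on_subset[OF RB_continuous]\<close>)
qed (use r in \<open>auto simp: dist_norm\<close>)

lemma holomorphic_cnj_RB:
  assumes h: "\<And>w. w \<in> ball zO \<rho> \<Longrightarrow> (h has_field_derivative h' w) (at w)" and z: "z \<notin> ball zB r"
  shows "((\<lambda>z. cnj (h (RB z))) has_field_derivative - (cnj (h' (RB z)) * of_real (r\<^sup>2) / (z - zB)\<^sup>2)) (at z)"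
proof -
  have z0: "z - zB \<noteq> 0" using z r by auto
  define W where "W z = cnj zB + of_real (r\<^sup>2) / (z - zB)" for z
  have RW: "RB z = cnj (W z)" for z by (simp add: RB_def W_def)
  have "(h has_field_derivative h' (RB z)) (at (cnj (W z)))"
    unfolding RW[symmetric] by (rule h) (rule RB_in_cball(1)[OF z])
  from has_field_derivative_cnj_cnj[OF this]
  have 1: "(cnj \<circ> h \<circ> cnj has_field_derivative cnj (h' (RB z))) (at (W z))" .
  have "(W has_field_derivative - (of_real (r\<^sup>2) / (z - zB)\<^sup>2)) (at z)"
    unfolding W_def[abs_def] using z0 by (auto intro!: derivative_eq_intros simp: power2_eq_square)
  from DERIV_chain[OF 1 this]
  show ?thesis by (simp add: comp_def RW[symmetric])
qed

lemma rd'_holomorphic: "rd' holomorphic_on ball zO \<rho> - cball zB r"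
proof -
  have "(\<lambda>z. cnj (hd' (RB z))) holomorphic_on ball zO \<rho> - cball zB r"
  proof (rule holomorphic_onI)
    fix x assume x: "x \<in> ball zO \<rho> - cball zB r"
    have "(hd' has_field_derivative deriv hd' w) (at w)" if "w \<in> ball zO \<rho>" for w
      using holomorphic_derivI[OF hd'_holomorphic open_ball that] .
    moreover have "x \<notin> ball zB r" using x by simp
    ultimately have "(\<lambda>z. cnj (hd' (RB z))) field_differentiable at x"
      unfolding field_differentiable_def by (intro exI) (rule holomorphic_cnj_RB)
    then show "(\<lambda>z. cnj (hd' (RB z))) field_differentiable at x within ball zO \<rho> - cball zB r"
      by (rule field_differentiable_at_within)
  qed
  moreover have "(x - zB)\<^sup>2 \<noteq> 0" if "x \<in> ball zO \<rho> - cball zB r" for x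
    using that r by auto
  ultimately show ?thesis
    unfolding rd'_def[abs_def] by (intro holomorphic_intros)
qed

text \<open>On \<open>\<partial>\<Omega>\<close> the reflection in \<open>\<partial>\<Omega>\<close> is the identity, so that there \<open>R\<^sub>B\<close> agrees with the Moebius map.\<close>

lemma boundary_reflection:
  assumes x: "x \<in> sphere zO \<rho>"
  shows "(x - zO) * (moeb' 1 x * hd' (moeb 1 x)) = cnj ((x - zO) * rd' x)"
proof -
  have xc: "x \<in> cball zO \<rho>" using x by auto
  have xB: "x \<notin> ball zB r"
  proof
    assume "x \<in> ball zB r"
    then have "x \<in> ball zO \<rho>" using B_sub ball_subset_cball by blast
    then show False using x by simp
  qed
  define w where "w = x - zO"
  have nw: "norm w = \<rho>" using x by (simp add: w_def dist_norm norm_minus_commute)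
  define b where "b = x - zB"
  have b0: "b \<noteq> 0" using xB r by (auto simp: b_def)
  have ww: "w * cnj w = of_real (\<rho>\<^sup>2)" using complex_norm_square[of w] nw by simp
  have w0: "w \<noteq> 0" using nw rho by auto
  have bw: "b = w - of_real d * e" by (simp add: b_def w_def zB_def)
  have N: "of_real (\<rho>\<^sup>2) - of_real d * cnj e * w = w * cnj b"
    unfolding ww[symmetric] bw by (simp add: algebra_simps)
  have m1: "moeb 1 x = RB x"
    unfolding moeb_1(1)[OF xc] w_def[symmetric] N RB_def b_def[symmetric] using w0 by simp
  have m2: "w * moeb' 1 x = cnj (w * of_real (r\<^sup>2) / b\<^sup>2)"
  proof -
    have "w * moeb' 1 x = w * (of_real (r\<^sup>2) * (w * cnj w)) / (w * cnj b)\<^sup>2"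
      unfolding moeb_1(2)[OF xc] w_def[symmetric] N ww by simp
    also have "\<dots> = of_real (r\<^sup>2) * cnj w / (cnj b)\<^sup>2"
      using w0 b0 by (simp add: power2_eq_square)
    finally show ?thesis by (simp add: mult.commute)
  qed
  show ?thesis
    unfolding w_def[symmetric] mult.assoc[symmetric] m2 m1 rd'_def b_def[symmetric] by simp
qed

text \<open>On \<partial>\<Omega> the image term of h and the reflected field are conjugate after
  multiplication by x - zO, so their contributions to the flux cancel and the flux of f
  remains.\<close>

lemma boundary_flux:
  assumes x: "x \<in> sphere zO \<rho>"
  shows "Re ((x - zO) * q2 x) = \<rho> * g x"
proof -
  have xc: "x \<in> cball zO \<rho>" using x by auto
  define w where "w = x - zO"
  have "Re (w * f0 x) = \<rho> * g x"
  proof -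
    have "Re (w * f0 x) = - 2 * Re (w * cd.field x)" by (simp add: f0_def)
    then show ?thesis using cd.field_normal[OF x] by (simp add: w_def)
  qed
  moreover have "Re (w * (moeb' 1 x * hd' (moeb 1 x))) = Re (w * rd' x)"
    using boundary_reflection[OF x] unfolding w_def[symmetric] by (simp only: cnj.sel)
  moreover have s: "Re (of_real a * w) = a * Re w" for a w by simp
  have "w * q2 x = w * f0 x - of_real contrast * (w * (moeb' 1 x * hd' (moeb 1 x))) + of_real contrast * (w * rd' x)"
    unfolding q2_def hd'_fixed[OF xc] by (simp add: algebra_simps)
  then have "Re (w * q2 x) = Re (w * f0 x) - contrast * Re (w * (moeb' 1 x * hd' (moeb 1 x))) + contrast * Re (w * rd' x)"
    by (simp only: plus_complex.sel minus_complex.sel s)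
  ultimately show ?thesis by (simp add: w_def)
qed

text \<open>On \<partial>B reflection changes nothing about the point, so \<open>rd'\<close> has the
  same normal component as \<open>hd'\<close> and the opposite tangential one.\<close>

lemma transmission_reflection:
  assumes x: "x \<in> sphere zB r"
  shows "(x - zB) * rd' x = cnj ((x - zB) * hd' x)"
proof -
  define b where "b = x - zB"
  have nb: "norm b = r" using x by (simp add: b_def dist_norm norm_minus_commute)
  then have b0: "b \<noteq> 0" using r by auto
  have bb: "b * cnj b = of_real (r\<^sup>2)" using complex_norm_square[of b] nb by simp
  show ?thesis
    unfolding b_def[symmetric] rd'_def RB_sphere[OF x] b_def[symmetric] bb[symmetric] using b0
    by (simp add: power2_eq_square)
qed

text \<open>The normal component of h is multiplied by 1 - \<sigma> inside and by 1 + \<sigma>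
  outside, and k (1 - \<sigma>) = 1 + \<sigma>. This equation is what singles out \<sigma>.\<close>

lemma transmission_flux:
  assumes x: "x \<in> sphere zB r"
  shows "k * Re ((x - zB) * q1 x) = Re ((x - zB) * q2 x)"
proof -
  define b where "b = x - zB"
  have r1: "Re (b * rd' x) = Re (b * hd' x)"
    using transmission_reflection[OF x] unfolding b_def[symmetric] by (simp only: cnj.sel)
  have s: "Re (of_real a * w) = a * Re w" for a w by simp
  have "k * Re (b * q1 x) = k * (1 - contrast) * Re (b * hd' x)"
    using s[of "1 - contrast" "b * hd' x"] unfolding q1_def mult.left_commute[of b] by (simp only: mult.assoc)
  also have "\<dots> = (1 + contrast) * Re (b * hd' x)" unfolding contrast(2) ..
  also have "\<dots> = Re (b * hd' x) + contrast * Re (b * rd' x)" unfolding r1 by (simp only: distrib_right mult_1_left)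
  also have "\<dots> = Re (b * q2 x)"
    using s[of contrast "b * rd' x"] unfolding q2_def distrib_left mult.left_commute[of b "of_real contrast"]
    by (simp only: plus_complex.sel)
  finally show ?thesis by (simp only: b_def)
qed

text \<open>A primitive of \<open>hd'\<close> on the convex disk yields a potential with the
  explicit field as its gradient. Its regularity and boundary conditions make uniqueness applicable,
  so that u is this potential up to a constant.\<close>

lemma solution_gradient:
  assumes u: "conductivity_solution zO \<rho> zB r k g u"
  shows "\<And>x. x \<in> ball zB r \<Longrightarrow> gradient u x = cnj (q1 x)"
    and "\<And>x. x \<in> ball zO \<rho> - cball zB r \<Longrightarrow> gradient u x = cnj (q2 x)"
proof -
  have fd: "hd' field_differentiable at x" if "x \<in> interior (cball zO \<rho>) - {}" for x
    using that hd'_holomorphic by (auto intro: holomorphic_on_imp_differentiable_at)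
  obtain h where h: "\<And>x. x \<in> cball zO \<rho> \<Longrightarrow> (h has_field_derivative hd' x) (at x within cball zO \<rho>)"
    using holomorphic_convex_primitive[OF convex_cball finite.emptyI hd'_continuous fd] by blast
  have hat: "(h has_field_derivative hd' x) (at x)" if "x \<in> ball zO \<rho>" for x
  proof -
    have "x \<in> cball zO \<rho>" using that by auto
    then have "(h has_field_derivative hd' x) (at x within ball zO \<rho>)"
      by (rule DERIV_subset[OF h]) auto
    then show ?thesis using that by (simp add: at_within_open[of x "ball zO \<rho>"])
  qed
  have hc: "continuous_on (cball zO \<rho>) h"
    using h by (meson DERIV_continuous continuous_on_eq_continuous_within)
  \<comment> \<open>The reflected part is subtracted because its derivative carries a minus sign. On
    \<partial>B, where \<open>RB\<close> is the identity, both branches are 1 - \<sigma> times the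
    real part of h.\<close>
  define v where "v z = (if z \<in> cball zB r then (1 - contrast) * Re (h z) else Re (h z) - contrast * Re (cnj (h (RB z))))" for z
  have vc: "continuous_on (cball zO \<rho>) v"
  proof -
    have U: "cball zO \<rho> = cball zB r \<union> (cball zO \<rho> - ball zB r)"
      using B_sub ball_subset_cball[of zO \<rho>] ball_subset_cball[of zB r] by auto
    have "continuous_on (cball zB r \<union> (cball zO \<rho> - ball zB r))
      (\<lambda>z. if z \<in> cball zB r then (1 - contrast) * Re (h z) else Re (h z) - contrast * Re (cnj (h (RB z))))"
    proof (rule continuous_on_cases)
      show "closed (cball zB r)" "closed (cball zO \<rho> - ball zB r)" by (auto intro: closed_Diff)
      show "continuous_on (cball zB r) (\<lambda>z. (1 - contrast) * Re (h z))"
        by (intro continuous_intros continuous_on_subset[OF hc]) (use U in blast)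
      have "continuous_on (cball zO \<rho> - ball zB r) (\<lambda>z. h (RB z))"
        by (rule continuous_on_compose2[OF hc])
           (use RB_in_cball in \<open>auto intro: continuous_on_subset[OF RB_continuous]\<close>)
      then show "continuous_on (cball zO \<rho> - ball zB r) (\<lambda>z. Re (h z) - contrast * Re (cnj (h (RB z))))"
        by (intro continuous_intros continuous_on_subset[OF hc]) auto
      show "\<forall>x. x \<in> cball zB r \<and> x \<notin> cball zB r \<or> x \<in> cball zO \<rho> - ball zB r \<and> x \<in> cball zB r \<longrightarrow>
        (1 - contrast) * Re (h x) = Re (h x) - contrast * Re (cnj (h (RB x)))"
      proof (intro allI impI)
        fix x assume "x \<in> cball zB r \<and> x \<notin> cball zB r \<or> x \<in> cball zO \<rho> - ball zB r \<and> x \<in> cball zB r"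
        then have "x \<in> sphere zB r" by auto
        then show "(1 - contrast) * Re (h x) = Re (h x) - contrast * Re (cnj (h (RB x)))"
          by (simp add: RB_sphere left_diff_distrib)
      qed
    qed
    then show ?thesis unfolding v_def[abs_def] U[symmetric] .
  qed
  have g1: "GDERIV v x :> cnj (q1 x)" if x: "x \<in> ball zB r" for x
  proof -
    have "x \<in> ball zO \<rho>" using x B_sub ball_subset_cball by blast
    from DERIV_cmult[OF hat[OF this], of "of_real (1 - contrast)"]
    have "GDERIV (\<lambda>z. Re (of_real (1 - contrast) * h z)) x :> cnj (q1 x)"
      unfolding q1_def by (rule GDERIV_Re(1))
    then show ?thesis
      unfolding gderiv_def
      by (rule has_derivative_transform_within_open[of _ _ _ _ "ball zB r"]) (use x in \<open>auto simp: v_def\<close>)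
  qed
  have g2: "GDERIV v x :> cnj (q2 x)" if x: "x \<in> ball zO \<rho> - cball zB r" for x
  proof -
    have x': "x \<in> ball zO \<rho>" "x \<notin> ball zB r" using x by auto
    have "((\<lambda>z. h z - of_real contrast * cnj (h (RB z))) has_field_derivative q2 x) (at x)"
      using DERIV_diff[OF hat[OF x'(1)] DERIV_cmult[OF holomorphic_cnj_RB[OF hat x'(2)], of "of_real contrast"]]
      by (simp add: q2_def rd'_def)
    then have "GDERIV (\<lambda>z. Re (h z - of_real contrast * cnj (h (RB z)))) x :> cnj (q2 x)"
      by (rule GDERIV_Re(1))
    then show ?thesis
      unfolding gderiv_def
      by (rule has_derivative_transform_within_open[of _ _ _ _ "ball zO \<rho> - cball zB r"])
         (use x in \<open>auto simp: v_def open_Diff\<close>)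
  qed
  have q1c: "q1 holomorphic_on ball zB r" "continuous_on (cball zB r) q1"
    unfolding q1_def[abs_def] using B_sub ball_subset_cball
    by (intro holomorphic_intros holomorphic_on_subset[OF hd'_holomorphic], blast,
        intro continuous_intros continuous_on_subset[OF hd'_continuous], blast)
  have q2c: "q2 holomorphic_on ball zO \<rho> - cball zB r" "continuous_on (cball zO \<rho> - ball zB r) q2"
    unfolding q2_def[abs_def]
    by (intro holomorphic_intros holomorphic_on_subset[OF hd'_holomorphic] rd'_holomorphic, blast,
        intro continuous_intros continuous_on_subset[OF hd'_continuous] rd'_continuous, blast)
  obtain c where c: "\<And>x. x \<in> cball zO \<rho> \<Longrightarrow> u x = v x + c"
    using conductivity_solution_unique[OF r B_sub k vc g1 g2 q1c q2c transmission_flux boundary_flux u] by blast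
  have gu: "gradient u x = D" if "GDERIV v x :> D" "x \<in> ball zO \<rho>" for x D
  proof (rule gradient_eqI)
    have "GDERIV (\<lambda>z. v z + c) x :> D + 0"
      by (rule GDERIV_add[OF that(1) GDERIV_const])
    then show "GDERIV u x :> D"
      unfolding gderiv_def add_0_right
      by (rule has_derivative_transform_within_open[of _ _ _ _ "ball zO \<rho>"]) (use that(2) c in auto)
  qed
  show "gradient u x = cnj (q1 x)" if "x \<in> ball zB r" for x
    by (rule gu[OF g1[OF that]]) (use that B_sub ball_subset_cball in blast)
  show "gradient u x = cnj (q2 x)" if "x \<in> ball zO \<rho> - cball zB r" for x
    by (rule gu[OF g2[OF that]]) (use that in blast)
qed

end

subsection \<open>Bounds for the gradient\<close>

lemma borel_measurable_lebesgue_on_AE: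
  fixes f h :: "complex \<Rightarrow> complex"
  assumes f: "f \<in> borel_measurable (lebesgue_on S)" and S: "S \<in> sets lebesgue"
    and ae: "AE x in lebesgue_on S. f x = h x"
  shows "h \<in> borel_measurable (lebesgue_on S)"
proof -
  have "(\<lambda>x. if x \<in> S then f x else 0) \<in> borel_measurable lebesgue"
    using f S by (simp add: borel_measurable_if)
  moreover have "AE x in lebesgue. (if x \<in> S then f x else 0) = (if x \<in> S then h x else 0)"
    using ae S by (simp add: AE_restrict_space_iff)
  ultimately have "(\<lambda>x. if x \<in> S then h x else 0) \<in> borel_measurable lebesgue"
    by (rule borel_measurable_AE)
  then show ?thesis using S by (simp add: borel_measurable_if)
qed

context transmission
begin

text \<open>The bound 4 for the derivatives of the iterates is doubled: inside B by the factor 1 -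
  \<sigma> < 2, outside by the reflected field, whose factor r^2 / |x - zB|^2 is at most 1.\<close>

lemma q_bounds:
  shows "x \<in> ball zB r \<Longrightarrow> norm (q1 x) \<le> 8 * bnd / (1 - \<bar>contrast\<bar> * lam)"
    and "x \<in> ball zO \<rho> - ball zB r \<Longrightarrow> norm (q2 x) \<le> 8 * bnd / (1 - \<bar>contrast\<bar> * lam)"
proof -
  define K where "K = 4 * bnd / (1 - \<bar>contrast\<bar> * lam)"
  have K0: "0 \<le> K" using bnd_nonneg ratio by (simp add: K_def)
  have K2: "8 * bnd / (1 - \<bar>contrast\<bar> * lam) = 2 * K" by (simp add: K_def)
  have hb: "norm (hd' z) \<le> K" if "z \<in> cball zO \<rho>" for z
    unfolding K_def by (rule hd'_bound[OF that])
  show "norm (q1 x) \<le> 8 * bnd / (1 - \<bar>contrast\<bar> * lam)" if "x \<in> ball zB r"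
  proof -
    have x: "x \<in> cball zO \<rho>" using that B_sub ball_subset_cball by blast
    have "norm (q1 x) = \<bar>1 - contrast\<bar> * norm (hd' x)"
      by (simp add: q1_def norm_mult del: of_real_diff)
    also have "\<dots> \<le> 2 * K"
      using contrast(1) hb[OF x] K0 by (intro mult_mono) auto
    finally show ?thesis unfolding K2 .
  qed
  show "norm (q2 x) \<le> 8 * bnd / (1 - \<bar>contrast\<bar> * lam)" if "x \<in> ball zO \<rho> - ball zB r"
  proof -
    have x: "x \<in> cball zO \<rho>" "x \<notin> ball zB r" using that by auto
    have n: "r \<le> norm (x - zB)" using x(2) by (simp add: dist_norm norm_minus_commute)
    have "norm (rd' x) = norm (hd' (RB x)) * (r\<^sup>2 / (norm (x - zB))\<^sup>2)"
      by (simp add: rd'_def norm_mult norm_divide norm_power)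
    also have "\<dots> \<le> K * 1"
    proof (intro mult_mono hb RB_in_cball(2)[OF x(2)])
      have "r\<^sup>2 \<le> (norm (x - zB))\<^sup>2" using n r by (intro power_mono) auto
      then show "r\<^sup>2 / (norm (x - zB))\<^sup>2 \<le> 1" using n r by (simp add: divide_le_eq_1)
    qed (use K0 in auto)
    finally have rd: "norm (rd' x) \<le> K" by simp
    have "norm (q2 x) \<le> norm (hd' x) + \<bar>contrast\<bar> * norm (rd' x)"
      unfolding q2_def by (rule order_trans[OF norm_triangle_ineq]) (simp add: norm_mult)
    also have "\<dots> \<le> K + 1 * K"
      using hb[OF x(1)] rd contrast(1) K0 by (intro add_mono mult_mono) auto
    finally show ?thesis unfolding K2 by simp
  qed
qed

text \<open>On \<partial>B nothing is known about \<open>gradient u\<close>. The circle is a null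
  set and Lebesgue measure is complete, so measurability and the bound are inherited from the
  explicit field.\<close>

lemma gradient_esssup:
  assumes u: "conductivity_solution zO \<rho> zB r k g u"
  shows "esssup (lebesgue_on (ball zO \<rho>)) (\<lambda>X. ereal (norm (gradient u X)))
    \<le> ereal (8 * bnd / (1 - \<bar>contrast\<bar> * lam))"
proof (rule esssup_I)
  let ?M = "lebesgue_on (ball zO \<rho>)"
  define p where "p x = (if x \<in> ball zB r then q1 x else q2 x)" for x
  have eq: "gradient u x = cnj (p x)" if "x \<in> ball zO \<rho>" "x \<notin> sphere zB r" for x
    using solution_gradient[OF u, of x] that by (cases "x \<in> ball zB r") (auto simp: p_def less_le)
  have q1c: "continuous_on (cball zB r) q1"
    unfolding q1_def[abs_def] using B_sub ball_subset_cball
    by (intro continuous_intros continuous_on_subset[OF hd'_continuous]) blast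
  have q2c: "continuous_on (cball zO \<rho> - ball zB r) q2"
    unfolding q2_def[abs_def]
    by (intro continuous_intros continuous_on_subset[OF hd'_continuous] rd'_continuous) blast
  have pm: "p \<in> borel_measurable ?M"
    unfolding p_def[abs_def] by (rule piecewise_bounded_measurable(1)[OF q1c q2c])
  have "cnj \<in> borel_measurable borel"
    by (intro borel_measurable_continuous_onI continuous_intros)
  from measurable_compose[OF pm this] have pm': "(\<lambda>x. cnj (p x)) \<in> borel_measurable ?M" .
  have ae: "AE x in ?M. cnj (p x) = gradient u x"
    using AE_lebesgue_on_sphere[where zO = zO and \<rho> = \<rho> and zB = zB and r = r] AE_space
    by eventually_elim (simp add: eq)
  have "gradient u \<in> borel_measurable ?M"
    by (rule borel_measurable_lebesgue_on_AE[OF pm' _ ae]) simp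
  then show "(\<lambda>X. ereal (norm (gradient u X))) \<in> borel_measurable ?M" by measurable
  show "AE x in ?M. ereal (norm (gradient u x)) \<le> ereal (8 * bnd / (1 - \<bar>contrast\<bar> * lam))"
    using AE_lebesgue_on_sphere[where zO = zO and \<rho> = \<rho> and zB = zB and r = r] AE_space
  proof eventually_elim
    case (elim x)
    then have "norm (gradient u x) = norm (p x)" by (simp add: eq)
    also have "\<dots> \<le> 8 * bnd / (1 - \<bar>contrast\<bar> * lam)"
      using q_bounds[of x] elim by (auto simp: p_def)
    finally show ?case by simp
  qed
qed

lemma gradient_tendsto:
  assumes u: "conductivity_solution zO \<rho> zB r k g u" and X: "X \<in> cball zO \<rho> - ball zB r"
  shows "(gradient u \<longlongrightarrow> cnj (q2 X)) (at X within ball zO \<rho> - cball zB r)"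
proof -
  have "continuous_on (cball zO \<rho> - ball zB r) q2"
    unfolding q2_def[abs_def]
    by (intro continuous_intros continuous_on_subset[OF hd'_continuous] rd'_continuous) blast
  then have "(q2 \<longlongrightarrow> q2 X) (at X within cball zO \<rho> - ball zB r)"
    using X by (simp add: continuous_on_def)
  then have "(q2 \<longlongrightarrow> q2 X) (at X within ball zO \<rho> - cball zB r)"
    by (rule tendsto_within_subset) auto
  then have "((\<lambda>x. cnj (q2 x)) \<longlongrightarrow> cnj (q2 X)) (at X within ball zO \<rho> - cball zB r)"
    by (rule tendsto_cnj)
  moreover have "\<forall>\<^sub>F x in at X within ball zO \<rho> - cball zB r. cnj (q2 x) = gradient u x"
    unfolding eventually_at_filter by (rule always_eventually) (use solution_gradient(2)[OF u] in auto)
  ultimately show ?thesis by (rule Lim_transform_eventually)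
qed

text \<open>At the point of the line of centers with coordinate y this is -2 times the derivative of
  the potential in direction \<open>\<i> * e\<close>, the common tangent direction of both circles
  at X_1 and X_2.\<close>

definition axis :: "real \<Rightarrow> real" where "axis y = Re (\<i> * e * f0 (zO + of_real y * e))"

lemma axis_in: "\<bar>y\<bar> \<le> \<rho> \<Longrightarrow> zO + of_real y * e \<in> cball zO \<rho>"
  "\<bar>y\<bar> < \<rho> \<Longrightarrow> zO + of_real y * e \<in> ball zO \<rho>"
  using e by (simp_all add: dist_norm norm_mult)

lemma axis_continuous: "continuous_on {p1..\<rho>} axis"
  unfolding axis_def[abs_def]
proof (intro continuous_intros)
  show "continuous_on {p1..\<rho>} (\<lambda>y. f0 (zO + of_real y * e))"
    by (rule continuous_on_compose2[OF f0_continuous])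
       (use p1_less axis_in(1) in \<open>auto intro!: continuous_intros simp del: mem_cball\<close>)
qed

text \<open>All iterates of a point of the axis stay on the axis, and all terms of the series have the same sign.\<close>

lemma axis_lower:
  assumes x: "p1 \<le> x" "x \<le> \<rho>" and m: "m > 0" and le: "\<And>y. p1 \<le> y \<Longrightarrow> y \<le> x \<Longrightarrow> m \<le> \<bar>axis y\<bar>"
    and c: "contrast \<le> 0"
  obtains s where "\<bar>s\<bar> = 1" "m / (1 - \<bar>contrast\<bar> * lam) \<le> s * Re (\<i> * e * hd' (zO + of_real x * e))"
    "s * axis x \<le> s * Re (\<i> * e * hd' (zO + of_real x * e))"
proof -
  define s where "s = sgn (axis x)"
  have ax0: "axis y \<noteq> 0" if "p1 \<le> y" "y \<le> x" for y using le[OF that] m by auto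
  have s1: "\<bar>s\<bar> = 1" using ax0[of x] x by (simp add: s_def abs_sgn)
  have cont: "continuous_on {p1..x} axis"
    by (rule continuous_on_subset[OF axis_continuous]) (use x in auto)
  \<comment> \<open>A continuous function whose modulus stays above m > 0 on an interval cannot
    change sign there, by the intermediate value theorem.\<close>
  have sgn: "m \<le> s * axis y" if y: "p1 \<le> y" "y \<le> x" for y
  proof -
    have con: "continuous_on {y..x} axis" by (rule continuous_on_subset[OF cont]) (use y in auto)
    have "s * axis y > 0"
    proof (rule ccontr)
      assume neg: "\<not> s * axis y > 0"
      have sx: "s * axis x > 0" using ax0[of x] x by (simp add: s_def sgn_mult_self_eq mult.commute[of "sgn _"] flip: abs_sgn)
      have "continuous_on {y..x} (\<lambda>y. s * axis y)" by (intro continuous_intros con)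
      then have "\<exists>t\<ge>y. t \<le> x \<and> s * axis t = 0"
        using IVT'[of "\<lambda>y. s * axis y" y 0 x] neg sx y by auto
      then obtain t where "y \<le> t" "t \<le> x" "s * axis t = 0" by blast
      then show False using ax0[of t] s1 y by auto
    qed
    moreover have "\<bar>s * axis y\<bar> = \<bar>axis y\<bar>" using s1 by (simp add: abs_mult)
    ultimately show ?thesis using le[OF y] by linarith
  qed
  let ?X = "zO + of_real x * e"
  have X: "?X \<in> cball zO \<rho>" using x p1_less by (intro axis_in(1)) auto
  define t where "t n = s * Re (\<i> * e * summand n ?X)" for n
  have tb: "m * (\<bar>contrast\<bar> * lam) ^ n \<le> t n" for n
  proof -
    obtain y q where y: "p1 \<le> y" "y \<le> x" "moeb n ?X = zO + of_real y * e"
      and q: "moeb' n ?X = of_real q" "lam ^ n \<le> q"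
      using moeb_axis[OF x, of n] by metis
    \<comment> \<open>For \<sigma> \<le> 0 the powers of -\<sigma> are powers of |\<sigma>|. With
      \<sigma> > 0 the series would alternate.\<close>
    have "\<i> * e * summand n ?X = of_real (\<bar>contrast\<bar> ^ n * q) * (\<i> * e * f0 (zO + of_real y * e))"
      unfolding summand_def y(3) q(1) using c by (simp add: mult_ac)
    moreover have "Re (of_real a * w) = a * Re w" for a w by simp
    ultimately have "Re (\<i> * e * summand n ?X) = \<bar>contrast\<bar> ^ n * q * axis y"
      unfolding axis_def by (simp only:)
    then have "t n = \<bar>contrast\<bar> ^ n * (q * (s * axis y))" by (simp add: t_def)
    moreover have "\<bar>contrast\<bar> ^ n * (lam ^ n * m) \<le> \<bar>contrast\<bar> ^ n * (q * (s * axis y))"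
      using q(2) sgn[OF y(1,2)] m lam by (intro mult_left_mono mult_mono) (auto intro: order_trans[OF _ q(2)])
    ultimately show ?thesis by (simp add: power_mult_distrib mult_ac)
  qed
  have bl: "bounded_linear (\<lambda>w. s * Re (\<i> * e * w))"
    by (rule bounded_linear_compose[OF bounded_linear_mult_right
          bounded_linear_compose[OF bounded_linear_Re bounded_linear_mult_right]])
  have sums: "t sums (s * Re (\<i> * e * hd' ?X))"
    unfolding t_def hd'_def by (rule bounded_linear.sums[OF bl summable_sums[OF summand_summable[OF X]]])
  have g: "(\<lambda>n. m * (\<bar>contrast\<bar> * lam) ^ n) sums (m * (1 / (1 - \<bar>contrast\<bar> * lam)))"
    by (intro sums_mult geometric_sums) (use ratio in simp)
  have 1: "m / (1 - \<bar>contrast\<bar> * lam) \<le> s * Re (\<i> * e * hd' ?X)"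
    using sums_le[OF tb g sums] by simp
  have nn: "0 \<le> t n" for n
    by (rule order_trans[OF _ tb]) (use m lam in simp)
  have "t 0 \<le> s * Re (\<i> * e * hd' ?X)"
  proof -
    have "sum t {..<1} \<le> suminf t"
      by (rule sum_le_suminf[OF sums_summable[OF sums]]) (use nn in auto)
    then show ?thesis using sums_unique[OF sums] by simp
  qed
  moreover have "t 0 = s * axis x" by (simp add: t_def summand_def moeb_0 moeb'_0 axis_def)
  ultimately show ?thesis using that[OF s1 1] by simp
qed

lemma layer_deriv_inside:
  assumes "X \<in> ball zO \<rho>"
  shows "single_layer_deriv zO \<rho> g (\<i> * e) X = - Re (\<i> * e * f0 X) / 2"
proof -
  have "X \<notin> sphere zO \<rho>" using assms by auto
  then have "single_layer_deriv zO \<rho> g (\<i> * e) X = cnj (layer_field zO \<rho> g X) \<bullet> (\<i> * e)"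
    by (simp add: single_layer_deriv_def cd.gradient_single_layer del: mem_sphere)
  also have "\<dots> = Re (\<i> * e * cd.field X)"
    unfolding cd.field_eq_layer_field[OF assms] by (simp add: inner_complex_def algebra_simps)
  finally show ?thesis by (simp add: f0_def)
qed

text \<open>The points at distances y and \<rho>^2/y from the center are reflections of each other.
  The conversion factor y^2/\<rho>^2 is at most 1, so lower bounds outside are inherited by
  \<open>axis\<close>.\<close>

lemma layer_deriv_outside:
  assumes y: "0 < y" "y < \<rho>"
  shows "single_layer_deriv zO \<rho> g (\<i> * e) (zO + of_real (\<rho>\<^sup>2 / y) * e) = - (y\<^sup>2 / \<rho>\<^sup>2) * axis y / 2"
proof -
  let ?X = "zO + of_real y * e" and ?Y = "zO + of_real (\<rho>\<^sup>2 / y) * e"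
  have X: "?X \<in> ball zO \<rho>" "?X \<noteq> zO" using axis_in(2)[of y] y e0 by auto
  have R: "circle_reflection zO \<rho> ?X = ?Y"
    using y e by (simp add: circle_reflection_def scaleR_conv_of_real norm_mult power2_eq_square)
  have "\<rho> * y < \<rho> * \<rho>" using y by simp
  then have ry: "\<rho> < \<rho>\<^sup>2 / y" using y by (simp add: pos_less_divide_eq power2_eq_square)
  have "dist zO ?Y = \<rho>\<^sup>2 / y" using e y by (simp add: dist_norm norm_mult norm_divide norm_power)
  then have nY: "?Y \<notin> sphere zO \<rho>" using ry by auto
  have "single_layer_deriv zO \<rho> g (\<i> * e) ?Y = cnj (layer_field zO \<rho> g ?Y) \<bullet> (\<i> * e)"
    by (simp only: single_layer_deriv_def cd.gradient_single_layer[OF nY] nY if_False)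
  also have "layer_field zO \<rho> g ?Y = - cnj ((?X - zO)\<^sup>2 / of_real (\<rho>\<^sup>2) * layer_field zO \<rho> g ?X)"
    using cd.layer_field_reflection[OF X] unfolding R .
  also have "cnj \<dots> \<bullet> (\<i> * e) = - (y\<^sup>2 / \<rho>\<^sup>2) * ((e\<^sup>2 * cd.field ?X) \<bullet> (\<i> * e))"
  proof -
    have "cnj (- cnj ((?X - zO)\<^sup>2 / of_real (\<rho>\<^sup>2) * layer_field zO \<rho> g ?X)) = (- (y\<^sup>2 / \<rho>\<^sup>2)) *\<^sub>R (e\<^sup>2 * cd.field ?X)"
      unfolding cd.field_eq_layer_field[OF X(1)] by (simp add: scaleR_conv_of_real power_mult_distrib)
    then show ?thesis by (simp only: inner_scaleR_left)
  qed
  also have "(e\<^sup>2 * cd.field ?X) \<bullet> (\<i> * e) = - Re (\<i> * e * cd.field ?X)"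
  proof -
    have ee: "e * cnj e = 1" using complex_norm_square[of e] e by simp
    have i: "a \<bullet> b = Re (a * cnj b)" for a b by (simp add: inner_complex_def)
    have "e\<^sup>2 * cd.field ?X * cnj (\<i> * e) = - (\<i> * e * cd.field ?X) * (e * cnj e)"
      by (simp add: power2_eq_square algebra_simps)
    then show ?thesis unfolding i ee by (simp only: mult_1_right uminus_complex.sel)
  qed
  also have "Re (\<i> * e * cd.field ?X) = - axis y / 2"
    by (simp add: axis_def f0_def)
  finally show ?thesis by simp
qed

lemma inf_le_layer_deriv:
  assumes "X \<in> S"
  shows "(INF X\<in>S. \<bar>single_layer_deriv zO \<rho> g T X\<bar>) \<le> \<bar>single_layer_deriv zO \<rho> g T X\<bar>"
  by (rule cINF_lower[OF _ assms]) (auto intro!: bdd_belowI2[where m = 0])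

lemma inf_layer_deriv_nonneg:
  assumes "S \<noteq> {}"
  shows "0 \<le> (INF X\<in>S. \<bar>single_layer_deriv zO \<rho> g T X\<bar>)"
  using assms by (intro cINF_greatest) auto

lemma segment_axis:
  assumes "a \<le> y" "y \<le> b"
  shows "zO + of_real y * e \<in> closed_segment (zO + of_real a * e) (zO + of_real b * e)"
    "zO + of_real y * e \<in> closed_segment (zO + of_real b * e) (zO + of_real a * e)"
proof -
  have "y \<in> closed_segment a b" using assms by (simp add: closed_segment_eq_real_ivl)
  then obtain t where t: "0 \<le> t" "t \<le> 1" "y = (1 - t) * a + t * b" by (auto simp: closed_segment_def)
  have "zO + of_real y * e = (1 - t) *\<^sub>R (zO + of_real a * e) + t *\<^sub>R (zO + of_real b * e)"
    unfolding t(3) by (simp add: scaleR_conv_of_real algebra_simps)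
  then show "zO + of_real y * e \<in> closed_segment (zO + of_real a * e) (zO + of_real b * e)"
    using t by (auto simp: closed_segment_def)
  then show "zO + of_real y * e \<in> closed_segment (zO + of_real b * e) (zO + of_real a * e)"
    by (simp add: closed_segment_commute)
qed

text \<open>At X_1 reflection flips the tangential component, so that of the solution from outside
  is 1 - \<sigma> \<ge> 1 times that of h, to which the one-signed series applies. The factor 2 is
  that of f against the gradient of the potential.\<close>

lemma lower_X1:
  assumes c: "contrast \<le> 0"
  defines "J \<equiv> closed_segment (zO + of_real p1 * e) (zO + of_real (d + r) * e)"
  shows "2 * (INF X\<in>J. \<bar>single_layer_deriv zO \<rho> g (\<i> * e) X\<bar>) / (1 - \<bar>contrast\<bar> * lam)
    \<le> norm (q2 (zO + of_real (d + r) * e))"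
proof -
  define m where "m = (INF X\<in>J. \<bar>single_layer_deriv zO \<rho> g (\<i> * e) X\<bar>)"
  let ?X = "zO + of_real (d + r) * e"
  show ?thesis
  proof (cases "m > 0")
    case False
    have "m \<ge> 0" unfolding m_def by (rule inf_layer_deriv_nonneg) (simp add: J_def)
    with False have "m = 0" by simp
    then show ?thesis by (simp add: m_def[symmetric])
  next
    case True
    have le: "2 * m \<le> \<bar>axis y\<bar>" if y: "p1 \<le> y" "y \<le> d + r" for y
    proof -
      have "zO + of_real y * e \<in> J" unfolding J_def by (rule segment_axis(1)[OF y])
      from inf_le_layer_deriv[OF this, of "\<i> * e"]
      have "m \<le> \<bar>single_layer_deriv zO \<rho> g (\<i> * e) (zO + of_real y * e)\<bar>" by (simp add: m_def)
      moreover have "zO + of_real y * e \<in> ball zO \<rho>" using y dr p1_less by (intro axis_in(2)) auto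
      ultimately show ?thesis by (simp add: layer_deriv_inside axis_def del: mem_ball)
    qed
    obtain s where s: "\<bar>s\<bar> = 1" "2 * m / (1 - \<bar>contrast\<bar> * lam) \<le> s * Re (\<i> * e * hd' ?X)"
      using axis_lower[of "d + r" "2 * m"] le p1_in dr True c by (metis less_imp_le mult_pos_pos zero_less_numeral)
    have pos: "0 \<le> 2 * m / (1 - \<bar>contrast\<bar> * lam)" using True ratio by simp
    have XB: "?X \<in> sphere zB r" using e r by (simp add: zB_def dist_norm algebra_simps norm_mult)
    have "of_real r * e * rd' ?X = cnj (of_real r * e * hd' ?X)"
      using transmission_reflection[OF XB] by (simp add: zB_def algebra_simps)
    then have rr: "e * rd' ?X = cnj (e * hd' ?X)"
      using r by (simp add: mult.assoc)
    \<comment> \<open>Multiplication by \<open>\<i> * e\<close> followed by \<open>Re\<close>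
      extracts the tangential component of the conjugate field.\<close>
    have "Re (\<i> * (e * q2 ?X)) = (1 - contrast) * Re (\<i> * e * hd' ?X)"
    proof -
      have "\<i> * (e * q2 ?X) = \<i> * (e * hd' ?X) + of_real contrast * (\<i> * cnj (e * hd' ?X))"
        unfolding rr[symmetric] q2_def by (simp add: algebra_simps)
      moreover have "Re (\<i> * (e * hd' ?X) + of_real contrast * (\<i> * cnj (e * hd' ?X))) = (1 - contrast) * Re (\<i> * (e * hd' ?X))"
        by (simp add: algebra_simps)
      ultimately show ?thesis by (simp only: mult.assoc)
    qed
    then have "\<bar>Re (\<i> * (e * q2 ?X))\<bar> = (1 - contrast) * \<bar>s * Re (\<i> * e * hd' ?X)\<bar>"
      using c s(1) by (simp only: abs_mult)
    moreover have "1 * \<bar>s * Re (\<i> * e * hd' ?X)\<bar> \<le> (1 - contrast) * \<bar>s * Re (\<i> * e * hd' ?X)\<bar>"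
      using c by (intro mult_right_mono) auto
    moreover have "\<bar>Re (\<i> * (e * q2 ?X))\<bar> \<le> norm (\<i> * (e * q2 ?X))" by (rule abs_Re_le_cmod)
    moreover have "norm (\<i> * (e * q2 ?X)) = norm (q2 ?X)" using e by (simp add: norm_mult)
    ultimately show ?thesis using s(2) pos unfolding m_def[symmetric] by linarith
  qed
qed

text \<open>On \<partial>\<Omega> the reflected field is conjugate to the image term Y in h = f -
  \<sigma> Y, so tangentially the solution is h - \<sigma> Y = 2 h - f. As f is the zeroth term of a
  series whose terms have one sign along the axis, |2 h - f| \<ge> |h| there.\<close>

lemma lower_X2:
  assumes c: "contrast \<le> 0"
  defines "J \<equiv> closed_segment (zO + of_real p2 * e) (zO + of_real \<rho> * e)"
  shows "2 * (INF X\<in>J. \<bar>single_layer_deriv zO \<rho> g (\<i> * e) X\<bar>) / (1 - \<bar>contrast\<bar> * lam)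
    \<le> norm (q2 (zO + of_real \<rho> * e))"
proof -
  define m where "m = (INF X\<in>J. \<bar>single_layer_deriv zO \<rho> g (\<i> * e) X\<bar>)"
  let ?X = "zO + of_real \<rho> * e"
  show ?thesis
  proof (cases "m > 0")
    case False
    have "m \<ge> 0" unfolding m_def by (rule inf_layer_deriv_nonneg) (simp add: J_def)
    with False have "m = 0" by simp
    then show ?thesis by (simp add: m_def[symmetric])
  next
    case True
    \<comment> \<open>Reflection in \<partial>\<Omega> maps the half-open segment of points at or
      beyond P_1 and before X_2 into J_2, because p1 p2 = \<rho>^2.\<close>
    have le0: "2 * m \<le> \<bar>axis y\<bar>" if y: "p1 \<le> y" "y < \<rho>" for y
    proof -
      have y0: "0 < y" using y p1_less by linarith
      have "\<rho> * y \<le> \<rho> * \<rho>" using y rho by simp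
      then have 1: "\<rho> \<le> \<rho>\<^sup>2 / y" using y0 by (simp add: pos_le_divide_eq power2_eq_square)
      have "p1 * p2 \<le> y * p2" using y p2_gt rho by (intro mult_right_mono) auto
      then have 2: "\<rho>\<^sup>2 / y \<le> p2" using y0 by (simp add: p_prod pos_divide_le_eq mult.commute)
      have "zO + of_real (\<rho>\<^sup>2 / y) * e \<in> J" unfolding J_def by (rule segment_axis(2)[OF 1 2])
      from inf_le_layer_deriv[OF this, of "\<i> * e"]
      have "m \<le> \<bar>- (y\<^sup>2 / \<rho>\<^sup>2) * axis y / 2\<bar>"
        unfolding m_def layer_deriv_outside[OF y0 y(2)] .
      then have "2 * m \<le> (y\<^sup>2 / \<rho>\<^sup>2) * \<bar>axis y\<bar>" by (simp add: abs_mult)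
      also have "\<dots> \<le> 1 * \<bar>axis y\<bar>"
      proof (rule mult_right_mono)
        have "y\<^sup>2 \<le> \<rho>\<^sup>2" using y y0 by (intro power_mono) auto
        then show "y\<^sup>2 / \<rho>\<^sup>2 \<le> 1" using rho by simp
      qed simp
      finally show ?thesis by simp
    qed
    \<comment> \<open>At y = \<rho> the derivative of the potential is a boundary limit; the bound
      is obtained there from continuity of \<open>axis\<close> instead.\<close>
    have le: "2 * m \<le> \<bar>axis y\<bar>" if y: "p1 \<le> y" "y \<le> \<rho>" for y
    proof (rule continuous_ge_on_closure[where S = "{p1..<\<rho>}" and f = "\<lambda>y. \<bar>axis y\<bar>"])
      have cl: "closure {p1..<\<rho>} = {p1..\<rho>}" using p1_less by simp
      show "continuous_on (closure {p1..<\<rho>}) (\<lambda>y. \<bar>axis y\<bar>)"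
        unfolding cl by (intro continuous_intros axis_continuous)
      show "y \<in> closure {p1..<\<rho>}" unfolding cl using y by simp
    qed (use le0 in auto)
    obtain s where s: "\<bar>s\<bar> = 1" "2 * m / (1 - \<bar>contrast\<bar> * lam) \<le> s * Re (\<i> * e * hd' ?X)"
      "s * axis \<rho> \<le> s * Re (\<i> * e * hd' ?X)"
      using axis_lower[of \<rho> "2 * m"] le p1_less True c by (metis less_imp_le order_refl mult_pos_pos zero_less_numeral)
    have XO: "?X \<in> sphere zO \<rho>" using e rho by (simp add: dist_norm norm_mult)
    then have Xc: "?X \<in> cball zO \<rho>" by auto
    define Y where "Y = moeb' 1 ?X * hd' (moeb 1 ?X)"
    have "of_real \<rho> * e * Y = cnj (of_real \<rho> * e * rd' ?X)"
      using boundary_reflection[OF XO] by (simp add: Y_def)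
    then have "e * Y = cnj (e * rd' ?X)" using rho by (simp add: mult.assoc)
    then have rr: "e * rd' ?X = cnj (e * Y)" by (metis complex_cnj_cnj)
    have hY: "hd' ?X = f0 ?X - of_real contrast * Y" unfolding Y_def by (rule hd'_fixed[OF Xc])
    \<comment> \<open>Eliminating Y between the formulas for the solution and for h.\<close>
    have "Re (\<i> * (e * q2 ?X)) = 2 * Re (\<i> * e * hd' ?X) - axis \<rho>"
    proof -
      have "\<i> * (e * q2 ?X) = \<i> * e * hd' ?X + of_real contrast * (\<i> * cnj (e * Y))"
        unfolding rr[symmetric] q2_def by (simp add: algebra_simps)
      moreover have "Re (\<i> * cnj (e * Y)) = - Re (\<i> * (e * Y))" by simp
      moreover have s: "Re (of_real a * w) = a * Re w" for a w by simp
      ultimately have "Re (\<i> * (e * q2 ?X)) = Re (\<i> * e * hd' ?X) - contrast * Re (\<i> * (e * Y))"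
        by (simp only: plus_complex.sel s mult_minus_right add_uminus_conv_diff)
      moreover have "\<i> * e * hd' ?X = \<i> * e * f0 ?X - of_real contrast * (\<i> * (e * Y))"
        unfolding hY by (simp add: algebra_simps)
      then have "Re (\<i> * e * hd' ?X) = axis \<rho> - contrast * Re (\<i> * (e * Y))"
        unfolding axis_def by (simp only: minus_complex.sel s)
      ultimately show ?thesis by linarith
    qed
    then have "s * Re (\<i> * (e * q2 ?X)) = 2 * (s * Re (\<i> * e * hd' ?X)) - s * axis \<rho>"
      by (simp only: right_diff_distrib mult.left_commute)
    moreover have "s * Re (\<i> * (e * q2 ?X)) \<le> \<bar>s * Re (\<i> * (e * q2 ?X))\<bar>" by (rule abs_ge_self)
    moreover have "\<bar>s * Re (\<i> * (e * q2 ?X))\<bar> = \<bar>Re (\<i> * (e * q2 ?X))\<bar>" using s(1) by (simp only: abs_mult mult_1_left)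
    moreover have "\<bar>Re (\<i> * (e * q2 ?X))\<bar> \<le> norm (\<i> * (e * q2 ?X))" by (rule abs_Re_le_cmod)
    moreover have "norm (\<i> * (e * q2 ?X)) = norm (q2 ?X)" using e by (simp add: norm_mult)
    ultimately show ?thesis using s(2,3) unfolding m_def[symmetric] by linarith
  qed
qed

end

subsection \<open>Closest points and fixed points of the reflections\<close>

lemma circle_reflection_eq:
  assumes "X \<noteq> z"
  shows "circle_reflection z s X = z + of_real (s\<^sup>2) / cnj (X - z)"
proof -
  define w where "w = X - z"
  have w: "w \<noteq> 0" using assms by (simp add: w_def)
  have "(s\<^sup>2 / (norm w)\<^sup>2) *\<^sub>R w = of_real (s\<^sup>2) * (w / of_real ((norm w)\<^sup>2))"
    by (simp add: scaleR_conv_of_real)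
  also have "w / of_real ((norm w)\<^sup>2) = 1 / cnj w"
    using w by (simp only: complex_norm_square) simp
  finally show ?thesis by (simp add: circle_reflection_def w_def)
qed

lemma circle_reflection_center [simp]: "circle_reflection z s z = z"
  by (simp add: circle_reflection_def)

lemma norm_circle_reflection: "norm (circle_reflection z s X - z) = s\<^sup>2 / norm (X - z)"
  by (simp add: circle_reflection_def power2_eq_square)

lemma infdist_sphere_ge:
  fixes X z :: complex
  assumes "0 \<le> s"
  shows "\<bar>dist X z - s\<bar> \<le> infdist X (sphere z s)"
proof -
  have ne: "sphere z s \<noteq> {}" using assms by simp
  have "\<bar>dist X z - s\<bar> \<le> dist X y" if "y \<in> sphere z s" for y
    using that dist_triangle[of X z y] dist_triangle[of z y X] by (auto simp: dist_commute)
  then show ?thesis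
    unfolding infdist_notempty[OF ne] by (intro cINF_greatest ne)
qed

lemma setdist_ball_sphere:
  fixes zO e :: complex
  assumes e: "norm e = 1" and r: "0 < r" and d: "0 \<le> d" and dr: "d + r \<le> \<rho>"
  shows "setdist (ball (zO + of_real d * e) r) (sphere zO \<rho>) = \<rho> - d - r"
proof (rule antisym)
  let ?B = "ball (zO + of_real d * e) r" and ?a = "zO + of_real (d + r) * e" and ?b = "zO + of_real \<rho> * e"
  have "dist (zO + of_real d * e) ?a = norm (of_real r * e)"
    by (simp add: dist_norm norm_minus_commute[of "zO + of_real d * e"] algebra_simps)
  then have "?a \<in> closure ?B" using r e by (simp add: norm_mult)
  moreover have "?b \<in> sphere zO \<rho>" using d r dr e by (simp add: dist_norm norm_mult)
  ultimately have "setdist (closure ?B) (sphere zO \<rho>) \<le> dist ?a ?b"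
    by (rule setdist_le_dist)
  also have "dist ?a ?b = norm (of_real (d + r - \<rho>) * e)"
    by (simp add: dist_norm algebra_simps)
  also have "\<dots> = \<rho> - d - r" using dr e by (simp only: norm_mult norm_of_real) simp
  finally show "setdist ?B (sphere zO \<rho>) \<le> \<rho> - d - r"
    by simp
  show "\<rho> - d - r \<le> setdist ?B (sphere zO \<rho>)"
  proof (rule le_setdistI)
    fix x y assume x: "x \<in> ?B" and y: "y \<in> sphere zO \<rho>"
    have "dist zO (zO + of_real d * e) = d" using d e by (simp add: dist_norm norm_mult)
    then show "\<rho> - d - r \<le> dist x y"
      using x y dist_triangle[of zO y x] dist_triangle[of zO x "zO + of_real d * e"] by simp
  qed (use r d dr in auto)
qed

text \<open>The equality case of the triangle inequality: x has norm a and is parallel to e. It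
  makes closest points unique.\<close>

lemma eq_scaled_unit:
  fixes x e :: complex
  assumes e: "norm e = 1" and d: "0 < d" and x: "norm x \<le> a" and s: "a + d \<le> norm (x + of_real d * e)"
  shows "x = of_real a * e"
proof -
  have de: "norm (of_real d * e) = d" using e d by (simp add: norm_mult)
  then have n: "norm x = a" and "norm (x + of_real d * e) = norm x + norm (of_real d * e)"
    using norm_triangle_ineq[of x "of_real d * e"] x s by linarith+
  then have "a *\<^sub>R (of_real d * e) = d *\<^sub>R x"
    unfolding norm_triangle_eq using n de by simp
  then show ?thesis using d by (simp add: scaleR_conv_of_real)
qed

context nested_disks
begin

lemma dist_axis: "dist (zO + of_real a * e) (zO + of_real b * e) = \<bar>a - b\<bar>"
proof -
  have "dist (zO + of_real a * e) (zO + of_real b * e) = norm (of_real (a - b) * e)"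
    by (simp add: dist_norm algebra_simps)
  then show ?thesis using e by (simp only: norm_mult norm_of_real) simp
qed

lemma axis_on_circles:
  "zO + of_real (d + r) * e \<in> sphere zB r" "zO + of_real \<rho> * e \<in> sphere zO \<rho>"
  using dist_axis[of d "d + r"] dist_axis[of 0 \<rho>] r rho by (simp_all add: zB_def)

text \<open>The axis point realizes the distance \<rho> - d - r, so a minimizer is at distance at
  least d + r from the center of \<Omega>. On \<partial>B this is the largest possible distance,
  attained only on the axis.\<close>

lemma closest_inner:
  assumes "is_arg_min (\<lambda>X. infdist X (sphere zO \<rho>)) (\<lambda>X. X \<in> sphere zB r) X1"
  shows "X1 = zO + of_real (d + r) * e" "circle_tangent zB r X1 = \<i> * e"
proof -
  let ?a = "zO + of_real (d + r) * e"
  have X1: "X1 \<in> sphere zB r" and "\<not> infdist ?a (sphere zO \<rho>) < infdist X1 (sphere zO \<rho>)"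
    using assms axis_on_circles(1) unfolding is_arg_min_def by blast+
  then have "infdist X1 (sphere zO \<rho>) \<le> infdist ?a (sphere zO \<rho>)" by simp
  also have "\<dots> \<le> dist ?a (zO + of_real \<rho> * e)"
    by (rule infdist_le) (rule axis_on_circles)
  also have "\<dots> = \<rho> - d - r" unfolding dist_axis using dr by simp
  finally have "d + r \<le> norm (X1 - zO)"
    using infdist_sphere_ge[of \<rho> X1 zO] rho by (simp add: dist_norm)
  then have "X1 - zB = of_real r * e"
    using X1 by (intro eq_scaled_unit[OF e d]) (auto simp: zB_def dist_norm norm_minus_commute)
  then show "X1 = zO + of_real (d + r) * e" "circle_tangent zB r X1 = \<i> * e"
    using r by (auto simp: zB_def circle_tangent_def scaleR_conv_of_real algebra_simps)
qed

lemma closest_outer: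
  assumes "is_arg_min (\<lambda>X. infdist X (sphere zB r)) (\<lambda>X. X \<in> sphere zO \<rho>) X2"
  shows "X2 = zO + of_real \<rho> * e" "circle_tangent zO \<rho> X2 = \<i> * e"
proof -
  let ?b = "zO + of_real \<rho> * e"
  have X2: "X2 \<in> sphere zO \<rho>" and "\<not> infdist ?b (sphere zB r) < infdist X2 (sphere zB r)"
    using assms axis_on_circles(2) unfolding is_arg_min_def by blast+
  then have "infdist X2 (sphere zB r) \<le> infdist ?b (sphere zB r)" by simp
  also have "\<dots> \<le> dist ?b (zO + of_real (d + r) * e)"
    by (rule infdist_le) (rule axis_on_circles)
  also have "\<dots> = \<rho> - d - r" unfolding dist_axis using dr by simp
  finally have "norm (X2 - zB) \<le> \<rho> - d"
    using infdist_sphere_ge[of r X2 zB] r by (simp add: dist_norm)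
  then have "X2 - zB = of_real (\<rho> - d) * e"
    using X2 by (intro eq_scaled_unit[OF e d]) (auto simp: zB_def dist_norm norm_minus_commute)
  then show X: "X2 = zO + of_real \<rho> * e"
    by (simp add: zB_def algebra_simps)
  show "circle_tangent zO \<rho> X2 = \<i> * e"
    using rho unfolding X by (simp add: circle_tangent_def scaleR_conv_of_real)
qed

text \<open>The center of \<Omega> is excluded because \<open>circle_reflection\<close> fixes it, by
  division by zero, whereas the Moebius map sends it to the center of B.\<close>

lemma reflections_eq_moeb:
  assumes Q: "Q \<in> ball zO \<rho>" "Q \<noteq> zO"
  shows "circle_reflection zB r (circle_reflection zO \<rho> Q) = moeb 1 Q"
proof -
  define w where "w = Q - zO"
  have w: "w \<noteq> 0" using Q by (simp add: w_def)
  have den: "of_real (\<rho>\<^sup>2) - of_real d * cnj e * w \<noteq> 0"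
    unfolding w_def by (rule denB_nonzero) (use Q in auto)
  have c: "cnj (circle_reflection zO \<rho> Q - zB) = (of_real (\<rho>\<^sup>2) - of_real d * cnj e * w) / w"
    using w by (simp add: circle_reflection_eq[OF Q(2)] zB_def w_def[symmetric] diff_divide_distrib)
  then have ne: "circle_reflection zO \<rho> Q \<noteq> zB"
    using den w by auto
  have "circle_reflection zB r (circle_reflection zO \<rho> Q)
      = zB + of_real (r\<^sup>2) * w / (of_real (\<rho>\<^sup>2) - of_real d * cnj e * w)"
    unfolding circle_reflection_eq[OF ne] c by simp
  then show ?thesis
    using moeb_1(1)[of Q] Q by (simp add: w_def)
qed

text \<open>The fixed point equation is quadratic, and its second root, p2, lies outside the
  disk.\<close>

lemma moeb_fixed:
  assumes Q: "Q \<in> ball zO \<rho>" and fixed: "moeb 1 Q = Q"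
  shows "Q = zO + of_real p1 * e"
proof (rule ccontr)
  define u where "u = Q - zO - of_real p1 * e"
  assume "\<not> ?thesis"
  then have u: "u \<noteq> 0" by (auto simp: u_def algebra_simps)
  have "den 1 Q = of_real (p2 - p1) * e - u + of_real lam * u"
    by (simp add: den_def u_def algebra_simps)
  moreover have den: "den 1 Q \<noteq> 0" using Q by (intro den_nonzero) auto
  moreover have "of_real (lam * (p2 - p1)) * e * u / den 1 Q = u"
    using fixed by (simp add: moeb_def u_def algebra_simps)
  ultimately have "of_real (lam * (p2 - p1)) * e * u = (of_real (p2 - p1) * e - u + of_real lam * u) * u"
    by (simp add: divide_eq_eq mult.commute)
  then have "of_real (lam * (p2 - p1)) * e = of_real (p2 - p1) * e - u + of_real lam * u"
    using u by simp
  then have "(1 - of_real lam) * (of_real (p2 - p1) * e - u) = 0"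
    by (simp add: algebra_simps)
  moreover have "1 - of_real lam \<noteq> (0::complex)"
    using lam(2) by (metis eq_iff_diff_eq_0 less_irrefl of_real_1 of_real_eq_iff)
  ultimately have "u = of_real (p2 - p1) * e" by simp
  then have "Q = zO + of_real p2 * e" by (simp add: u_def algebra_simps)
  then have "dist zO Q = p2" using p2_gt rho e by (simp add: dist_norm norm_mult)
  then show False using Q p2_gt by simp
qed

lemma fixed_inner:
  assumes P: "P1 \<in> ball zB r" "(circle_reflection zB r \<circ> circle_reflection zO \<rho>) P1 = P1"
  shows "P1 = zO + of_real p1 * e"
proof -
  \<comment> \<open>The spurious fixed point of \<open>circle_reflection\<close> at the center of
    \<Omega> would be fixed by the product only if d = r, and then it lies on \<partial>B instead of
    inside B.\<close>
  have "P1 \<noteq> zO"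
  proof
    assume P1: "P1 = zO"
    then have "norm (zO - zB) = r\<^sup>2 / norm (zO - zB)"
      using P(2) norm_circle_reflection[of zB r zO] by simp
    moreover have "norm (zO - zB) = d" using zB_dist by (simp add: dist_norm)
    ultimately have "d\<^sup>2 = r\<^sup>2" using d by (simp add: field_simps power2_eq_square)
    then have "d = r" using d r by simp
    then show False using P(1) P1 zB_dist by (simp add: dist_commute)
  qed
  moreover have "P1 \<in> ball zO \<rho>" using P(1) B_sub ball_subset_cball by blast
  ultimately show ?thesis
    using P(2) reflections_eq_moeb[of P1] by (intro moeb_fixed) auto
qed

text \<open>The reflection of P_2 in \<partial>B is a fixed point of the other product inside
  \<Omega>, hence P_1, and P_2 is its reflection in \<partial>\<Omega>.\<close>

lemma fixed_outer:
  assumes P: "P2 \<notin> ball zO \<rho>" "(circle_reflection zO \<rho> \<circ> circle_reflection zB r) P2 = P2"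
  shows "P2 = zO + of_real p2 * e"
proof -
  define Q where "Q = circle_reflection zB r P2"
  have PQ: "circle_reflection zO \<rho> Q = P2" using P(2) by (simp add: Q_def)
  have "P2 \<notin> ball zB r" using P(1) B_sub ball_subset_cball by blast
  then have n: "r \<le> norm (P2 - zB)" by (simp add: dist_norm norm_minus_commute)
  have "norm (Q - zB) \<le> r"
    unfolding Q_def norm_circle_reflection using n r
    by (simp add: divide_le_eq power2_eq_square)
  then have "Q \<in> cball zB r" by (simp add: dist_norm norm_minus_commute)
  then have Q: "Q \<in> ball zO \<rho>" using B_sub by blast
  have Q0: "Q \<noteq> zO"
  proof
    assume "Q = zO"
    then have "P2 = zO" using PQ by simp
    then show False using P(1) rho by simp
  qed
  have "Q = zO + of_real p1 * e"
    using reflections_eq_moeb[OF Q Q0] PQ by (intro moeb_fixed[OF Q]) (simp add: Q_def)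
  then have "P2 = zO + of_real (\<rho>\<^sup>2) / (of_real p1 * cnj e)"
    using PQ circle_reflection_eq[OF Q0, of \<rho>] by simp
  moreover have "e * cnj e = 1" using e by (simp add: complex_norm_square[symmetric])
  then have "1 / cnj e = e" using e0 by (simp add: field_simps)
  then have "of_real (\<rho>\<^sup>2) / (of_real p1 * cnj e) = of_real (p1 * p2) / of_real p1 * e"
    unfolding p_prod by (metis divide_divide_eq_left mult.right_neutral times_divide_eq_right)
  ultimately show ?thesis using p1_less by simp
qed

end

text \<open>For concentric circles the product is the dilation by (\<rho>/r)^2 about the center. So
  the existence of P_2 forces d > 0.\<close>

lemma concentric_no_fixed:
  assumes "0 < r" "r < \<rho>" "P \<noteq> z"
  shows "(circle_reflection z \<rho> \<circ> circle_reflection z r) P \<noteq> P"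
proof
  assume "(circle_reflection z \<rho> \<circ> circle_reflection z r) P = P"
  then have "norm (P - z) = \<rho>\<^sup>2 / (r\<^sup>2 / norm (P - z))"
    by (metis comp_apply norm_circle_reflection)
  then have "\<rho>\<^sup>2 = r\<^sup>2" using assms by (simp add: field_simps)
  then show False using assms by simp
qed

section \<open>The estimates in terms of \<sigma>, the radii and the gap\<close>

context transmission
begin

text \<open>The last bound is (1 - |\<sigma>|)(1 - lam) \<ge> 0 expanded. The lower bounds serve
  (ii), the upper one serves (i).\<close>

lemma rate: "0 < 1 - \<bar>contrast\<bar> * lam" "1 - \<bar>contrast\<bar> \<le> 1 - \<bar>contrast\<bar> * lam"
    "1 - lam \<le> 1 - \<bar>contrast\<bar> * lam"
    "1 - \<bar>contrast\<bar> * lam \<le> 1 - \<bar>contrast\<bar> + (1 - lam)"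
proof -
  have 1: "\<bar>contrast\<bar> * lam \<le> \<bar>contrast\<bar> * 1" "\<bar>contrast\<bar> * lam \<le> 1 * lam"
    using contrast(1) lam by (intro mult_mono; simp)+
  have "0 \<le> (1 - \<bar>contrast\<bar>) * (1 - lam)"
    using contrast(1) lam by (intro mult_nonneg_nonneg) auto
  then show "0 < 1 - \<bar>contrast\<bar> * lam" "1 - \<bar>contrast\<bar> \<le> 1 - \<bar>contrast\<bar> * lam"
    "1 - lam \<le> 1 - \<bar>contrast\<bar> * lam" "1 - \<bar>contrast\<bar> * lam \<le> 1 - \<bar>contrast\<bar> + (1 - lam)"
    using 1 ratio(2) by (auto simp: algebra_simps)
qed

text \<open>For \<sigma> \<le> 0 the number 1 + \<sigma> is 1 - |\<sigma>|, and
  \<open>lam_upper\<close> bounds the remaining 1 - lam.\<close>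

lemma divide_rate_le:
  assumes c: "contrast \<le> 0" and a: "0 \<le> a"
  shows "2 * a / (1 + contrast + 4 * sqrt ((\<rho> - r) / (\<rho> * r)) * sqrt gap) \<le> 2 * a / (1 - \<bar>contrast\<bar> * lam)"
proof (rule divide_left_mono)
  show le: "1 - \<bar>contrast\<bar> * lam \<le> 1 + contrast + 4 * sqrt ((\<rho> - r) / (\<rho> * r)) * sqrt gap"
    using rate(4) lam_upper c by linarith
  then show "0 < (1 + contrast + 4 * sqrt ((\<rho> - r) / (\<rho> * r)) * sqrt gap) * (1 - \<bar>contrast\<bar> * lam)"
    using rate(1) by (intro mult_pos_pos) linarith+
qed (use a in simp)

text \<open>Near X_1 the complement of B lies in \<Omega>, so the limit from outside B is the
  boundary value of the explicit outer field.\<close>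

lemma inner_lower_bound:
  assumes u: "conductivity_solution zO \<rho> zB r k g u" and c: "contrast \<le> 0"
    and X1: "X1 = zO + of_real (d + r) * e" and P1: "P1 = zO + of_real p1 * e"
  shows "\<exists>A. (gradient u \<longlongrightarrow> A) (at X1 within - cball zB r) \<and>
    2 * (INF X\<in>closed_segment P1 X1. \<bar>single_layer_deriv zO \<rho> g (\<i> * e) X\<bar>)
      / (1 + contrast + 4 * sqrt ((\<rho> - r) / (\<rho> * r)) * sqrt gap) \<le> norm A"
proof (intro exI conjI)
  have X: "X1 \<in> sphere zB r" unfolding X1 by (rule axis_on_circles)
  then have "X1 \<in> ball zO \<rho>" using B_sub by (meson sphere_cball subsetD)
  then have "at X1 within (- cball zB r) = at X1 within (ball zO \<rho> - cball zB r)"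
    by (intro at_within_nhd[of _ "ball zO \<rho>"]) auto
  moreover have "X1 \<in> cball zO \<rho> - ball zB r"
    using X \<open>X1 \<in> ball zO \<rho>\<close> by simp
  ultimately show "(gradient u \<longlongrightarrow> cnj (q2 X1)) (at X1 within - cball zB r)"
    using gradient_tendsto[OF u] by simp
  show "2 * (INF X\<in>closed_segment P1 X1. \<bar>single_layer_deriv zO \<rho> g (\<i> * e) X\<bar>)
      / (1 + contrast + 4 * sqrt ((\<rho> - r) / (\<rho> * r)) * sqrt gap) \<le> norm (cnj (q2 X1))"
    unfolding complex_mod_cnj X1 P1
    by (rule order_trans[OF divide_rate_le[OF c] lower_X1[OF c]]) (rule inf_layer_deriv_nonneg, simp)
qed

lemma outer_lower_bound:
  assumes u: "conductivity_solution zO \<rho> zB r k g u" and c: "contrast \<le> 0"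
    and X2: "X2 = zO + of_real \<rho> * e" and P2: "P2 = zO + of_real p2 * e"
  shows "\<exists>A. (gradient u \<longlongrightarrow> A) (at X2 within ball zO \<rho>) \<and>
    2 * (INF X\<in>closed_segment P2 X2. \<bar>single_layer_deriv zO \<rho> g (\<i> * e) X\<bar>)
      / (1 + contrast + 4 * sqrt ((\<rho> - r) / (\<rho> * r)) * sqrt gap) \<le> norm A"
proof (intro exI conjI)
  have X: "X2 \<in> sphere zO \<rho>" unfolding X2 by (rule axis_on_circles)
  then have nB: "X2 \<notin> cball zB r" using B_sub by (metis less_irrefl mem_ball mem_sphere subsetD)
  then have "at X2 within ball zO \<rho> = at X2 within (ball zO \<rho> - cball zB r)"
    by (intro at_within_nhd[of _ "- cball zB r"]) auto
  moreover have "X2 \<in> cball zO \<rho> - ball zB r"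
    using X nB by simp
  ultimately show "(gradient u \<longlongrightarrow> cnj (q2 X2)) (at X2 within ball zO \<rho>)"
    using gradient_tendsto[OF u] by simp
  show "2 * (INF X\<in>closed_segment P2 X2. \<bar>single_layer_deriv zO \<rho> g (\<i> * e) X\<bar>)
      / (1 + contrast + 4 * sqrt ((\<rho> - r) / (\<rho> * r)) * sqrt gap) \<le> norm (cnj (q2 X2))"
    unfolding complex_mod_cnj X2 P2
    by (rule order_trans[OF divide_rate_le[OF c] lower_X2[OF c]]) (rule inf_layer_deriv_nonneg, simp)
qed

lemma upper_bound:
  assumes u: "conductivity_solution zO \<rho> zB r k g u"
    and s: "sqrt ((\<rho> - r) / (\<rho> * r)) * sqrt gap \<le> 1"
  shows "esssup (lebesgue_on (ball zO \<rho>)) (\<lambda>X. ereal (norm (gradient u X)))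
    \<le> ereal (24 * bnd / (1 - \<bar>contrast\<bar> + sqrt ((\<rho> - r) / (\<rho> * r)) * sqrt gap))"
proof -
  define s where "s = sqrt ((\<rho> - r) / (\<rho> * r)) * sqrt gap"
  have s0: "0 \<le> s" using d dr r rho gap_pos by (simp add: s_def)
  \<comment> \<open>The rate dominates both 1 - |\<sigma>| and s/2, so it dominates a third of 1 -
    |\<sigma>| + s. Together with 8 from \<open>q_bounds\<close> this gives 24.\<close>
  have "a + s \<le> 3 * b" if "a \<le> b" "l \<le> b" "s / 2 \<le> l" for a b l :: real
    using that by linarith
  from this[OF rate(2,3) lam_lower[OF s, folded s_def]]
  have "1 - \<bar>contrast\<bar> + s \<le> 3 * (1 - \<bar>contrast\<bar> * lam)" .
  moreover have "0 < 1 - \<bar>contrast\<bar> + s" using contrast(1) s0 by linarith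
  ultimately have "24 * bnd / (3 * (1 - \<bar>contrast\<bar> * lam)) \<le> 24 * bnd / (1 - \<bar>contrast\<bar> + s)"
    using bnd_nonneg rate(1) by (intro divide_left_mono mult_pos_pos) auto
  moreover have "24 * a / (3 * b) = 8 * a / b" for a b :: real
    by simp
  ultimately show ?thesis
    using gradient_esssup[OF u] unfolding s_def[symmetric] by (metis ereal_less_eq(3) order_trans)
qed

end

lemma disk_frame:
  fixes zO zB :: complex
  assumes r: "0 < r" and B: "ball zB r \<subseteq> ball zO \<rho>" and eps: "0 < setdist (ball zB r) (sphere zO \<rho>)"
  obtains e d where "norm e = 1" "0 \<le> d" "zB = zO + of_real d * e" "d + r < \<rho>"
    "setdist (ball zB r) (sphere zO \<rho>) = \<rho> - d - r"
proof -
  \<comment> \<open>For concentric disks any direction will do.\<close>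
  define e where "e = (if zB = zO then 1 else sgn (zB - zO))"
  define d where "d = norm (zB - zO)"
  have e: "norm e = 1" by (simp add: e_def norm_sgn)
  have zB: "zB = zO + of_real d * e" by (simp add: e_def d_def sgn_eq)
  have "d + r \<le> \<rho>" using B r by (auto simp: ball_subset_ball_iff d_def dist_norm)
  moreover from this have s: "setdist (ball zB r) (sphere zO \<rho>) = \<rho> - d - r"
    unfolding zB using e r by (intro setdist_ball_sphere) (auto simp: d_def)
  ultimately show ?thesis using that[OF e _ zB _ s] eps by (simp add: d_def)
qed

theorem theorem1p3:
  fixes zO :: complex and \<rho> \<alpha> :: real
  assumes "0 < \<rho>" and "0 < \<alpha>"
  shows
    "(\<exists>C1>0. \<exists>\<epsilon>0>0. \<forall>r>0. \<forall>k zB g u X1 X2 P1 P2 \<epsilon> \<sigma> rs.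
        0 < k \<and> k < 1 \<and>
        ball zB r \<subseteq> ball zO \<rho> \<and>
        holder_circle zO \<rho> \<alpha> g \<and> arc_integral zO \<rho> g = 0 \<and>
        conductivity_solution zO \<rho> zB r k g u \<and>
        \<epsilon> = setdist (ball zB r) (sphere zO \<rho>) \<and>
        \<sigma> = (k - 1) / (k + 1) \<and>
        rs = sqrt ((\<rho> - r) / (\<rho> * r)) \<and>
        is_arg_min (\<lambda>X. infdist X (sphere zO \<rho>)) (\<lambda>X. X \<in> sphere zB r) X1 \<and>
        is_arg_min (\<lambda>X. infdist X (sphere zB r)) (\<lambda>X. X \<in> sphere zO \<rho>) X2 \<and>
        P1 \<in> ball zB r \<and> (circle_reflection zB r \<circ> circle_reflection zO \<rho>) P1 = P1 \<and>
        P2 \<notin> ball zO \<rho> \<and> (circle_reflection zO \<rho> \<circ> circle_reflection zB r) P2 = P2 \<and>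
        0 < \<epsilon> \<and> \<epsilon> < \<epsilon>0
        \<longrightarrow>
        (\<exists>A. (gradient u \<longlongrightarrow> A) (at X1 within - cball zB r) \<and>
           C1 * (INF X \<in> closed_segment P1 X1.
                   \<bar>single_layer_deriv zO \<rho> g (circle_tangent zB r X1) X\<bar>)
             / (1 + \<sigma> + 4 * rs * sqrt \<epsilon>) \<le> norm A) \<and>
        (\<exists>A. (gradient u \<longlongrightarrow> A) (at X2 within ball zO \<rho>) \<and>
           C1 * (INF X \<in> closed_segment P2 X2.
                   \<bar>single_layer_deriv zO \<rho> g (circle_tangent zO \<rho> X2) X\<bar>)
             / (1 + \<sigma> + 4 * rs * sqrt \<epsilon>) \<le> norm A)) \<and>
     (\<exists>C2. \<forall>r>0. \<exists>\<epsilon>0>0. \<forall>k zB g u \<epsilon> \<sigma> rs.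
        0 < k \<and> k \<noteq> 1 \<and>
        ball zB r \<subseteq> ball zO \<rho> \<and>
        holder_circle zO \<rho> \<alpha> g \<and> arc_integral zO \<rho> g = 0 \<and>
        conductivity_solution zO \<rho> zB r k g u \<and>
        \<epsilon> = setdist (ball zB r) (sphere zO \<rho>) \<and>
        \<sigma> = (k - 1) / (k + 1) \<and>
        rs = sqrt ((\<rho> - r) / (\<rho> * r)) \<and>
        0 < \<epsilon> \<and> \<epsilon> < \<epsilon>0
        \<longrightarrow>
        esssup (lebesgue_on (ball zO \<rho>)) (\<lambda>X. ereal (norm (gradient u X)))
          \<le> ereal (C2 * holder_norm zO \<rho> \<alpha> g / (1 - \<bar>\<sigma>\<bar> + rs * sqrt \<epsilon>)))"
proof -
  obtain \<beta> where b: "0 < \<beta>" "\<beta> \<le> 1"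
    and N0: "\<And>g. holder_circle zO \<rho> \<alpha> g \<Longrightarrow> 0 \<le> holder_norm zO \<rho> \<alpha> g"
    and hol: "\<And>g x y. holder_circle zO \<rho> \<alpha> g \<Longrightarrow> x \<in> sphere zO \<rho> \<Longrightarrow> y \<in> sphere zO \<rho> \<Longrightarrow>
       \<bar>g x - g y\<bar> \<le> 3 * holder_norm zO \<rho> \<alpha> g * dist x y powr \<beta>"
    by (rule holder_norm_controls[OF assms, of zO]) blast
  have tr: "transmission zO e \<rho> r d g (3 * holder_norm zO \<rho> \<alpha> g) \<beta> k"
    if "norm e = 1" "0 < r" "0 < d" "d + r < \<rho>" "0 < k" "holder_circle zO \<rho> \<alpha> g" "arc_integral zO \<rho> g = 0"
    for e r d k g
    using that assms b N0[OF that(6)] hol[OF that(6)] by unfold_locales auto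
  \<comment> \<open>The leading 6 is the factor 2 of f against the layer field times the factor 3 of
    \<open>holder_norm_controls\<close>; the rest is the integral bound of
    \<open>field_bound\<close>. K depends on \<rho> and \<beta> only.\<close>
  define K where "K = 6 * (6 * \<rho> powr \<beta> * integral {0..2*pi} (circle_density.major \<beta>) / (2 * pi))"
  show ?thesis
  proof (rule conjI)
    show "(\<exists>C1>0. \<exists>\<epsilon>0>0. \<forall>r>0. \<forall>k zB g u X1 X2 P1 P2 \<epsilon> \<sigma> rs.
        0 < k \<and> k < 1 \<and>
        ball zB r \<subseteq> ball zO \<rho> \<and>
        holder_circle zO \<rho> \<alpha> g \<and> arc_integral zO \<rho> g = 0 \<and>
        conductivity_solution zO \<rho> zB r k g u \<and>
        \<epsilon> = setdist (ball zB r) (sphere zO \<rho>) \<and>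
        \<sigma> = (k - 1) / (k + 1) \<and>
        rs = sqrt ((\<rho> - r) / (\<rho> * r)) \<and>
        is_arg_min (\<lambda>X. infdist X (sphere zO \<rho>)) (\<lambda>X. X \<in> sphere zB r) X1 \<and>
        is_arg_min (\<lambda>X. infdist X (sphere zB r)) (\<lambda>X. X \<in> sphere zO \<rho>) X2 \<and>
        P1 \<in> ball zB r \<and> (circle_reflection zB r \<circ> circle_reflection zO \<rho>) P1 = P1 \<and>
        P2 \<notin> ball zO \<rho> \<and> (circle_reflection zO \<rho> \<circ> circle_reflection zB r) P2 = P2 \<and>
        0 < \<epsilon> \<and> \<epsilon> < \<epsilon>0
        \<longrightarrow>
        (\<exists>A. (gradient u \<longlongrightarrow> A) (at X1 within - cball zB r) \<and>
           C1 * (INF X \<in> closed_segment P1 X1.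
                   \<bar>single_layer_deriv zO \<rho> g (circle_tangent zB r X1) X\<bar>)
             / (1 + \<sigma> + 4 * rs * sqrt \<epsilon>) \<le> norm A) \<and>
        (\<exists>A. (gradient u \<longlongrightarrow> A) (at X2 within ball zO \<rho>) \<and>
           C1 * (INF X \<in> closed_segment P2 X2.
                   \<bar>single_layer_deriv zO \<rho> g (circle_tangent zO \<rho> X2) X\<bar>)
             / (1 + \<sigma> + 4 * rs * sqrt \<epsilon>) \<le> norm A))"
    \<comment> \<open>The witness 2 for \<open>C1\<close> is the factor between f and the gradient
      of the potential.\<close>
    proof (rule exI[of _ 2], rule conjI, simp, rule exI[of _ 1], rule conjI, simp, intro allI impI, elim conjE)
      fix r k zB g u X1 X2 P1 P2 \<epsilon> \<sigma> rs
      assume r: "0 < r" and k: "0 < k" "k < 1" and B: "ball zB r \<subseteq> ball zO \<rho>"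
        and g: "holder_circle zO \<rho> \<alpha> g" "arc_integral zO \<rho> g = 0"
        and u: "conductivity_solution zO \<rho> zB r k g u"
        and eps: "\<epsilon> = setdist (ball zB r) (sphere zO \<rho>)" and sig: "\<sigma> = (k - 1) / (k + 1)"
        and rs: "rs = sqrt ((\<rho> - r) / (\<rho> * r))"
        and X: "is_arg_min (\<lambda>X. infdist X (sphere zO \<rho>)) (\<lambda>X. X \<in> sphere zB r) X1"
          "is_arg_min (\<lambda>X. infdist X (sphere zB r)) (\<lambda>X. X \<in> sphere zO \<rho>) X2"
        and P1: "P1 \<in> ball zB r" "(circle_reflection zB r \<circ> circle_reflection zO \<rho>) P1 = P1"
        and P2: "P2 \<notin> ball zO \<rho>" "(circle_reflection zO \<rho> \<circ> circle_reflection zB r) P2 = P2"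
        and e0: "0 < \<epsilon>"
      obtain e d where e: "norm e = 1" "0 \<le> d" and zB: "zB = zO + of_real d * e" and dr: "d + r < \<rho>"
        and sd: "setdist (ball zB r) (sphere zO \<rho>) = \<rho> - d - r"
        using disk_frame[OF r B e0[unfolded eps]] .
      \<comment> \<open>The fixed point P_2 outside \<Omega> rules out concentric disks.\<close>
      have "d \<noteq> 0"
      proof
        assume "d = 0"
        then have "zB = zO" "r < \<rho>" using zB dr by auto
        moreover have "P2 \<noteq> zO" using P2(1) assms(1) by auto
        ultimately show False using concentric_no_fixed[of r \<rho> P2 zO] r P2(2) by simp
      qed
      then have d: "0 < d" using e by simp
      interpret T: transmission zO e \<rho> r d g "3 * holder_norm zO \<rho> \<alpha> g" \<beta> k
        by (rule tr[OF e(1) r d dr k(1) g])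
      have zBT: "T.zB = zB" by (simp add: T.zB_def zB)
      have gap: "T.gap = \<epsilon>" using sd by (simp add: T.gap_def eps)
      have con: "T.contrast = \<sigma>" by (simp add: T.contrast_def sig)
      have c: "T.contrast \<le> 0" using k by (simp add: T.contrast_def divide_nonpos_pos)
      note ci = T.closest_inner[unfolded zBT, OF X(1)] and co = T.closest_outer[unfolded zBT, OF X(2)]
        and fi = T.fixed_inner[unfolded zBT, OF P1] and fo = T.fixed_outer[unfolded zBT, OF P2]
      have u': "conductivity_solution zO \<rho> T.zB r k g u" using u by (simp add: zBT)
      show "(\<exists>A. (gradient u \<longlongrightarrow> A) (at X1 within - cball zB r) \<and>
           2 * (INF X \<in> closed_segment P1 X1.
                   \<bar>single_layer_deriv zO \<rho> g (circle_tangent zB r X1) X\<bar>)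
             / (1 + \<sigma> + 4 * rs * sqrt \<epsilon>) \<le> norm A) \<and>
        (\<exists>A. (gradient u \<longlongrightarrow> A) (at X2 within ball zO \<rho>) \<and>
           2 * (INF X \<in> closed_segment P2 X2.
                   \<bar>single_layer_deriv zO \<rho> g (circle_tangent zO \<rho> X2) X\<bar>)
             / (1 + \<sigma> + 4 * rs * sqrt \<epsilon>) \<le> norm A)"
        unfolding ci(2) co(2) rs con[symmetric] gap[symmetric]
        using T.inner_lower_bound[OF u' c ci(1) fi] T.outer_lower_bound[OF u' c co(1) fo]
        unfolding zBT by simp
    qed
  next
    show "(\<exists>C2. \<forall>r>0. \<exists>\<epsilon>0>0. \<forall>k zB g u \<epsilon> \<sigma> rs.
        0 < k \<and> k \<noteq> 1 \<and>
        ball zB r \<subseteq> ball zO \<rho> \<and>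
        holder_circle zO \<rho> \<alpha> g \<and> arc_integral zO \<rho> g = 0 \<and>
        conductivity_solution zO \<rho> zB r k g u \<and>
        \<epsilon> = setdist (ball zB r) (sphere zO \<rho>) \<and>
        \<sigma> = (k - 1) / (k + 1) \<and>
        rs = sqrt ((\<rho> - r) / (\<rho> * r)) \<and>
        0 < \<epsilon> \<and> \<epsilon> < \<epsilon>0
        \<longrightarrow>
        esssup (lebesgue_on (ball zO \<rho>)) (\<lambda>X. ereal (norm (gradient u X)))
          \<le> ereal (C2 * holder_norm zO \<rho> \<alpha> g / (1 - \<bar>\<sigma>\<bar> + rs * sqrt \<epsilon>)))"
    proof (rule exI[of _ "24 * K"], intro allI impI)
      fix r :: real
      assume r: "0 < r"
      show "\<exists>\<epsilon>0>0. \<forall>k zB g u \<epsilon> \<sigma> rs. 0 < k \<and> k \<noteq> 1 \<and>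
          ball zB r \<subseteq> ball zO \<rho> \<and>
          holder_circle zO \<rho> \<alpha> g \<and> arc_integral zO \<rho> g = 0 \<and>
          conductivity_solution zO \<rho> zB r k g u \<and>
          \<epsilon> = setdist (ball zB r) (sphere zO \<rho>) \<and>
          \<sigma> = (k - 1) / (k + 1) \<and>
          rs = sqrt ((\<rho> - r) / (\<rho> * r)) \<and>
          0 < \<epsilon> \<and> \<epsilon> < \<epsilon>0
          \<longrightarrow>
          esssup (lebesgue_on (ball zO \<rho>)) (\<lambda>X. ereal (norm (gradient u X)))
            \<le> ereal (24 * K * holder_norm zO \<rho> \<alpha> g / (1 - \<bar>\<sigma>\<bar> + rs * sqrt \<epsilon>))"
      proof (cases "r < \<rho>")
        case True
        show ?thesis
        \<comment> \<open>A gap below \<rho> - r forces d > 0, and one below \<rho> r / (\<rho> - r)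
          makes the product of the square roots at most 1, as \<open>lam_lower\<close> requires. The
          threshold depends on r, the constant does not.\<close>
        proof (rule exI[of _ "min (\<rho> - r) (\<rho> * r / (\<rho> - r))"], rule conjI,
            use True r assms(1) in simp, intro allI impI, elim conjE)
          fix k zB g u \<epsilon> \<sigma> rs
          assume k: "0 < k" and B: "ball zB r \<subseteq> ball zO \<rho>"
            and g: "holder_circle zO \<rho> \<alpha> g" "arc_integral zO \<rho> g = 0"
            and u: "conductivity_solution zO \<rho> zB r k g u"
            and eps: "\<epsilon> = setdist (ball zB r) (sphere zO \<rho>)" and sig: "\<sigma> = (k - 1) / (k + 1)"
            and rs: "rs = sqrt ((\<rho> - r) / (\<rho> * r))"
            and e0: "0 < \<epsilon>" and small: "\<epsilon> < min (\<rho> - r) (\<rho> * r / (\<rho> - r))"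
          obtain e d where e: "norm e = 1" "0 \<le> d" and zB: "zB = zO + of_real d * e" and dr: "d + r < \<rho>"
            and sd: "setdist (ball zB r) (sphere zO \<rho>) = \<rho> - d - r"
            using disk_frame[OF r B e0[unfolded eps]] .
          have d: "0 < d" using small sd eps e by simp
          interpret T: transmission zO e \<rho> r d g "3 * holder_norm zO \<rho> \<alpha> g" \<beta> k
            by (rule tr[OF e(1) r d dr k g])
          have gap: "T.gap = \<epsilon>" using sd by (simp add: T.gap_def eps)
          have con: "T.contrast = \<sigma>" by (simp add: T.contrast_def sig)
          have bnd: "T.bnd = K * holder_norm zO \<rho> \<alpha> g" by (simp add: T.bnd_def K_def)
          have "(\<rho> - r) / (\<rho> * r) * \<epsilon> \<le> 1"
            using small True r assms(1) by (simp add: field_simps)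
          then have "sqrt ((\<rho> - r) / (\<rho> * r)) * sqrt T.gap \<le> 1"
            unfolding gap real_sqrt_mult[symmetric] by simp
          moreover have "conductivity_solution zO \<rho> T.zB r k g u"
            using u by (simp add: T.zB_def zB)
          ultimately show "esssup (lebesgue_on (ball zO \<rho>)) (\<lambda>X. ereal (norm (gradient u X)))
            \<le> ereal (24 * K * holder_norm zO \<rho> \<alpha> g / (1 - \<bar>\<sigma>\<bar> + rs * sqrt \<epsilon>))"
            using T.upper_bound[of u] unfolding bnd con gap rs by (simp only: mult.assoc)
        qed
      next
        case False
        \<comment> \<open>A disk of radius at least \<rho> cannot lie in \<Omega> at positive
          distance from its boundary, so the claim is vacuous.\<close>
        then have "\<not> 0 < setdist (ball zB r) (sphere zO \<rho>)" if "ball zB r \<subseteq> ball zO \<rho>" for zB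
          using disk_frame[OF r that] by force
        then show ?thesis by (intro exI[of _ 1]) auto
      qed
    qed
  qed
qed

end
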